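(* Let $\varphi\colon \mathbb{C}^n\to\mathbb{R}$ be a plurisubharmonic $C^2$ function and suppose that the weighted Bergman space $A^2(\mathbb{C}^n,e^{-\varphi})$ of entire functions is infinite dimensional. If there is $1\le q\le n$ such that the $\overline\partial$-Neumann operator $N^{\varphi}_{0,q}$ is compact, then $$\limsup_{z\to\infty}\operatorname{tr}(M_\varphi(z))=+\infty .$$
   Context: Let $\lambda$ be Lebesgue measure on $\mathbb{C}^n$ and let $\varphi\colon\mathbb{C}^n\to\mathbb{R}$ be $C^2$. Complex Hessian: $M_\varphi(z)=\left(\frac{\partial^2\varphi}{\partial z_j\partial\overline z_k}(z)\right)_{j,k=1}^n$, and $\operatorname{tr}$ denotes the trace. $z\to\infty$ means $|z|\to\infty$. Weighted Bergman space: $A^2(\mathbb{C}^n,e^{-\varphi})=\{f\colon\mathbb{C}^n\to\mathbb{C} : f \text{ entire},\ \int_{\mathbb{C}^n}|f|^2e^{-\varphi}\,d\lambda<\infty\}$. Weighted forms: $L^2_{0,q}(\mathbb{C}^n,e^{-\varphi})$ is the Hilbert space of $(0,q)$-forms $u=\sum'_{|J|=q}u_J\,d\overline z_J$ (the primed sum runs over increasing multiindices $J=(j_1,\dots,j_q)$ only, and $d\overline z_J=d\overline z_{j_1}\wedge\dots\wedge d\overline z_{j_q}$) with inner product $(u,v)_\varphi=\sum'_{|J|=q}\int_{\mathbb{C}^n}u_J\overline{v_J}\,e^{-\varphi}\,d\lambda$. The operator $\overline\partial u=\sum'_{|J|=q}\sum_{j=1}^n\frac{\partial u_J}{\partial\overline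 z_j}\,d\overline z_j\wedge d\overline z_J$ acts in the sense of distributions from $L^2_{0,q}(\mathbb{C}^n,e^{-\varphi})$ to $L^2_{0,q+1}(\mathbb{C}^n,e^{-\varphi})$ with maximal domain $\operatorname{dom}(\overline\partial)=\{f\in L^2_{0,q}(\mathbb{C}^n,e^{-\varphi}):\overline\partial f\in L^2_{0,q+1}(\mathbb{C}^n,e^{-\varphi})\}$ (and $\overline\partial=0$ on $(0,n)$-forms). Its Hilbert space adjoint with respect to $(\cdot,\cdot)_\varphi$ is $\overline\partial^*_\varphi$ (and $\overline\partial^*_\varphi=0$ on functions). The complex Laplacian is the positive self-adjoint operator $\square^\varphi_{0,q}=\overline\partial\,\overline\partial^*_\varphi+\overline\partial^*_\varphi\overline\partial$ on $L^2_{0,q}(\mathbb{C}^n,e^{-\varphi})$ with domain $\{u\in\operatorname{dom}(\overline\partial)\cap\operatorname{dom}(\overline\partial^*_\varphi):\overline\partial u\in\operatorname{dom}(\overline\partial^*_\varphi),\ \overline\partial^*_\varphi u\in\operatorname{dom}(\overline\partial)\}$. The $\overline\partial$-Neumann operator $N^\varphi_{0,q}\colon\operatorname{img}(\square^\varphi_{0,q})\to L^2_{0,q}(\mathbb{C}^n,e^{-\varphi})$ is the inverse of the restriction of $\square^\varphi_{0,q}$ to $\operatorname{dom}(\square^\varphi_{0,q})\cap\ker(\square^\varphi_{0,q})^\perp$. It is called bounded if it extends to a bounded operator on $L^2_{0,q}(\mathbb{C}^n,e^{-\varphi})$, equivalently if $\square^\varphi_{0,q}$ has closed range (the extension being by $0$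 on $\ker(\square^\varphi_{0,q})$), and compact if this bounded extension exists and is compact. *)

theory Defs
  imports "HOL-Analysis.Analysis" "HOL-Library.Function_Algebras"
begin

text \<open>\<open>\<complex>\<^sup>n\<close> is \<^typ>\<open>complex^'n\<close> for an arbitrary finite index type \<open>'n\<close>; the linear order on
  \<open>'n\<close> is used only to fix the signs of the wedge products.\<close>


section \<open>Differentiability\<close>

fun C_k :: "nat \<Rightarrow> ('a::euclidean_space \<Rightarrow> 'b::euclidean_space) \<Rightarrow> bool" where
  "C_k 0 f \<longleftrightarrow> continuous_on UNIV f"
| "C_k (Suc k) f \<longleftrightarrow> f differentiable_on UNIV \<and> (\<forall>v. C_k k (\<lambda>x. frechet_derivative f (at x) v))"

definition test_function :: "('a::euclidean_space \<Rightarrow> complex) \<Rightarrow> bool" where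
  "test_function \<psi> \<longleftrightarrow> (\<forall>k. C_k k \<psi>) \<and> compact (closure {x. \<psi> x \<noteq> 0})"

text \<open>Wirtinger derivatives: with \<open>z\<^sub>j = x\<^sub>j + \<i> y\<^sub>j\<close>, the directions \<open>axis j 1\<close> and \<open>axis j \<i>\<close> give the real
  partial derivatives in \<open>x\<^sub>j\<close> and \<open>y\<^sub>j\<close>.\<close>

definition d_z :: "'n::finite \<Rightarrow> (complex^'n \<Rightarrow> complex) \<Rightarrow> complex^'n \<Rightarrow> complex" where
  "d_z j f z = (frechet_derivative f (at z) (axis j 1)
                - \<i> * frechet_derivative f (at z) (axis j \<i>)) / 2"

definition d_zbar :: "'n::finite \<Rightarrow> (complex^'n \<Rightarrow> complex) \<Rightarrow> complex^'n \<Rightarrow> complex" where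
  "d_zbar j f z = (frechet_derivative f (at z) (axis j 1)
                   + \<i> * frechet_derivative f (at z) (axis j \<i>)) / 2"

definition complex_hessian :: "(complex^'n::finite \<Rightarrow> real) \<Rightarrow> complex^'n \<Rightarrow> complex^'n^'n" where
  "complex_hessian \<phi> z = (\<chi> j k. d_z j (d_zbar k (\<lambda>w. complex_of_real (\<phi> w))) z)"

text \<open>Upper semicontinuity and the sub-mean value property on all complex lines. The circle means of a
  finite-valued plurisubharmonic function are finite, so requiring integrability loses nothing.\<close>

definition plurisubharmonic :: "(complex^'n::finite \<Rightarrow> real) \<Rightarrow> bool" where
  "plurisubharmonic \<phi> \<longleftrightarrow>
     (\<forall>a. open {z. \<phi> z < a}) \<and>
     (\<forall>z w. (\<lambda>t. \<phi> (z + cis t *s w)) absolutely_integrable_on {0..2*pi} \<and>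
            \<phi> z \<le> integral {0..2*pi} (\<lambda>t. \<phi> (z + cis t *s w)) / (2 * pi))"


section \<open>The weighted Bergman space\<close>

definition entire :: "(complex^'n::finite \<Rightarrow> complex) \<Rightarrow> bool" where
  "entire f \<longleftrightarrow> (\<forall>z. \<exists>f'. (f has_derivative f') (at z) \<and> (\<forall>c h. f' (c *s h) = c * f' h))"

definition bergman_space :: "(complex^'n::finite \<Rightarrow> real) \<Rightarrow> (complex^'n \<Rightarrow> complex) set" where
  "bergman_space \<phi> = {f. entire f \<and> integrable lborel (\<lambda>z. (cmod (f z))\<^sup>2 * exp (- \<phi> z))}"

interpretation cfun: vector_space "\<lambda>(c::complex) (f::'a \<Rightarrow> complex) x. c * f x"
  by unfold_locales (auto simp: fun_eq_iff algebra_simps)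

definition infinite_dimensional :: "('a \<Rightarrow> complex) set \<Rightarrow> bool" where
  "infinite_dimensional V \<longleftrightarrow> \<not> (\<exists>B. finite B \<and> B \<subseteq> V \<and> V \<subseteq> cfun.span B)"


section \<open>Weighted forms\<close>

text \<open>A \<open>(0,q)\<close>-form is the family of its coefficients \<open>u J\<close>; an increasing multiindex of length \<open>q\<close> is
  identified with its underlying set \<open>J\<close>, \<open>card J = q\<close>. Coefficients in all other degrees are \<open>0\<close>.
  Elements of \<open>L\<^sup>2\<close> are represented by Borel functions, to be read modulo \<open>form_eq\<close>. Accordingly, unbounded
  operators are given by their graphs on representatives; these graphs are closed under \<open>form_eq\<close> and
  single-valued modulo \<open>form_eq\<close>.\<close>

type_synonym 'n form = "'n set \<Rightarrow> complex^'n \<Rightarrow> complex"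

definition L2 :: "(complex^'n::finite \<Rightarrow> real) \<Rightarrow> nat \<Rightarrow> 'n form set" where
  "L2 \<phi> q = {u. (\<forall>J. card J = q \<longrightarrow> u J \<in> borel_measurable lborel \<and>
                       integrable lborel (\<lambda>z. (cmod (u J z))\<^sup>2 * exp (- \<phi> z))) \<and>
                (\<forall>J. card J \<noteq> q \<longrightarrow> u J = 0)}"

definition form_eq :: "'n::finite form \<Rightarrow> 'n form \<Rightarrow> bool" where
  "form_eq u v \<longleftrightarrow> (\<forall>J. AE z in lborel. u J z = v J z)"

definition form_scale :: "complex \<Rightarrow> 'n::finite form \<Rightarrow> 'n form" where
  "form_scale c u = (\<lambda>J z. c * u J z)"

definition form_inner :: "(complex^'n::finite \<Rightarrow> real) \<Rightarrow> nat \<Rightarrow> 'n form \<Rightarrow> 'n form \<Rightarrow> complex" where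
  "form_inner \<phi> q u v =
     (\<Sum>J | card J = q. LINT z|lborel. u J z * cnj (v J z) * complex_of_real (exp (- \<phi> z)))"

definition form_norm :: "(complex^'n::finite \<Rightarrow> real) \<Rightarrow> nat \<Rightarrow> 'n form \<Rightarrow> real" where
  "form_norm \<phi> q u = sqrt (Re (form_inner \<phi> q u u))"


section \<open>The Cauchy-Riemann operator and its adjoint\<close>

text \<open>The coefficient of \<open>d\<zbar>\<^sub>K\<close> in \<open>d\<zbar>\<^sub>j \<and> d\<zbar>\<^sub>J\<close>.\<close>

definition wedge_coeff :: "'n::{finite,linorder} \<Rightarrow> 'n set \<Rightarrow> 'n set \<Rightarrow> complex" where
  "wedge_coeff j J K = (if j \<notin> J \<and> K = insert j J then (- 1) ^ card {k \<in> J. k < j} else 0)"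

definition weak_dbar :: "nat \<Rightarrow> 'n::{finite,linorder} form \<Rightarrow> 'n form \<Rightarrow> bool" where
  "weak_dbar q u w \<longleftrightarrow>
     (\<forall>K. card K = Suc q \<longrightarrow> (\<forall>\<psi>. test_function \<psi> \<longrightarrow>
        (LINT z|lborel. w K z * \<psi> z) =
        (\<Sum>J | card J = q. \<Sum>j\<in>UNIV. wedge_coeff j J K * - (LINT z|lborel. u J z * d_zbar j \<psi> z))))"

text \<open>\<open>dbar \<phi> q\<close> goes from degree \<open>q\<close> to degree \<open>q + 1\<close>, and \<open>dbar_star \<phi> q\<close> is its adjoint, from degree
  \<open>q + 1\<close> to degree \<open>q\<close>. For \<open>q = CARD('n)\<close> the target \<open>L2 \<phi> (Suc q)\<close> is the zero space.\<close>

definition dbar :: "(complex^'n::{finite,linorder} \<Rightarrow> real) \<Rightarrow> nat \<Rightarrow> 'n form rel" where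
  "dbar \<phi> q = {(u, w). u \<in> L2 \<phi> q \<and> w \<in> L2 \<phi> (Suc q) \<and> weak_dbar q u w}"

definition dbar_star :: "(complex^'n::{finite,linorder} \<Rightarrow> real) \<Rightarrow> nat \<Rightarrow> 'n form rel" where
  "dbar_star \<phi> q = {(v, u). v \<in> L2 \<phi> (Suc q) \<and> u \<in> L2 \<phi> q \<and>
     (\<forall>(f, g) \<in> dbar \<phi> q. form_inner \<phi> (Suc q) g v = form_inner \<phi> q f u)}"


section \<open>The complex Laplacian and its inverse\<close>

text \<open>The case \<open>q = 0\<close> reflects the convention that the adjoint vanishes on functions.\<close>

definition dbar_dbar_star :: "(complex^'n::{finite,linorder} \<Rightarrow> real) \<Rightarrow> nat \<Rightarrow> 'n form rel" where
  "dbar_dbar_star \<phi> q = (case q of 0 \<Rightarrow> L2 \<phi> 0 \<times> {0} | Suc p \<Rightarrow> dbar_star \<phi> p O dbar \<phi> p)"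

definition complex_laplacian :: "(complex^'n::{finite,linorder} \<Rightarrow> real) \<Rightarrow> nat \<Rightarrow> 'n form rel" where
  "complex_laplacian \<phi> q =
     {(u, a + b) | u a b. (u, a) \<in> dbar_dbar_star \<phi> q \<and> (u, b) \<in> dbar \<phi> q O dbar_star \<phi> q}"

definition laplacian_kernel :: "(complex^'n::{finite,linorder} \<Rightarrow> real) \<Rightarrow> nat \<Rightarrow> 'n form set" where
  "laplacian_kernel \<phi> q = {u. (u, 0) \<in> complex_laplacian \<phi> q}"

definition neumann_operator :: "(complex^'n::{finite,linorder} \<Rightarrow> real) \<Rightarrow> nat \<Rightarrow> 'n form rel" where
  "neumann_operator \<phi> q =
     {(u, f) \<in> complex_laplacian \<phi> q. \<forall>h \<in> laplacian_kernel \<phi> q. form_inner \<phi> q u h = 0}\<inverse>"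

definition bounded_operator ::
    "(complex^'n::finite \<Rightarrow> real) \<Rightarrow> nat \<Rightarrow> ('n form \<Rightarrow> 'n form) \<Rightarrow> bool" where
  "bounded_operator \<phi> q T \<longleftrightarrow>
     (\<forall>u \<in> L2 \<phi> q. T u \<in> L2 \<phi> q) \<and>
     (\<forall>u \<in> L2 \<phi> q. \<forall>v \<in> L2 \<phi> q. form_eq (T (u + v)) (T u + T v)) \<and>
     (\<forall>c. \<forall>u \<in> L2 \<phi> q. form_eq (T (form_scale c u)) (form_scale c (T u))) \<and>
     (\<exists>C. \<forall>u \<in> L2 \<phi> q. form_norm \<phi> q (T u) \<le> C * form_norm \<phi> q u)"

definition compact_operator ::
    "(complex^'n::finite \<Rightarrow> real) \<Rightarrow> nat \<Rightarrow> ('n form \<Rightarrow> 'n form) \<Rightarrow> bool" where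
  "compact_operator \<phi> q T \<longleftrightarrow> bounded_operator \<phi> q T \<and>
     (\<forall>u :: nat \<Rightarrow> 'n form. (\<forall>k. u k \<in> L2 \<phi> q \<and> form_norm \<phi> q (u k) \<le> 1) \<longrightarrow>
        (\<exists>r w. strict_mono r \<and> w \<in> L2 \<phi> q \<and>
               (\<lambda>k. form_norm \<phi> q (T (u (r k)) - w)) \<longlonglongrightarrow> 0))"

definition neumann_extension ::
    "(complex^'n::{finite,linorder} \<Rightarrow> real) \<Rightarrow> nat \<Rightarrow> ('n form \<Rightarrow> 'n form) \<Rightarrow> bool" where
  "neumann_extension \<phi> q T \<longleftrightarrow> bounded_operator \<phi> q T \<and>
     (\<forall>(f, u) \<in> neumann_operator \<phi> q. form_eq (T f) u) \<and>
     (\<forall>h \<in> laplacian_kernel \<phi> q. form_eq (T h) 0)"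

definition neumann_compact :: "(complex^'n::{finite,linorder} \<Rightarrow> real) \<Rightarrow> nat \<Rightarrow> bool" where
  "neumann_compact \<phi> q \<longleftrightarrow> (\<exists>T. neumann_extension \<phi> q T \<and> compact_operator \<phi> q T)"

end

theory Submission
  imports Defs "HOL-Complex_Analysis.Complex_Analysis"
begin

text \<open>If the limsup is finite, then the trace of the complex Hessian is bounded, and since the Hessian of a
  plurisubharmonic function is positive semidefinite, so are all its entries \<open>\<phi>\<^sub>j\<^sub>k\<close>.
  Fix \<open>J\<close> with \<open>q\<close> elements and let \<open>f\<close> be in the Bergman space. The form \<open>u = f d\<zbar>\<^sub>J\<close> is closed, and its
  adjoint derivative has the coefficients \<open>\<delta>\<^sub>j f = (\<partial>\<phi>/\<partial>z\<^sub>j) f - \<partial>f/\<partial>z\<^sub>j\<close>, \<open>j \<in> J\<close>, which are square integrable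
  by the commutation relation \<open>[\<partial>/\<partial>\<zbar>\<^sub>k, \<delta>\<^sub>j] = \<phi>\<^sub>j\<^sub>k\<close> and integration by parts. By the same relation the
  coefficients of the Laplacian of \<open>u\<close> are sums of terms \<open>\<plusminus>\<phi>\<^sub>j\<^sub>k f\<close>, so its norm is at most a constant times
  that of \<open>f\<close>. Moreover \<open>u\<close> is a limit of exact forms, hence orthogonal to the kernel of the Laplacian, and
  therefore \<open>u\<close> is the image under the Neumann operator of a form of comparable norm. If that operator is
  compact, every bounded sequence in the Bergman space has a convergent subsequence, which is impossible in
  infinite dimension.\<close>

text \<open>The obstacle is the domain of the adjoint. A pair belongs to \<open>dbar_star\<close>
  only if it passes the test against all of the maximal weak \<open>dbar\<close>, and weak
  derivatives are defined by smooth test functions, while the natural test function, a cutoff times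
  the conjugate of f e^{-\<phi>}, inherits the limited regularity of the weight. Mollification
  therefore extends the weak identity to compactly supported C^1 functions, after which elementary
  C^1 cutoffs suffice. Removing the cutoff needs \<delta>_j f to be square integrable in advance;
  this is a Caccioppoli type estimate, in which the gradient of the cutoff is absorbed and the
  Hessian bound controls the rest. No spectral theory enters. The bounded extension agrees with the
  graph \<open>neumann_operator\<close>, so explicit pairs in that graph are enough, and
  orthogonality to the kernel is what puts them there: the adjoint annihilates the kernel, which is
  thus orthogonal to exact forms. The sequence fed to compactness consists of the Laplacians of an
  orthonormal sequence, scaled into the unit ball; its images stay at a fixed positive distance from
  each other.\<close>

abbreviation dir_deriv :: "'a::real_normed_vector \<Rightarrow> ('a \<Rightarrow> 'b::real_normed_vector) \<Rightarrow> 'a \<Rightarrow> 'b" where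
  "dir_deriv v f \<equiv> \<lambda>x. frechet_derivative f (at x) v"

section \<open>Calculus of the regularity classes \<open>C_k\<close>\<close>

lemma dir_deriv_eq: "(f has_derivative f') (at x) \<Longrightarrow> dir_deriv v f x = f' v"
  by (metis frechet_derivative_at)

text \<open>\<open>C_k\<close> speaks of \<open>frechet_derivative\<close>, a choice operator;
  uniqueness of derivatives lets any explicit derivative formula stand in for it.\<close>

lemma C_k_SucI:
  assumes "\<And>x. (f has_derivative f' x) (at x)" "\<And>v. C_k k (\<lambda>x. f' x v)"
  shows "C_k (Suc k) f"
proof -
  have "dir_deriv v f = (\<lambda>x. f' x v)" for v
    using dir_deriv_eq[OF assms(1)] by auto
  moreover have "f differentiable_on UNIV"
    using assms(1) by (auto simp: differentiable_on_def differentiable_def)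
  ultimately show ?thesis using assms(2) by simp
qed

lemma C_k_Suc_has_derivative:
  assumes "C_k (Suc k) f" shows "(f has_derivative (\<lambda>v. dir_deriv v f x)) (at x)"
  using assms by (auto simp: differentiable_on_def frechet_derivative_works)

lemma C_k_Suc_dir_deriv: "C_k (Suc k) f \<Longrightarrow> C_k k (dir_deriv v f)"
  by simp

lemma C_k_Suc_lower: "C_k (Suc k) f \<Longrightarrow> C_k k f"
proof (induction k arbitrary: f)
  case 0 then show ?case by (auto intro: differentiable_imp_continuous_on)
next
  case (Suc k)
  have "C_k k (dir_deriv v f)" for v
    by (rule Suc.IH) (rule C_k_Suc_dir_deriv[OF Suc.prems])
  then show ?case using Suc.prems by simp
qed

lemma C_k_continuous: "C_k k f \<Longrightarrow> continuous_on UNIV f"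
proof (induction k)
  case (Suc k) then show ?case using C_k_Suc_lower by blast
qed simp

lemma C_k_const: "C_k k (\<lambda>x. c)"
proof (induction k arbitrary: c)
  case (Suc k) show ?case by (rule C_k_SucI[where f'="\<lambda>x v. 0"]) (auto intro: Suc)
qed simp

lemma C_k_add: "C_k k f \<Longrightarrow> C_k k g \<Longrightarrow> C_k k (\<lambda>x. f x + g x)"
proof (induction k arbitrary: f g)
  case 0 then show ?case by (auto intro: continuous_intros)
next
  case (Suc k)
  show ?case
    by (rule C_k_SucI[OF has_derivative_add[OF C_k_Suc_has_derivative[OF Suc.prems(1)] C_k_Suc_has_derivative[OF Suc.prems(2)]]])
      (use Suc in simp)
qed

text \<open>One induction serves products and the inner product alike. The product rule leaves one
  factor undifferentiated, so the order of that factor is lowered by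
  \<open>C_k_Suc_lower\<close>.\<close>

lemma C_k_bilinear:
  assumes "bounded_bilinear (bop :: 'b::euclidean_space \<Rightarrow> 'c::euclidean_space \<Rightarrow> 'd::euclidean_space)"
  shows "C_k k f \<Longrightarrow> C_k k g \<Longrightarrow> C_k k (\<lambda>x. bop (f x) (g x))"
proof (induction k arbitrary: f g)
  case 0 then show ?case by (auto intro: bounded_bilinear.continuous_on[OF assms])
next
  case (Suc k)
  show ?case
    by (rule C_k_SucI[OF bounded_bilinear.FDERIV[OF assms C_k_Suc_has_derivative[OF Suc.prems(1)] C_k_Suc_has_derivative[OF Suc.prems(2)]]])
      (intro C_k_add Suc.IH C_k_Suc_lower[OF Suc.prems(1)] C_k_Suc_lower[OF Suc.prems(2)]
        C_k_Suc_dir_deriv[OF Suc.prems(1)] C_k_Suc_dir_deriv[OF Suc.prems(2)])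
qed

lemmas C_k_mult = C_k_bilinear[OF bounded_bilinear_mult]

lemma C_k_linear:
  assumes "bounded_linear (L :: 'b::euclidean_space \<Rightarrow> 'c::euclidean_space)"
  shows "C_k k f \<Longrightarrow> C_k k (\<lambda>x. L (f x))"
proof (induction k arbitrary: f)
  case 0 then show ?case
    by (simp add: bounded_linear.continuous_on[OF assms])
next
  case (Suc k)
  show ?case
    by (rule C_k_SucI[OF bounded_linear.has_derivative[OF assms C_k_Suc_has_derivative[OF Suc.prems]]])
      (use Suc in simp)
qed

lemmas C_k_of_real = C_k_linear[OF bounded_linear_of_real]
lemmas C_k_cnj = C_k_linear[OF bounded_linear_cnj]

lemma C_k_id: "C_k k (\<lambda>x. x)"
proof (cases k)
  case (Suc n) show ?thesis unfolding Suc
    by (rule C_k_SucI[where f'="\<lambda>x v. v"]) (auto intro: C_k_const)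
qed simp

lemma C_k_minus: "C_k k f \<Longrightarrow> C_k k (\<lambda>x. - f x)"
  by (rule C_k_linear[OF bounded_linear_minus[OF bounded_linear_ident]])

lemma C_k_diff: "C_k k f \<Longrightarrow> C_k k g \<Longrightarrow> C_k k (\<lambda>x. f x - g x)"
  using C_k_add[of k f "\<lambda>x. - g x"] C_k_minus[of k g] by simp

lemma C_k_sum: "(\<And>i. i \<in> I \<Longrightarrow> C_k k (f i)) \<Longrightarrow> C_k k (\<lambda>x. \<Sum>i\<in>I. f i x)"
  by (induction I rule: infinite_finite_induct) (auto intro: C_k_const C_k_add)

section \<open>A smooth bump function\<close>

text \<open>The power in the denominator makes the family closed under differentiation up to linear
  combinations: a derivative of exp(-1/t) / t^m produces the members with m + 1 and m + 2.\<close>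

definition flat :: "nat \<Rightarrow> real \<Rightarrow> real" where
  "flat m t = (if t \<le> 0 then 0 else exp (- 1 / t) / t ^ m)"

lemma flat_nonneg: "flat m t \<ge> 0"
  by (simp add: flat_def)

text \<open>The single term of order m + 2 in the series of exp(1/t) already gives exp(-1/t) \<le>
  (m+2)! t^(m+2), and division by t^m leaves t^2. Vanishing to second order yields the derivative 0
  at the origin.\<close>

lemma flat_le: "flat m t \<le> fact (m + 2) * t\<^sup>2"
proof (cases "t \<le> 0")
  case False
  hence t: "t > 0" by simp
  define N where "N = m + 2"
  have "sum (\<lambda>n. (1/t) ^ n /\<^sub>R fact n) {N} \<le> (\<Sum>n. (1/t) ^ n /\<^sub>R fact n)"
    using t by (intro sum_le_suminf summable_exp_generic) auto
  hence "(1/t) ^ N / fact N \<le> exp (1/t)" by (simp add: exp_def field_simps)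
  hence "exp (- (1/t)) \<le> fact N * t ^ N"
    using t by (simp add: exp_minus field_simps power_divide)
  hence "exp (- (1/t)) / t ^ m \<le> fact N * t\<^sup>2"
    using t unfolding N_def by (simp add: divide_le_eq power_add power2_eq_square mult_ac del: fact_Suc)
  thus ?thesis using t by (simp add: flat_def N_def)
qed (simp add: flat_def)

lemma flat_has_derivative: "(flat m has_real_derivative flat (m + 2) t - m * flat (Suc m) t) (at t)"
proof -
  consider "t < 0" | "t > 0" | "t = 0" by linarith
  thus ?thesis
  proof cases
    case 1
    have "((\<lambda>t. 0) has_real_derivative 0) (at t)" by simp
    moreover have "eventually (\<lambda>s. (0::real) = flat m s) (nhds t)"
      using eventually_nhds_in_open[of "{..<0}" t] 1 by (auto simp: flat_def elim: eventually_mono)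
    ultimately show ?thesis using 1 DERIV_cong_ev[OF refl, of "\<lambda>t. 0" "flat m" t 0 0]
      by (simp add: flat_def)
  next
    case 2
    have "((\<lambda>t. exp (- 1 / t) / t ^ m) has_real_derivative flat (m + 2) t - m * flat (Suc m) t) (at t)"
      using 2 apply (auto intro!: derivative_eq_intros simp: flat_def)
      apply (cases m; simp add: field_simps power_add power2_eq_square)
      done
    moreover have "eventually (\<lambda>s. exp (- 1 / s) / s ^ m = flat m s) (nhds t)"
      using eventually_nhds_in_open[of "{0<..}" t] 2 by (auto simp: flat_def elim: eventually_mono)
    ultimately show ?thesis using DERIV_cong_ev[OF refl _ refl, THEN iffD1] by metis
  next
    case 3
    have "((\<lambda>h. flat m h / h) \<longlongrightarrow> 0) (at 0)"
    proof (rule Lim_null_comparison)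
      show "\<forall>\<^sub>F h in at 0. norm (flat m h / h) \<le> fact (m + 2) * \<bar>h\<bar>"
      proof (rule always_eventually, rule allI)
        fix h :: real
        have "\<bar>flat m h\<bar> \<le> fact (m + 2) * \<bar>h\<bar> * \<bar>h\<bar>"
          using flat_le[of m h] flat_nonneg[of m h] by (simp add: power2_eq_square)
        thus "norm (flat m h / h) \<le> fact (m + 2) * \<bar>h\<bar>"
          by (cases "h = 0") (auto simp: field_simps)
      qed
      show "((\<lambda>h. fact (m + 2) * \<bar>h\<bar>) \<longlongrightarrow> 0) (at (0::real))"
        by (auto intro!: tendsto_eq_intros)
    qed
    thus ?thesis using 3 by (simp add: DERIV_def flat_def)
  qed
qed

text \<open>The induction runs over all m at once, because differentiation raises m.\<close>

lemma C_k_flat: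
  fixes g :: "'a::euclidean_space \<Rightarrow> real"
  assumes "\<And>k. C_k k g" shows "C_k k (\<lambda>x. flat m (g x))"
proof (induction k arbitrary: m)
  case 0
  have "continuous_on UNIV (flat m)"
    by (intro continuous_at_imp_continuous_on ballI DERIV_isCont) (rule flat_has_derivative)
  thus ?case using assms[of 0] continuous_on_compose2 by fastforce
next
  case (Suc k)
  have "((\<lambda>x. flat m (g x)) has_derivative
      (\<lambda>v. (flat (m + 2) (g x) - m * flat (Suc m) (g x)) * dir_deriv v g x)) (at x)" for x
    using has_derivative_compose[OF C_k_Suc_has_derivative[OF assms]
       flat_has_derivative[unfolded has_field_derivative_def]] by simp
  thus ?case
    by (rule C_k_SucI) (intro C_k_mult C_k_diff Suc C_k_const C_k_Suc_dir_deriv assms)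
qed

section \<open>Integration by parts\<close>

lemma integrable_compact_support:
  fixes f :: "'a::euclidean_space \<Rightarrow> 'b::euclidean_space"
  assumes "continuous_on UNIV f" "\<And>x. norm x > R \<Longrightarrow> f x = 0"
  shows "integrable lborel f"
proof -
  have "integrable lborel (\<lambda>x. indicator (cball 0 R) x *\<^sub>R f x)"
    using assms(1) by (intro borel_integrable_compact) (auto intro: continuous_on_subset)
  moreover have "(\<lambda>x. indicator (cball 0 R) x *\<^sub>R f x) = f"
    using assms(2) by (auto simp: fun_eq_iff indicator_def)
  ultimately show ?thesis by simp
qed

lemma bounded_compact_support:
  fixes f :: "'a::euclidean_space \<Rightarrow> 'b::euclidean_space"
  assumes "continuous_on UNIV f" "\<And>x. norm x > R \<Longrightarrow> f x = 0"
  obtains M where "M > 0" "\<And>x. norm (f x) \<le> M"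
proof -
  have "compact (f ` cball 0 R)"
    using assms(1) by (intro compact_continuous_image) (auto intro: continuous_on_subset)
  then obtain M where "M > 0" "\<And>x. norm x \<le> R \<Longrightarrow> norm (f x) \<le> M"
    using bounded_pos[of "f ` cball 0 R"] compact_imp_bounded by auto
  moreover from this have "norm (f x) \<le> M" for x
    using assms(2)[of x] by (cases "norm x \<le> R") auto
  ultimately show ?thesis using that by blast
qed

lemma dir_deriv_compact_support:
  assumes "\<And>x. norm x > R \<Longrightarrow> f x = 0" "norm x > R"
  shows "dir_deriv v f x = 0"
proof -
  have "open {x::'a. R < norm x}"
    by (intro open_Collect_less continuous_intros)
  hence "(f has_derivative (\<lambda>h. 0)) (at x)"
    by (rule has_derivative_transform_within_open[OF has_derivative_const[of 0]]) (use assms in auto)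
  thus ?thesis using dir_deriv_eq by blast
qed

lemma has_vector_derivative_line:
  assumes "C_k (Suc k) f"
  shows "((\<lambda>s. f (x + s *\<^sub>R v)) has_vector_derivative dir_deriv v f (x + s *\<^sub>R v)) (at s within S)"
proof -
  have "((\<lambda>s. f (x + s *\<^sub>R v)) has_derivative (\<lambda>h. dir_deriv (h *\<^sub>R v) f (x + s *\<^sub>R v))) (at s within S)"
    by (rule has_derivative_compose[OF _ C_k_Suc_has_derivative[OF assms]])
      (auto intro!: derivative_eq_intros)
  moreover have "linear (\<lambda>v. dir_deriv v f (x + s *\<^sub>R v0))" for v0
    using has_derivative_linear[OF C_k_Suc_has_derivative[OF assms]] .
  ultimately show ?thesis
    unfolding has_vector_derivative_def by (simp add: linear_scale)
qed

lemma dir_deriv_quotient: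
  assumes "C_k (Suc k) f"
  shows "(\<lambda>n. real (Suc n) *\<^sub>R (f (x + (1 / real (Suc n)) *\<^sub>R v) - f x)) \<longlonglongrightarrow> dir_deriv v f x"
proof -
  let ?y = "\<lambda>n. 1 / real (Suc n)"
  have "((\<lambda>y. (1 / norm (y - 0)) *\<^sub>R (f (x + y *\<^sub>R v) - (f (x + 0 *\<^sub>R v) + (y - 0) *\<^sub>R dir_deriv v f (x + 0 *\<^sub>R v)))) \<longlongrightarrow> 0) (at 0)"
    using has_vector_derivative_line[OF assms, of x v 0 UNIV]
    unfolding has_vector_derivative_def has_derivative_def
    by (simp add: divide_inverse diff_diff_eq)
  moreover have "filterlim ?y (at 0) sequentially"
    unfolding filterlim_at using LIMSEQ_inverse_real_of_nat by (auto simp: inverse_eq_divide)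
  ultimately have "(\<lambda>n. (1 / norm (?y n - 0)) *\<^sub>R (f (x + ?y n *\<^sub>R v) - (f (x + 0 *\<^sub>R v) + (?y n - 0) *\<^sub>R dir_deriv v f (x + 0 *\<^sub>R v)))) \<longlonglongrightarrow> 0"
    by (rule filterlim_compose)
  hence "(\<lambda>n. real (Suc n) *\<^sub>R (f (x + ?y n *\<^sub>R v) - f x) - dir_deriv v f x) \<longlonglongrightarrow> 0"
    by (simp add: scaleR_diff_right scaleR_add_right diff_diff_eq add_ac del: of_nat_Suc)
  thus ?thesis using LIM_zero_iff by blast
qed

lemma integral_translation:
  fixes f :: "'a::euclidean_space \<Rightarrow> 'b::euclidean_space"
  assumes "f \<in> borel_measurable borel"
  shows "(LINT x|lborel. f (c + x)) = (LINT x|lborel. f x)"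
  by (subst (2) lborel_distr_plus[symmetric, of c]) (simp add: integral_distr assms)

text \<open>Translation invariance makes the integral of every difference quotient zero, and
  dominated convergence carries this to the derivative. The majorant lives on a ball enlarged by
  |v|, since the steps 1/(n+1) move points by at most |v|.\<close>

lemma integral_dir_deriv_zero:
  fixes f :: "'a::euclidean_space \<Rightarrow> 'b::euclidean_space"
  assumes f: "C_k (Suc k) f" and R: "\<And>x. norm x > R \<Longrightarrow> f x = 0"
  shows "(LINT x|lborel. dir_deriv v f x) = 0"
proof -
  have [measurable]: "f \<in> borel_measurable borel"
    using C_k_continuous[OF f] borel_measurable_continuous_onI by blast
  have [measurable]: "dir_deriv v f \<in> borel_measurable borel"
    using C_k_continuous[OF C_k_Suc_dir_deriv[OF f]] borel_measurable_continuous_onI by blast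
  obtain M where M: "M > 0" "\<And>x. norm (dir_deriv v f x) \<le> M"
    by (rule bounded_compact_support[OF C_k_continuous[OF C_k_Suc_dir_deriv[OF f]] dir_deriv_compact_support[OF R], of R])
      auto
  \<comment> \<open>Mean value inequality along v: the bound M of the derivative bounds all
    difference quotients uniformly.\<close>
  have lip: "norm (f (x + h *\<^sub>R v) - f x) \<le> h * M" if "h \<ge> 0" for x h
  proof -
    have "norm (f (x + h *\<^sub>R v) - f (x + 0 *\<^sub>R v)) \<le> M * norm (h - 0)"
    proof (rule differentiable_bound[where S = UNIV])
      show "((\<lambda>s. f (x + s *\<^sub>R v)) has_derivative (\<lambda>h. h *\<^sub>R dir_deriv v f (x + s *\<^sub>R v))) (at s within UNIV)" for s
        using has_vector_derivative_line[OF f] unfolding has_vector_derivative_def .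
      show "onorm (\<lambda>h. h *\<^sub>R dir_deriv v f (x + s *\<^sub>R v)) \<le> M" for s
        using M by (intro onorm_bound) (auto simp: mult.commute[of M] intro: mult_left_mono)
    qed auto
    thus ?thesis using that by (simp add: mult.commute)
  qed
  let ?s = "\<lambda>n x. real (Suc n) *\<^sub>R (f (x + (1 / real (Suc n)) *\<^sub>R v) - f x)"
  let ?w = "\<lambda>x. indicator (cball 0 (R + norm v)) x * M"
  have "(\<lambda>n. LINT x|lborel. ?s n x) \<longlonglongrightarrow> (LINT x|lborel. dir_deriv v f x)"
  proof (rule integral_dominated_convergence[where w="?w"])
    show "integrable lborel ?w"
      by (intro integrable_mult_left integrable_real_indicator emeasure_bounded_finite) auto
    show "AE x in lborel. (\<lambda>n. ?s n x) \<longlonglongrightarrow> dir_deriv v f x"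
      using dir_deriv_quotient[OF f] by auto
    show "AE x in lborel. norm (?s n x) \<le> ?w x" for n
    proof (rule AE_I2)
      fix x
      have "norm (?s n x) \<le> M"
        using mult_left_mono[OF lip[of "1 / real (Suc n)" x], of "real (Suc n)"]
        by (simp del: of_nat_Suc scaleR_diff_right)
      moreover have "?s n x = 0" if "norm x > R + norm v"
      proof -
        have "norm ((1 / real (Suc n)) *\<^sub>R v) \<le> norm v"
          by (simp add: divide_le_eq mult_le_cancel_left1)
        hence "norm (x + (1 / real (Suc n)) *\<^sub>R v) > R"
          using that norm_triangle_ineq4[of "x + (1 / real (Suc n)) *\<^sub>R v" "(1 / real (Suc n)) *\<^sub>R v"] by simp
        thus ?thesis using R that by (smt (verit) diff_self norm_ge_zero scaleR_zero_right)
      qed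
      ultimately show "norm (?s n x) \<le> ?w x"
        by (auto simp: indicator_def not_le)
    qed
  qed measurable
  moreover have "(LINT x|lborel. ?s n x) = 0" for n
  proof -
    have i: "integrable lborel f" using integrable_compact_support[OF C_k_continuous[OF f] R] by blast
    have "integrable lborel (\<lambda>x. f (c + x))" for c
    proof (rule integrable_compact_support)
      show "continuous_on UNIV (\<lambda>x. f (c + x))"
        by (intro continuous_on_compose2[OF C_k_continuous[OF f]] continuous_intros) auto
      show "f (c + x) = 0" if "norm x > R + norm c" for x
        using R[of "c + x"] that norm_triangle_ineq4[of "c + x" c] by simp
    qed
    from this[of "(1 / real (Suc n)) *\<^sub>R v"] show ?thesis
      using i integral_translation[of f "(1 / real (Suc n)) *\<^sub>R v"]
      by (simp add: add.commute[of _ "_ *\<^sub>R _"] del: of_nat_Suc)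
  qed
  ultimately show ?thesis by (simp add: LIMSEQ_const_iff)
qed

lemma C_k_borel_measurable [measurable_dest]:
  "C_k k f \<Longrightarrow> f \<in> borel_measurable borel"
  using C_k_continuous borel_measurable_continuous_onI by blast

lemma dir_deriv_mult:
  fixes f g :: "'a::euclidean_space \<Rightarrow> complex"
  assumes "C_k (Suc k) f" "C_k (Suc l) g"
  shows "dir_deriv v (\<lambda>x. f x * g x) x = f x * dir_deriv v g x + dir_deriv v f x * g x"
  using dir_deriv_eq[OF has_derivative_mult[OF C_k_Suc_has_derivative[OF assms(1)] C_k_Suc_has_derivative[OF assms(2)]]]
  by simp

text \<open>Compact support of one factor passes to the product f g, whose derivative therefore
  integrates to zero; the other factor may grow freely.\<close>

lemma integration_by_parts:
  fixes f g :: "'a::euclidean_space \<Rightarrow> complex"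
  assumes f: "C_k (Suc 0) f" and g: "C_k (Suc 0) g" and R: "\<And>x. norm x > R \<Longrightarrow> g x = 0"
  shows "(LINT x|lborel. f x * dir_deriv v g x) = - (LINT x|lborel. dir_deriv v f x * g x)"
proof -
  note c = C_k_continuous[OF C_k_Suc_dir_deriv[OF f]] C_k_continuous[OF C_k_Suc_dir_deriv[OF g]]
    C_k_continuous[OF f] C_k_continuous[OF g]
  have i: "integrable lborel (\<lambda>x. f x * dir_deriv v g x)" "integrable lborel (\<lambda>x. dir_deriv v f x * g x)"
    by (rule integrable_compact_support[where R=R]; use c R dir_deriv_compact_support[of R g] in \<open>auto intro: continuous_on_mult\<close>)+
  have "(LINT x|lborel. dir_deriv v (\<lambda>x. f x * g x) x) = 0"
    by (rule integral_dir_deriv_zero[OF C_k_mult[OF f g], of R]) (simp add: R)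
  thus ?thesis using i by (simp add: dir_deriv_mult[OF f g] add_eq_0_iff)
qed

section \<open>Mollification\<close>

text \<open>Evenness turns y \<mapsto> \<kappa> (x - y) into a translate of \<kappa>, so that its
  total mass is 1 by translation invariance.\<close>

definition mollifier :: "real \<Rightarrow> ('a::euclidean_space \<Rightarrow> real) \<Rightarrow> bool" where
  "mollifier \<epsilon> \<kappa> \<longleftrightarrow> (\<forall>k. C_k k \<kappa>) \<and> (\<forall>x. \<kappa> x \<ge> 0) \<and> (\<forall>x. \<kappa> (- x) = \<kappa> x) \<and>
     (\<forall>x. norm x > \<epsilon> \<longrightarrow> \<kappa> x = 0) \<and> (LINT x|lborel. \<kappa> x) = 1"

lemma AE_lborel_notin_open:
  fixes S :: "'a::euclidean_space set"
  assumes "AE x in lborel. x \<notin> S" "open S"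
  shows "S = {}"
proof -
  have "S \<in> null_sets lborel"
    using assms AE_iff_null_sets[of S lborel] by auto
  hence "negligible S"
    by (simp add: negligible_iff_null_sets null_sets_completionI)
  thus ?thesis using open_not_negligible assms(2) by blast
qed

text \<open>\<open>flat 0\<close> of \<epsilon>^2 - |x|^2 is smooth and positive exactly inside the
  ball. Its integral cannot vanish, since the ball is open and nonempty, so it can be
  normalised.\<close>

lemma mollifier_exists:
  assumes "\<epsilon> > 0" shows "\<exists>\<kappa> :: 'a::euclidean_space \<Rightarrow> real. mollifier \<epsilon> \<kappa>"
proof -
  let ?b = "\<lambda>x::'a. flat 0 (\<epsilon>\<^sup>2 - x \<bullet> x)"
  have Cb: "C_k k ?b" for k
    by (intro C_k_flat C_k_diff C_k_const C_k_bilinear[OF bounded_bilinear_inner] C_k_id)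
  have supp: "?b x = 0" if "norm x > \<epsilon>" for x
  proof -
    have "\<epsilon>\<^sup>2 < (norm x)\<^sup>2" using that assms by (intro power_strict_mono) auto
    thus ?thesis by (simp add: flat_def dot_square_norm)
  qed
  have int: "integrable lborel ?b"
    using integrable_compact_support[OF C_k_continuous[OF Cb] supp] .
  have "(LINT x|lborel. ?b x) \<noteq> 0"
  proof
    assume "(LINT x|lborel. ?b x) = 0"
    hence "AE x in lborel. ?b x = 0"
      using int by (subst (asm) integral_nonneg_eq_0_iff_AE) (auto simp: flat_nonneg)
    moreover have "x \<notin> ball 0 \<epsilon>" if "?b x = 0" for x
    proof
      assume "x \<in> ball 0 \<epsilon>"
      hence "(norm x)\<^sup>2 < \<epsilon>\<^sup>2" by (intro power_strict_mono) auto
      thus False using that by (simp add: flat_def dot_square_norm)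
    qed
    ultimately have "AE x in lborel. x \<notin> ball (0::'a) \<epsilon>"
      by (rule eventually_mono)
    thus False using AE_lborel_notin_open[of "ball (0::'a) \<epsilon>"] assms by auto
  qed
  moreover have "(LINT x|lborel. ?b x) \<ge> 0" by (simp add: flat_nonneg)
  moreover have "C_k k (\<lambda>x. (1 / (LINT x|lborel. ?b x)) * ?b x)" for k
    by (intro C_k_mult C_k_const Cb)
  ultimately have "mollifier \<epsilon> (\<lambda>x. (1 / (LINT x|lborel. ?b x)) * ?b x)"
    using supp int by (simp add: mollifier_def flat_nonneg)
  thus ?thesis by blast
qed

definition convolve :: "('a::euclidean_space \<Rightarrow> real) \<Rightarrow> ('a \<Rightarrow> complex) \<Rightarrow> 'a \<Rightarrow> complex" where
  "convolve \<kappa> \<psi> x = (LINT y|lborel. \<kappa> (x - y) *\<^sub>R \<psi> y)"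

context
  fixes \<psi> :: "'a::euclidean_space \<Rightarrow> complex" and R :: real
  assumes cont: "continuous_on UNIV \<psi>" and supp: "\<And>x. norm x > R \<Longrightarrow> \<psi> x = 0"
begin

lemma convolve_integrable:
  assumes "continuous_on UNIV \<kappa>"
  shows "integrable lborel (\<lambda>y. (\<kappa> (x - y) :: real) *\<^sub>R \<psi> y)"
proof (rule integrable_compact_support[where R=R])
  show "continuous_on UNIV (\<lambda>y. \<kappa> (x - y) *\<^sub>R \<psi> y)"
    by (intro continuous_intros cont continuous_on_compose2[OF assms]) auto
qed (simp add: supp)

text \<open>The rule for differentiation under the integral works over boxes, so the convolution is
  rewritten over a box containing the support of \<psi>. The derivative is bundled as a bounded
  linear function, whose integral is then evaluated at each direction v.\<close>

lemma convolve_derivative: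
  assumes \<kappa>: "C_k (Suc k) \<kappa>"
  shows "(convolve \<kappa> \<psi> has_derivative (\<lambda>v. convolve (dir_deriv v \<kappa>) \<psi> x)) (at x)"
proof -
  obtain a :: 'a where a: "cball 0 R \<subseteq> cbox (-a) a"
    using bounded_subset_cbox_symmetric[OF bounded_cball] by blast
  have conv: "convolve \<kappa> \<psi> x = integral (cbox (-a) a) (\<lambda>y. \<kappa> (x - y) *\<^sub>R \<psi> y)"
    if "continuous_on UNIV \<kappa>" for \<kappa> x
  proof -
    have "(\<lambda>y. \<kappa> (x - y) *\<^sub>R \<psi> y) = (\<lambda>y. if y \<in> cbox (-a) a then \<kappa> (x - y) *\<^sub>R \<psi> y else 0)"
      using a supp by (force simp: fun_eq_iff not_le[symmetric])
    thus ?thesis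
      using integral_lborel[OF convolve_integrable[OF that, of x]] integral_restrict_UNIV[of "cbox (-a) a" "\<lambda>y. \<kappa> (x - y) *\<^sub>R \<psi> y"]
      unfolding convolve_def by simp
  qed
  let ?D = "\<lambda>x y. Blinfun (\<lambda>v. dir_deriv v \<kappa> (x - y) *\<^sub>R \<psi> y)"
  have bl: "bounded_linear (\<lambda>v. dir_deriv v \<kappa> (x - y) *\<^sub>R \<psi> y)" for x y
    using has_derivative_bounded_linear[OF C_k_Suc_has_derivative[OF \<kappa>]]
    by (rule bounded_linear_scaleR_const)
  have D: "blinfun_apply (?D x y) = (\<lambda>v. dir_deriv v \<kappa> (x - y) *\<^sub>R \<psi> y)" for x y
    using bounded_linear_Blinfun_apply[OF bl] .
  have cD: "continuous_on (UNIV \<times> cbox (-a) a) (\<lambda>(x, y). ?D x y)"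
  proof (rule continuous_on_blinfun_componentwise)
    fix i :: 'a
    have "continuous_on (UNIV \<times> cbox (-a) a) (\<lambda>p. dir_deriv i \<kappa> (fst p - snd p) *\<^sub>R \<psi> (snd p))"
      by (intro continuous_intros continuous_on_compose2[OF cont] continuous_on_compose2[OF C_k_continuous[OF C_k_Suc_dir_deriv[OF \<kappa>]]]) auto
    thus "continuous_on (UNIV \<times> cbox (-a) a) (\<lambda>x. blinfun_apply (case x of (x, y) \<Rightarrow> ?D x y) i)"
      by (simp add: D case_prod_beta)
  qed
  have "((\<lambda>x. integral (cbox (-a) a) (\<lambda>y. \<kappa> (x - y) *\<^sub>R \<psi> y)) has_derivative integral (cbox (-a) a) (?D x)) (at x within UNIV)"
  proof (rule leibniz_rule[OF _ _ cD])
    fix x y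
    have "((\<lambda>x. \<kappa> (x - y)) has_derivative (\<lambda>v. dir_deriv v \<kappa> (x - y))) (at x)"
      by (rule has_derivative_compose[OF _ C_k_Suc_has_derivative[OF \<kappa>], of "\<lambda>x. x - y"]) (auto intro!: derivative_eq_intros)
    from has_derivative_scaleR_left[OF this, of "\<psi> y"]
    show "((\<lambda>x. \<kappa> (x - y) *\<^sub>R \<psi> y) has_derivative blinfun_apply (?D x y)) (at x within UNIV)"
      by (simp add: D)
  next
    fix x
    show "(\<lambda>y. \<kappa> (x - y) *\<^sub>R \<psi> y) integrable_on cbox (-a) a"
      by (intro integrable_continuous continuous_intros continuous_on_compose2[OF cont] continuous_on_compose2[OF C_k_continuous[OF \<kappa>]]) auto
  qed auto
  moreover have "blinfun_apply (integral (cbox (-a) a) (?D x)) = (\<lambda>v. convolve (dir_deriv v \<kappa>) \<psi> x)"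
  proof
    fix v
    have "continuous_on (cbox (-a) a) (?D x)"
      using continuous_on_compose2[OF cD, of "cbox (-a) a" "\<lambda>y. (x, y)"] continuous_on_Pair[OF continuous_on_const continuous_on_id]
      by auto
    hence "?D x integrable_on cbox (-a) a" by (rule integrable_continuous)
    hence "blinfun_apply (integral (cbox (-a) a) (?D x)) v = integral (cbox (-a) a) (\<lambda>y. blinfun_apply (?D x y) v)"
      by (rule blinfun_apply_integral)
    thus "blinfun_apply (integral (cbox (-a) a) (?D x)) v = convolve (dir_deriv v \<kappa>) \<psi> x"
      using conv[OF C_k_continuous[OF C_k_Suc_dir_deriv[OF \<kappa>]]] by (simp add: D)
  qed
  moreover have "convolve \<kappa> \<psi> = (\<lambda>x. integral (cbox (-a) a) (\<lambda>y. \<kappa> (x - y) *\<^sub>R \<psi> y))"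
    using conv[OF C_k_continuous[OF \<kappa>]] by auto
  ultimately show ?thesis by simp
qed

lemma C_k_convolve:
  assumes "\<And>k. C_k k \<kappa>" shows "C_k k (convolve \<kappa> \<psi>)"
  using assms
proof (induction k arbitrary: \<kappa>)
  case 0
  have "isCont (convolve \<kappa> \<psi>) x" for x
    using convolve_derivative[OF 0[of "Suc 0"]] has_derivative_continuous by blast
  thus ?case by (simp add: continuous_at_imp_continuous_on)
next
  case (Suc k)
  show ?case
    by (rule C_k_SucI[OF convolve_derivative[OF Suc.prems]]) (intro Suc.IH C_k_Suc_dir_deriv Suc.prems)
qed

text \<open>The derivative first falls on \<kappa>; the reflection in x - y and the integration by
  parts each contribute a sign, and it ends on \<psi>. Derivatives of mollifications thus converge
  for the same reason as the mollifications themselves.\<close>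

lemma convolve_dir_deriv:
  assumes \<kappa>: "C_k (Suc 0) \<kappa>" and \<psi>: "C_k (Suc 0) \<psi>"
  shows "dir_deriv v (convolve \<kappa> \<psi>) x = convolve \<kappa> (dir_deriv v \<psi>) x"
proof -
  have d: "((\<lambda>y. complex_of_real (\<kappa> (x - y))) has_derivative (\<lambda>v. - complex_of_real (dir_deriv v \<kappa> (x - y)))) (at y)" for y
  proof -
    have "((\<lambda>y. \<kappa> (x - y)) has_derivative (\<lambda>v. dir_deriv (- v) \<kappa> (x - y))) (at y)"
      by (rule has_derivative_compose[OF _ C_k_Suc_has_derivative[OF \<kappa>], of "\<lambda>y. x - y"]) (auto intro!: derivative_eq_intros)
    from has_derivative_of_real[OF this] show ?thesis
      using linear_neg[OF has_derivative_linear[OF C_k_Suc_has_derivative[OF \<kappa>]]] by simp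
  qed
  have C: "C_k (Suc 0) (\<lambda>y. complex_of_real (\<kappa> (x - y)))"
    by (rule C_k_SucI[OF d]) (auto intro!: continuous_intros continuous_on_compose2[OF C_k_continuous[OF C_k_Suc_dir_deriv[OF \<kappa>]]])
  have "dir_deriv v (convolve \<kappa> \<psi>) x = convolve (dir_deriv v \<kappa>) \<psi> x"
    using dir_deriv_eq[OF convolve_derivative[OF \<kappa>]] .
  also have "\<dots> = - (LINT y|lborel. dir_deriv v (\<lambda>y. complex_of_real (\<kappa> (x - y))) y * \<psi> y)"
    by (simp add: convolve_def dir_deriv_eq[OF d] scaleR_conv_of_real)
  also have "\<dots> = (LINT y|lborel. complex_of_real (\<kappa> (x - y)) * dir_deriv v \<psi> y)"
    using integration_by_parts[OF C \<psi> supp, where v=v] by simp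
  finally show ?thesis by (simp add: convolve_def scaleR_conv_of_real)
qed

text \<open>Convolution with a mollifier averages over the ball of radius \<epsilon>. The choice c =
  \<psi> x gives convergence, c = 0 with \<delta> = 0 the support, and c = 0 with a bound of \<psi>
  as \<delta> a uniform bound.\<close>

lemma convolve_mollifier_error:
  assumes \<kappa>: "mollifier \<epsilon> \<kappa>" and d: "\<And>y. norm (y - x) \<le> \<epsilon> \<Longrightarrow> norm (\<psi> y - c) \<le> \<delta>" and "\<delta> \<ge> 0"
  shows "norm (convolve \<kappa> \<psi> x - c) \<le> \<delta>"
proof -
  have C: "continuous_on UNIV \<kappa>" using \<kappa> by (auto simp: mollifier_def intro: C_k_continuous)
  have sym: "\<kappa> (x - y) = \<kappa> (- x + y)" for y
    using \<kappa> by (metis mollifier_def minus_diff_eq uminus_add_conv_diff)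
  have i1: "(LINT y|lborel. \<kappa> (x - y)) = 1"
    using integral_translation[of \<kappa> "- x"] \<kappa> C_k_borel_measurable by (auto simp: sym mollifier_def)
  hence i2: "integrable lborel (\<lambda>y. \<kappa> (x - y))" using not_integrable_integral_eq by fastforce
  have "convolve \<kappa> \<psi> x - c = (LINT y|lborel. \<kappa> (x - y) *\<^sub>R \<psi> y) - (LINT y|lborel. \<kappa> (x - y) *\<^sub>R c)"
    using i1 i2 by (simp add: convolve_def)
  also have "\<dots> = (LINT y|lborel. \<kappa> (x - y) *\<^sub>R (\<psi> y - c))"
    using convolve_integrable[OF C, of x] i2 by (simp add: scaleR_diff_right)
  also have "norm \<dots> \<le> (LINT y|lborel. \<kappa> (x - y) * \<delta>)"
  proof (rule Bochner_Integration.integral_norm_bound_integral)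
    show "integrable lborel (\<lambda>y. \<kappa> (x - y) *\<^sub>R (\<psi> y - c))"
      using convolve_integrable[OF C, of x] i2 by (simp add: scaleR_diff_right)
    show "norm (\<kappa> (x - y) *\<^sub>R (\<psi> y - c)) \<le> \<kappa> (x - y) * \<delta>" for y
    proof (cases "norm (x - y) > \<epsilon>")
      case True thus ?thesis using \<kappa> by (simp add: mollifier_def)
    next
      case False
      thus ?thesis using \<kappa> d[of y] by (auto simp: mollifier_def norm_minus_commute intro: mult_left_mono)
    qed
  qed (use i2 in auto)
  finally show ?thesis using i1 i2 by simp
qed

lemma convolve_compact_support:
  assumes "mollifier \<epsilon> \<kappa>" "norm x > R + \<epsilon>"
  shows "convolve \<kappa> \<psi> x = 0"
proof -
  have "norm (convolve \<kappa> \<psi> x - 0) \<le> 0"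
  proof (rule convolve_mollifier_error[OF assms(1)])
    fix y assume "norm (y - x) \<le> \<epsilon>"
    hence "norm y > R" using assms(2) norm_triangle_sub[of x y] by (simp add: norm_minus_commute)
    thus "norm (\<psi> y - 0) \<le> 0" using supp by simp
  qed simp
  thus ?thesis by simp
qed

lemma convolve_mollifier_tendsto:
  assumes "\<And>n. mollifier (1 / real (Suc n)) (\<kappa> n)"
  shows "(\<lambda>n. convolve (\<kappa> n) \<psi> x) \<longlonglongrightarrow> \<psi> x"
proof (rule LIMSEQ_I)
  fix r :: real assume r: "r > 0"
  have "isCont \<psi> x" using cont by (simp add: continuous_on_eq_continuous_at)
  then obtain d where d: "d > 0" "\<And>y. norm (y - x) < d \<Longrightarrow> norm (\<psi> y - \<psi> x) < r / 2"
    using r unfolding continuous_at_eps_delta dist_norm by (metis half_gt_zero)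
  obtain N where N: "1 / real (Suc N) < d" using d(1) nat_approx_posE by blast
  show "\<exists>no. \<forall>n\<ge>no. norm (convolve (\<kappa> n) \<psi> x - \<psi> x) < r"
  proof (intro exI allI impI)
    fix n assume "n \<ge> N"
    hence "1 / real (Suc n) \<le> 1 / real (Suc N)" by (simp add: frac_le)
    hence "norm (convolve (\<kappa> n) \<psi> x - \<psi> x) \<le> r / 2"
      using d(2) N r by (intro convolve_mollifier_error[OF assms] less_imp_le) auto
    thus "norm (convolve (\<kappa> n) \<psi> x - \<psi> x) < r" using r by simp
  qed
qed

end

text \<open>The bridge from smooth test functions to C^1 ones. The uniform bounds and the common
  support are what dominated convergence will ask for; the support grows by 1 because all radii
  1/(n+1) are at most 1.\<close>

lemma test_function_approximation:
  fixes \<psi> :: "'a::euclidean_space \<Rightarrow> complex"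
  assumes \<psi>: "C_k (Suc 0) \<psi>" and supp: "\<And>x. norm x > R \<Longrightarrow> \<psi> x = 0"
  obtains \<Psi> where "\<And>n. test_function (\<Psi> n)" "\<And>n x. norm x > R + 1 \<Longrightarrow> \<Psi> n x = 0"
    "\<And>x. (\<lambda>n. \<Psi> n x) \<longlonglongrightarrow> \<psi> x" "\<And>v x. (\<lambda>n. dir_deriv v (\<Psi> n) x) \<longlonglongrightarrow> dir_deriv v \<psi> x"
    "\<exists>M. \<forall>n x. norm (\<Psi> n x) \<le> M" "\<And>v. \<exists>M. \<forall>n x. norm (dir_deriv v (\<Psi> n) x) \<le> M"
proof -
  have "\<forall>n. \<exists>\<kappa>::'a\<Rightarrow>real. mollifier (1 / real (Suc n)) \<kappa>" by (simp add: mollifier_exists del: of_nat_Suc)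
  then obtain \<kappa> :: "nat \<Rightarrow> 'a \<Rightarrow> real" where \<kappa>: "\<And>n. mollifier (1 / real (Suc n)) (\<kappa> n)" by metis
  note c = C_k_continuous[OF \<psi>]
  note cd = C_k_continuous[OF C_k_Suc_dir_deriv[OF \<psi>]]
  have sd: "dir_deriv v \<psi> x = 0" if "norm x > R" for v x
    using dir_deriv_compact_support[OF supp that] by auto
  have C: "C_k k (\<kappa> n)" for k n using \<kappa> by (auto simp: mollifier_def)
  have D: "dir_deriv v (convolve (\<kappa> n) \<psi>) x = convolve (\<kappa> n) (dir_deriv v \<psi>) x" for v n x
    by (rule convolve_dir_deriv[OF c supp C \<psi>])
  have bd: "\<exists>M. \<forall>n x. norm (convolve (\<kappa> n) \<psi> x) \<le> M" if c: "continuous_on UNIV \<psi>" and supp: "\<And>x. norm x > R \<Longrightarrow> \<psi> x = 0" for \<psi>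
  proof -
    obtain M where "M > 0" "\<And>x. norm (\<psi> x) \<le> M" using bounded_compact_support[OF c supp] by blast
    hence "norm (convolve (\<kappa> n) \<psi> x - 0) \<le> M" for n x
      by (intro convolve_mollifier_error[OF c supp \<kappa>]) auto
    thus ?thesis by auto
  qed
  have z: "convolve (\<kappa> n) \<psi> x = 0" if "norm x > R + 1" for n x
  proof (rule convolve_compact_support[OF c supp \<kappa>])
    have "1 / real (Suc n) \<le> 1" by simp
    thus "norm x > R + 1 / real (Suc n)" using that by linarith
  qed
  show ?thesis
  proof (rule that[of "\<lambda>n. convolve (\<kappa> n) \<psi>"])
    fix n
    have "{x. convolve (\<kappa> n) \<psi> x \<noteq> 0} \<subseteq> cball 0 (R + 1)" using z[of _ n] by (force simp: not_le[symmetric])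
    hence "compact (closure {x. convolve (\<kappa> n) \<psi> x \<noteq> 0})"
      using bounded_subset bounded_cball compact_closure by blast
    thus "test_function (convolve (\<kappa> n) \<psi>)"
      using C_k_convolve[OF c supp C] by (simp add: test_function_def)
  qed (use z convolve_mollifier_tendsto[OF c supp \<kappa>] convolve_mollifier_tendsto[OF cd sd \<kappa>] bd[OF c supp] bd[OF cd sd] D in auto)
qed

section \<open>Entire functions\<close>

lemma bounded_linear_scale_vec: "bounded_linear (\<lambda>c::complex. c *s (v::complex^'n))"
proof -
  have "linear (\<lambda>c::complex. c *s v)"
    by (rule linearI) (simp_all add: vec_eq_iff algebra_simps)
  thus ?thesis by (simp add: linear_conv_bounded_linear)
qed

lemma entire_has_derivative: "entire f \<Longrightarrow> (f has_derivative (\<lambda>v. dir_deriv v f z)) (at z)"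
  unfolding entire_def by (metis frechet_derivative_works differentiable_def)

lemma entire_dir_deriv_scale: "entire f \<Longrightarrow> dir_deriv (c *s v) f z = c * dir_deriv v f z"
  unfolding entire_def by (metis frechet_derivative_at)

lemma entire_line_derivative:
  assumes "entire f"
  shows "((\<lambda>\<zeta>. f (z + \<zeta> *s v)) has_field_derivative dir_deriv v f (z + \<zeta> *s v)) (at \<zeta>)"
proof -
  have "((\<lambda>\<zeta>. z + \<zeta> *s v) has_derivative (\<lambda>\<zeta>. \<zeta> *s v)) (at \<zeta>)"
    by (rule derivative_eq_intros bounded_linear_imp_has_derivative[OF bounded_linear_scale_vec] | simp)+
  hence "((\<lambda>\<zeta>. f (z + \<zeta> *s v)) has_derivative (\<lambda>h. dir_deriv (h *s v) f (z + \<zeta> *s v))) (at \<zeta>)"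
    by (rule has_derivative_compose[OF _ entire_has_derivative[OF assms]])
  thus ?thesis
    unfolding has_field_derivative_def by (simp add: entire_dir_deriv_scale[OF assms] mult.commute[of _ "dir_deriv v f _"])
qed

abbreviation circ :: "real \<Rightarrow> complex" where "circ t \<equiv> exp (2 * of_real pi * \<i> * of_real t)"

text \<open>Cauchy's formula for the derivative in one variable, applied on the complex line through
  z in direction v. It expresses derivatives by integrals of f itself, so that the regularity of f
  passes on to them.\<close>

lemma entire_cauchy:
  assumes "entire f"
  shows "dir_deriv v f z = integral (cbox 0 1) (\<lambda>t. f (z + circ t *s v) / circ t)"
proof -
  let ?h = "\<lambda>\<zeta>. f (z + \<zeta> *s v)"
  have h: "?h holomorphic_on S" for S
    using entire_line_derivative[OF assms] by (intro holomorphic_onI) (metis field_differentiable_at_within field_differentiable_def)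
  have "(?h has_field_derivative (1 / (2 * of_real pi * \<i>) * contour_integral (circlepath 0 1) (\<lambda>u. ?h u / (u - 0)\<^sup>2))) (at 0)"
    by (rule Cauchy_derivative_integral_circlepath[OF holomorphic_on_imp_continuous_on[OF h] h]) simp
  hence "dir_deriv v f (z + 0 *s v) = 1 / (2 * of_real pi * \<i>) * contour_integral (circlepath 0 1) (\<lambda>u. ?h u / (u - 0)\<^sup>2)"
    using entire_line_derivative[OF assms, of z v 0] DERIV_unique by blast
  also have "contour_integral (circlepath 0 1) (\<lambda>u. ?h u / (u - 0)\<^sup>2) =
     integral {0..1} (\<lambda>t. 2 * of_real pi * \<i> * (f (z + circ t *s v) / circ t))"
    unfolding contour_integral_integral
  proof (rule integral_cong)
    fix t :: real
    have c: "circlepath 0 1 t = circ t" by (simp add: circlepath)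
    show "?h (circlepath 0 1 t) / (circlepath 0 1 t - 0)\<^sup>2 * vector_derivative (circlepath 0 1) (at t)
       = 2 * of_real pi * \<i> * (f (z + circ t *s v) / circ t)"
      unfolding c vector_derivative_circlepath by (simp add: power2_eq_square field_simps)
  qed
  also have "\<dots> = 2 * of_real pi * \<i> * integral {0..1} (\<lambda>t. f (z + circ t *s v) / circ t)"
    by (rule integral_mult_right)
  finally show ?thesis by simp
qed

lemma continuous_on_circ_line:
  assumes "continuous_on UNIV g"
  shows "continuous_on (UNIV \<times> cbox 0 1) (\<lambda>(z, t). g (z + circ t *s (v::complex^'n)) / circ t)"
proof -
  have c: "continuous_on S (\<lambda>p::(complex^'n) \<times> real. circ (snd p))" for S
    by (intro continuous_intros)
  have "continuous_on S (\<lambda>p::(complex^'n) \<times> real. fst p + circ (snd p) *s v)" for S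
    by (intro continuous_on_add continuous_on_fst continuous_on_id bounded_linear.continuous_on[OF bounded_linear_scale_vec c])
  hence "continuous_on S (\<lambda>p. g (fst p + circ (snd p) *s v))" for S
    using continuous_on_compose2[OF assms] by auto
  hence "continuous_on S (\<lambda>p. g (fst p + circ (snd p) *s v) / circ (snd p))" for S
    by (intro continuous_on_divide c) auto
  thus ?thesis unfolding case_prod_beta .
qed

text \<open>\<open>entire\<close> gives a derivative at each point but no continuity in the point.
  In Cauchy's formula the derivative is an integral of the continuous f over a compact parameter
  interval, hence continuous.\<close>

lemma C_1_entire:
  assumes "entire f" shows "C_k (Suc 0) f"
proof (rule C_k_SucI[OF entire_has_derivative[OF assms]])
  fix v
  have "continuous_on UNIV f"
    using has_derivative_continuous[OF entire_has_derivative[OF assms]]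
    by (simp add: continuous_at_imp_continuous_on)
  hence "continuous_on UNIV (\<lambda>z. integral (cbox 0 1) (\<lambda>t. f (z + circ t *s v) / circ t))"
    by (intro integral_continuous_on_param continuous_on_circ_line)+
  thus "C_k 0 (dir_deriv v f)" by (simp add: entire_cauchy[OF assms])
qed

text \<open>Cauchy's formula is differentiated under the integral sign; complex linearity of the new
  derivative is inherited from the integrand.\<close>

lemma entire_dir_deriv:
  assumes f: "entire f" shows "entire (dir_deriv v f)"
  unfolding entire_def
proof
  fix z
  note C = C_1_entire[OF f]
  let ?D = "\<lambda>z t. Blinfun (\<lambda>w. dir_deriv w f (z + circ t *s v) / circ t)"
  have "bounded_linear (\<lambda>w. dir_deriv w f (z + circ t *s v) / circ t)" for z t
    using has_derivative_bounded_linear[OF C_k_Suc_has_derivative[OF C]]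
    by (rule bounded_linear_compose[OF bounded_linear_divide])
  hence D: "blinfun_apply (?D z t) = (\<lambda>w. dir_deriv w f (z + circ t *s v) / circ t)" for z t
    by (rule bounded_linear_Blinfun_apply)
  have cD: "continuous_on (UNIV \<times> cbox 0 1) (\<lambda>(z, t). ?D z t)"
  proof (rule continuous_on_blinfun_componentwise)
    fix i
    show "continuous_on (UNIV \<times> cbox 0 1) (\<lambda>x. blinfun_apply (case x of (z, t) \<Rightarrow> ?D z t) i)"
      using continuous_on_circ_line[OF C_k_continuous[OF C_k_Suc_dir_deriv[OF C]], of v i]
      by (simp add: D case_prod_beta)
  qed
  have "((\<lambda>z. integral (cbox 0 1) (\<lambda>t. f (z + circ t *s v) / circ t)) has_derivative integral (cbox 0 1) (?D z)) (at z within UNIV)"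
  proof (rule leibniz_rule[OF _ _ cD])
    fix z t
    have "((\<lambda>z. f (z + circ t *s v)) has_derivative (\<lambda>w. dir_deriv w f (z + circ t *s v))) (at z)"
      by (rule has_derivative_compose[OF _ C_k_Suc_has_derivative[OF C], of "\<lambda>x. x + circ t *s v"]) (auto intro!: derivative_eq_intros)
    from has_derivative_mult_left[OF this, of "inverse (circ t)"]
    show "((\<lambda>z. f (z + circ t *s v) / circ t) has_derivative blinfun_apply (?D z t)) (at z within UNIV)"
      unfolding D unfolding divide_inverse by simp
  next
    fix z
    show "(\<lambda>t. f (z + circ t *s v) / circ t) integrable_on cbox 0 1"
    proof (rule integrable_continuous)
      have "continuous_on (cbox 0 1) (\<lambda>t. case (z, t) of (z, t) \<Rightarrow> f (z + circ t *s v) / circ t)"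
        by (rule continuous_on_compose2[OF continuous_on_circ_line[OF C_k_continuous[OF C], of v]
          continuous_on_Pair[OF continuous_on_const continuous_on_id]]) auto
      thus "continuous_on (cbox 0 1) (\<lambda>t. f (z + circ t *s v) / circ t)" by simp
    qed
  qed auto
  hence der: "(dir_deriv v f has_derivative integral (cbox 0 1) (?D z)) (at z)"
    by (simp add: entire_cauchy[OF f])
  have "blinfun_apply (integral (cbox 0 1) (?D z)) w = integral (cbox 0 1) (\<lambda>t. blinfun_apply (?D z t) w)" for w
  proof (rule blinfun_apply_integral, rule integrable_continuous)
    show "continuous_on (cbox 0 1) (?D z)"
      using continuous_on_compose2[OF cD, of "cbox 0 1" "\<lambda>t. (z, t)"] continuous_on_Pair[OF continuous_on_const continuous_on_id]
      by auto
  qed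
  hence "blinfun_apply (integral (cbox 0 1) (?D z)) (c *s h) = c * blinfun_apply (integral (cbox 0 1) (?D z)) h" for c h
    by (simp add: D entire_dir_deriv_scale[OF f] flip: times_divide_eq_right)
  thus "\<exists>f'. (dir_deriv v f has_derivative f') (at z) \<and> (\<forall>c h. f' (c *s h) = c * f' h)"
    using der by blast
qed

section \<open>The complex Hessian\<close>

lemma dir_deriv_linear:
  assumes "C_k (Suc k) f"
  shows "linear (\<lambda>v. dir_deriv v f x)"
  using has_derivative_linear[OF C_k_Suc_has_derivative[OF assms]] .

abbreviation second_deriv :: "('a::euclidean_space \<Rightarrow> real) \<Rightarrow> 'a \<Rightarrow> 'a \<Rightarrow> 'a \<Rightarrow> real" where
  "second_deriv \<phi> x u v \<equiv> dir_deriv v (dir_deriv u \<phi>) x"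

context
  fixes \<phi> :: "'a::euclidean_space \<Rightarrow> real"
  assumes \<phi>: "C_k (Suc (Suc 0)) \<phi>"
begin

lemma second_deriv_linear_left: "linear (\<lambda>u. second_deriv \<phi> x u v)"
proof
  note d = C_k_Suc_has_derivative[OF C_k_Suc_dir_deriv[OF \<phi>]]
  fix u u' and c :: real
  have "dir_deriv (u + u') \<phi> = (\<lambda>x. dir_deriv u \<phi> x + dir_deriv u' \<phi> x)"
    using linear_add[OF dir_deriv_linear[OF \<phi>]] by auto
  thus "second_deriv \<phi> x (u + u') v = second_deriv \<phi> x u v + second_deriv \<phi> x u' v"
    using dir_deriv_eq[OF has_derivative_add[OF d d]] by simp
  have "dir_deriv (c *\<^sub>R u) \<phi> = (\<lambda>x. c *\<^sub>R dir_deriv u \<phi> x)"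
    using linear_scale[OF dir_deriv_linear[OF \<phi>]] by auto
  thus "second_deriv \<phi> x (c *\<^sub>R u) v = c *\<^sub>R second_deriv \<phi> x u v"
    using dir_deriv_eq[OF has_derivative_scaleR_right[OF d]] by simp
qed

lemma second_deriv_linear_right: "linear (\<lambda>v. second_deriv \<phi> x u v)"
  by (rule dir_deriv_linear[OF C_k_Suc_dir_deriv[OF \<phi>]])

lemma second_deriv_continuous: "continuous_on UNIV (\<lambda>x. second_deriv \<phi> x u v)"
  by (rule C_k_continuous[OF C_k_Suc_dir_deriv[OF C_k_Suc_dir_deriv[OF \<phi>]]])

lemma has_real_derivative_line:
  assumes "C_k (Suc k) (f :: 'a \<Rightarrow> real)"
  shows "((\<lambda>s. f (x + s *\<^sub>R v)) has_real_derivative dir_deriv v f (x + s *\<^sub>R v)) (at s)"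
  using has_vector_derivative_line[OF assms] has_real_derivative_iff_has_vector_derivative by blast

text \<open>Two applications of the mean value theorem, in direction u to the increment along v and
  then in direction v. The second difference does not change when u and v are swapped, so its limit
  yields the symmetry of second derivatives.\<close>

lemma second_difference:
  assumes "h > 0"
  obtains \<xi> \<eta> where "0 < \<xi>" "\<xi> < h" "0 < \<eta>" "\<eta> < h"
    "\<phi> (x + h *\<^sub>R u + h *\<^sub>R v) - \<phi> (x + h *\<^sub>R u) - \<phi> (x + h *\<^sub>R v) + \<phi> x
      = h\<^sup>2 * second_deriv \<phi> (x + \<xi> *\<^sub>R u + \<eta> *\<^sub>R v) u v"
proof -
  have "\<exists>\<xi>. 0 < \<xi> \<and> \<xi> < h \<and> (\<phi> (x + h *\<^sub>R v + h *\<^sub>R u) - \<phi> (x + h *\<^sub>R u)) - (\<phi> (x + h *\<^sub>R v + 0 *\<^sub>R u) - \<phi> (x + 0 *\<^sub>R u))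
     = (h - 0) * (dir_deriv u \<phi> (x + h *\<^sub>R v + \<xi> *\<^sub>R u) - dir_deriv u \<phi> (x + \<xi> *\<^sub>R u))"
    by (rule MVT2[OF assms]) (intro DERIV_diff has_real_derivative_line[OF \<phi>])
  then obtain \<xi> where \<xi>: "0 < \<xi>" "\<xi> < h"
    and 1: "(\<phi> (x + h *\<^sub>R v + h *\<^sub>R u) - \<phi> (x + h *\<^sub>R u)) - (\<phi> (x + h *\<^sub>R v) - \<phi> x)
       = h * (dir_deriv u \<phi> (x + h *\<^sub>R v + \<xi> *\<^sub>R u) - dir_deriv u \<phi> (x + \<xi> *\<^sub>R u))" by auto
  have "\<exists>\<eta>. 0 < \<eta> \<and> \<eta> < h \<and> dir_deriv u \<phi> (x + \<xi> *\<^sub>R u + h *\<^sub>R v) - dir_deriv u \<phi> (x + \<xi> *\<^sub>R u + 0 *\<^sub>R v)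
     = (h - 0) * second_deriv \<phi> (x + \<xi> *\<^sub>R u + \<eta> *\<^sub>R v) u v"
    by (rule MVT2[OF assms]) (rule has_real_derivative_line[OF C_k_Suc_dir_deriv[OF \<phi>]])
  then obtain \<eta> where \<eta>: "0 < \<eta>" "\<eta> < h"
    and 2: "dir_deriv u \<phi> (x + h *\<^sub>R v + \<xi> *\<^sub>R u) - dir_deriv u \<phi> (x + \<xi> *\<^sub>R u)
     = h * second_deriv \<phi> (x + \<xi> *\<^sub>R u + \<eta> *\<^sub>R v) u v" by (auto simp: add_ac)
  show ?thesis using that[OF \<xi> \<eta>] 1 unfolding 2 by (simp add: power2_eq_square add_ac)
qed

lemma second_difference_tendsto:
  "(\<lambda>n. (\<phi> (x + (1 / real (Suc n)) *\<^sub>R u + (1 / real (Suc n)) *\<^sub>R v) - \<phi> (x + (1 / real (Suc n)) *\<^sub>R u)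
     - \<phi> (x + (1 / real (Suc n)) *\<^sub>R v) + \<phi> x) / (1 / real (Suc n))\<^sup>2) \<longlonglongrightarrow> second_deriv \<phi> x u v"
proof -
  let ?h = "\<lambda>n. 1 / real (Suc n)"
  have "\<forall>n. \<exists>\<xi> \<eta>. 0 < \<xi> \<and> \<xi> < ?h n \<and> 0 < \<eta> \<and> \<eta> < ?h n \<and>
    \<phi> (x + ?h n *\<^sub>R u + ?h n *\<^sub>R v) - \<phi> (x + ?h n *\<^sub>R u) - \<phi> (x + ?h n *\<^sub>R v) + \<phi> x
      = (?h n)\<^sup>2 * second_deriv \<phi> (x + \<xi> *\<^sub>R u + \<eta> *\<^sub>R v) u v"
  proof
    fix n
    have h: "?h n > 0" by simp
    show "\<exists>\<xi> \<eta>. 0 < \<xi> \<and> \<xi> < ?h n \<and> 0 < \<eta> \<and> \<eta> < ?h n \<and>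
      \<phi> (x + ?h n *\<^sub>R u + ?h n *\<^sub>R v) - \<phi> (x + ?h n *\<^sub>R u) - \<phi> (x + ?h n *\<^sub>R v) + \<phi> x
      = (?h n)\<^sup>2 * second_deriv \<phi> (x + \<xi> *\<^sub>R u + \<eta> *\<^sub>R v) u v"
      by (rule second_difference[OF h, of x u v]) blast
  qed
  then obtain \<xi> \<eta> where b: "\<And>n. 0 < \<xi> n" "\<And>n. \<xi> n < ?h n" "\<And>n. 0 < \<eta> n" "\<And>n. \<eta> n < ?h n"
    and eq: "\<And>n. \<phi> (x + ?h n *\<^sub>R u + ?h n *\<^sub>R v) - \<phi> (x + ?h n *\<^sub>R u) - \<phi> (x + ?h n *\<^sub>R v) + \<phi> x
      = (?h n)\<^sup>2 * second_deriv \<phi> (x + \<xi> n *\<^sub>R u + \<eta> n *\<^sub>R v) u v" by metis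
  have h: "?h \<longlonglongrightarrow> 0" using LIMSEQ_inverse_real_of_nat by (simp add: inverse_eq_divide)
  have "\<xi> \<longlonglongrightarrow> 0" "\<eta> \<longlonglongrightarrow> 0"
    by (rule tendsto_sandwich[OF _ _ tendsto_const h]; use b in \<open>auto intro!: always_eventually less_imp_le simp del: of_nat_Suc\<close>)+
  hence "(\<lambda>n. x + \<xi> n *\<^sub>R u + \<eta> n *\<^sub>R v) \<longlonglongrightarrow> x + 0 *\<^sub>R u + 0 *\<^sub>R v"
    by (intro tendsto_intros)
  hence "(\<lambda>n. second_deriv \<phi> (x + \<xi> n *\<^sub>R u + \<eta> n *\<^sub>R v) u v) \<longlonglongrightarrow> second_deriv \<phi> x u v"
    using isCont_tendsto_compose[of x "\<lambda>x. second_deriv \<phi> x u v"] second_deriv_continuous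
    by (auto simp: continuous_on_eq_continuous_at)
  thus ?thesis unfolding eq by simp
qed

lemma second_deriv_symmetric: "second_deriv \<phi> x u v = second_deriv \<phi> x v u"
proof (rule LIMSEQ_unique[OF second_difference_tendsto])
  show "(\<lambda>n. (\<phi> (x + (1 / real (Suc n)) *\<^sub>R u + (1 / real (Suc n)) *\<^sub>R v) - \<phi> (x + (1 / real (Suc n)) *\<^sub>R u)
     - \<phi> (x + (1 / real (Suc n)) *\<^sub>R v) + \<phi> x) / (1 / real (Suc n))\<^sup>2) \<longlonglongrightarrow> second_deriv \<phi> x v u"
    using second_difference_tendsto[of x v u] by (simp add: add_ac diff_diff_eq)
qed

lemma taylor2:
  assumes "r > 0"
  obtains \<xi> where "0 < \<xi>" "\<xi> < r"
    "\<phi> (x + r *\<^sub>R v) = \<phi> x + r * dir_deriv v \<phi> x + r\<^sup>2 / 2 * second_deriv \<phi> (x + \<xi> *\<^sub>R v) v v"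
proof -
  let ?d = "\<lambda>m::nat. case m of 0 \<Rightarrow> (\<lambda>s. \<phi> (x + s *\<^sub>R v)) | Suc 0 \<Rightarrow> (\<lambda>s. dir_deriv v \<phi> (x + s *\<^sub>R v))
     | _ \<Rightarrow> (\<lambda>s. second_deriv \<phi> (x + s *\<^sub>R v) v v)"
  have "\<exists>\<xi>>0. \<xi> < r \<and> \<phi> (x + r *\<^sub>R v) = (\<Sum>m<2. ?d m 0 / fact m * r ^ m) + ?d 2 \<xi> / fact 2 * r ^ 2"
  proof (rule Maclaurin[OF assms])
    show "\<forall>m t. m < 2 \<and> 0 \<le> t \<and> t \<le> r \<longrightarrow> (?d m has_real_derivative ?d (Suc m) t) (at t)"
      using has_real_derivative_line[OF \<phi>] has_real_derivative_line[OF C_k_Suc_dir_deriv[OF \<phi>]]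
      by (auto simp: less_2_cases_iff)
  qed auto
  thus ?thesis using that by (auto simp: numeral_2_eq_2)
qed

end

section \<open>From the sub-mean value property to a nonnegative Levi form\<close>

lemma trig_integral:
  "((\<lambda>t. A + B * cos t + C * sin t + D * (cos t)\<^sup>2 + E * (sin t * cos t) + F * (sin t)\<^sup>2)
     has_integral (2 * pi * A + pi * (D + F))) {0..2*pi}"
proof -
  let ?G = "\<lambda>t. A * t + B * sin t - C * cos t + D * (t / 2 + sin t * cos t / 2) + E * ((sin t)\<^sup>2 / 2) + F * (t / 2 - sin t * cos t / 2)"
  have "((\<lambda>t. A + B * cos t + C * sin t + D * (cos t)\<^sup>2 + E * (sin t * cos t) + F * (sin t)\<^sup>2)
     has_integral (?G (2*pi) - ?G 0)) {0..2*pi}"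
  proof (rule fundamental_theorem_of_calculus)
    fix t :: real
    have s: "(sin t)\<^sup>2 = 1 - (cos t)\<^sup>2" by (simp add: sin_squared_eq)
    have "(?G has_real_derivative (A + B * cos t + C * sin t + D * (cos t)\<^sup>2 + E * (sin t * cos t) + F * (sin t)\<^sup>2)) (at t)"
      by (rule derivative_eq_intros refl | simp)+ (simp add: s power2_eq_square[symmetric] field_simps)
    thus "(?G has_vector_derivative (A + B * cos t + C * sin t + D * (cos t)\<^sup>2 + E * (sin t * cos t) + F * (sin t)\<^sup>2)) (at t within {0..2*pi})"
      using has_real_derivative_iff_has_vector_derivative has_vector_derivative_at_within by blast
  qed simp
  thus ?thesis by (simp add: algebra_simps)
qed

lemma cis_scale: "cis t *s (w :: complex^'n) = cos t *\<^sub>R w + sin t *\<^sub>R (\<i> *s w)"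
  by (simp add: vec_eq_iff complex_eq_iff algebra_simps)

text \<open>Were the sum negative, the Taylor expansion on a small circle in the complex direction w
  would put the circle mean strictly below the value at the centre: linear and mixed terms integrate
  to zero, and the squares of cosine and sine contribute equally.\<close>

lemma plurisubharmonic_second_deriv_nonneg:
  fixes \<phi> :: "complex^'n \<Rightarrow> real"
  assumes \<phi>: "C_k (Suc (Suc 0)) \<phi>" and psh: "plurisubharmonic \<phi>"
  shows "0 \<le> second_deriv \<phi> z w w + second_deriv \<phi> z (\<i> *s w) (\<i> *s w)"
proof (rule ccontr)
  let ?H = "second_deriv \<phi>" and ?w = "\<i> *s w"
  let ?L = "?H z w w + ?H z ?w ?w"
  assume "\<not> 0 \<le> ?L"
  \<comment> \<open>The tolerance for second derivatives near z. It enters the mean as 6 \<epsilon>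
    = - \<open>?L\<close> / 2, so half of the negative quantity survives.\<close>
  define \<epsilon> where "\<epsilon> = - ?L / 12"
  have \<epsilon>: "\<epsilon> > 0" using \<open>\<not> 0 \<le> ?L\<close> by (simp add: \<epsilon>_def)
  define P where "P x \<longleftrightarrow> (\<forall>(u, v) \<in> {(w, w), (w, ?w), (?w, w), (?w, ?w)}. ?H x u v \<le> ?H z u v + \<epsilon> \<and> ?H x u v \<ge> ?H z u v - \<epsilon>)" for x
  have "eventually P (nhds z)"
  proof -
    have "eventually (\<lambda>x. ?H x u v \<le> ?H z u v + \<epsilon> \<and> ?H x u v \<ge> ?H z u v - \<epsilon>) (nhds z)" for u v
    proof -
      have "isCont (\<lambda>x. ?H x u v) z"
        using second_deriv_continuous[OF \<phi>] by (simp add: continuous_on_eq_continuous_at)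
      hence "((\<lambda>x. ?H x u v) \<longlongrightarrow> ?H z u v) (nhds z)"
        using tendsto_at_iff_tendsto_nhds[of "\<lambda>x. ?H x u v" z] by (simp add: isCont_def)
      hence "eventually (\<lambda>x. dist (?H x u v) (?H z u v) < \<epsilon>) (nhds z)" using \<epsilon> by (rule tendstoD)
      thus ?thesis by eventually_elim (auto simp: dist_real_def)
    qed
    thus ?thesis unfolding P_def by (intro eventually_ball_finite) auto
  qed
  then obtain \<delta> where \<delta>: "\<delta> > 0" and near: "\<And>x. dist x z < \<delta> \<Longrightarrow> P x"
    unfolding eventually_nhds_metric by metis
  \<comment> \<open>The summand 1 covers w = 0 and makes r |w| strictly smaller than
    \<delta>.\<close>
  define r where "r = \<delta> / (norm w + 1)"
  have r: "r > 0" using \<delta> by (simp add: r_def add_nonneg_pos)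
  have "norm w + 1 > 0" by (simp add: add_nonneg_pos)
  hence rw: "r * norm w < \<delta>" using \<delta> by (simp add: r_def pos_divide_less_eq)
  let ?R = "\<lambda>t. (\<phi> z + 3 * r\<^sup>2 / 2 * \<epsilon>) + (r * dir_deriv w \<phi> z) * cos t + (r * dir_deriv ?w \<phi> z) * sin t
     + (r\<^sup>2 / 2 * ?H z w w) * (cos t)\<^sup>2 + (r\<^sup>2 / 2 * (?H z w ?w + ?H z ?w w)) * (sin t * cos t) + (r\<^sup>2 / 2 * ?H z ?w ?w) * (sin t)\<^sup>2"
  have le: "\<phi> (z + cis t *s (r *\<^sub>R w)) \<le> ?R t" for t
  proof -
    define c where "c = cos t"
    define s where "s = sin t"
    define v where "v = c *\<^sub>R w + s *\<^sub>R ?w"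
    have v: "cis t *s w = v" by (simp add: v_def c_def s_def cis_scale)
    have nv: "norm v = norm w" unfolding v[symmetric] by (simp add: norm_mult norm_vec_def)
    have rv: "cis t *s (r *\<^sub>R w) = r *\<^sub>R v" unfolding v[symmetric] by (simp add: vec_eq_iff)
    obtain \<xi> where \<xi>: "0 < \<xi>" "\<xi> < r"
      and T: "\<phi> (z + r *\<^sub>R v) = \<phi> z + r * dir_deriv v \<phi> z + r\<^sup>2 / 2 * ?H (z + \<xi> *\<^sub>R v) v v"
      using taylor2[OF \<phi> r] by blast
    let ?x = "z + \<xi> *\<^sub>R v"
    have "dist ?x z < \<delta>"
      using \<xi> rw mult_right_mono[of \<xi> r "norm w"] by (simp add: dist_norm nv)
    note nr = near[OF this, unfolded P_def]
    have D: "dir_deriv v \<phi> z = c * dir_deriv w \<phi> z + s * dir_deriv ?w \<phi> z"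
      using dir_deriv_linear[OF \<phi>, of z] by (simp add: v_def linear_add linear_scale)
    have Hv: "?H x v v = c\<^sup>2 * ?H x w w + (s * c) * (?H x w ?w + ?H x ?w w) + s\<^sup>2 * ?H x ?w ?w" for x
      unfolding v_def
      by (simp add: linear_add[OF second_deriv_linear_left[OF \<phi>]] linear_scale[OF second_deriv_linear_left[OF \<phi>]]
        linear_add[OF second_deriv_linear_right[OF \<phi>]] linear_scale[OF second_deriv_linear_right[OF \<phi>]] power2_eq_square algebra_simps)
    have sc: "\<bar>s * c\<bar> \<le> 1" unfolding s_def c_def abs_mult by (intro mult_le_one) auto
    define d where "d = (?H ?x w ?w + ?H ?x ?w w) - (?H z w ?w + ?H z ?w w)"
    have "\<bar>d\<bar> \<le> 2 * \<epsilon>"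
      using nr unfolding d_def by (simp add: abs_if)
    hence "\<bar>s * c\<bar> * \<bar>d\<bar> \<le> \<bar>s * c\<bar> * (2 * \<epsilon>)" by (rule mult_left_mono) simp
    hence "(s * c) * d \<le> \<bar>s * c\<bar> * (2 * \<epsilon>)" unfolding abs_mult[symmetric] by linarith
    also have "\<dots> \<le> 1 * (2 * \<epsilon>)" using sc \<epsilon> by (intro mult_right_mono) auto
    finally have a1: "(s * c) * (?H ?x w ?w + ?H ?x ?w w) \<le> (s * c) * (?H z w ?w + ?H z ?w w) + 2 * \<epsilon>"
      unfolding d_def by (simp add: algebra_simps)
    have a2: "c\<^sup>2 * ?H ?x w w \<le> c\<^sup>2 * (?H z w w + \<epsilon>)" "s\<^sup>2 * ?H ?x ?w ?w \<le> s\<^sup>2 * (?H z ?w ?w + \<epsilon>)"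
      using nr by (intro mult_left_mono; simp)+
    have a3: "c\<^sup>2 * \<epsilon> + s\<^sup>2 * \<epsilon> = \<epsilon>"
      unfolding distrib_right[symmetric] c_def s_def by simp
    \<comment> \<open>The cross term costs 2 \<epsilon>, as |s c| \<le> 1; the two square terms
      together cost one \<epsilon>, as c^2 + s^2 = 1.\<close>
    have "?H ?x v v \<le> ?H z v v + 3 * \<epsilon>"
      unfolding Hv using a1 a2 a3 by (simp add: algebra_simps)
    hence "r\<^sup>2 / 2 * ?H ?x v v \<le> r\<^sup>2 / 2 * (?H z v v + 3 * \<epsilon>)" by (intro mult_left_mono) auto
    hence "\<phi> (z + cis t *s (r *\<^sub>R w)) \<le> \<phi> z + r * dir_deriv v \<phi> z + r\<^sup>2 / 2 * (?H z v v + 3 * \<epsilon>)"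
      unfolding rv T by simp
    thus ?thesis unfolding D Hv c_def[symmetric] s_def[symmetric] by (simp add: algebra_simps)
  qed
  have "(\<lambda>t. \<phi> (z + cis t *s (r *\<^sub>R w))) integrable_on {0..2*pi}"
    using psh set_lebesgue_integral_eq_integral(1) unfolding plurisubharmonic_def by blast
  hence "integral {0..2*pi} (\<lambda>t. \<phi> (z + cis t *s (r *\<^sub>R w))) \<le>
     2 * pi * (\<phi> z + 3 * r\<^sup>2 / 2 * \<epsilon>) + pi * (r\<^sup>2 / 2 * ?H z w w + r\<^sup>2 / 2 * ?H z ?w ?w)"
    using le by (intro has_integral_le[OF integrable_integral trig_integral])
  also have "\<dots> = 2 * pi * \<phi> z + pi * r\<^sup>2 / 2 * (6 * \<epsilon> + ?L)" by (simp add: algebra_simps)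
  also have "\<dots> < 2 * pi * \<phi> z"
  proof -
    have "x = - (12 * (- x / 12))" for x :: real by simp
    hence "?L = - (12 * \<epsilon>)" unfolding \<epsilon>_def .
    hence "6 * \<epsilon> + ?L < 0" using \<epsilon> by linarith
    hence "pi * r\<^sup>2 / 2 * (6 * \<epsilon> + ?L) < 0" using r by (intro mult_pos_neg) auto
    thus ?thesis by linarith
  qed
  also have "\<dots> \<le> integral {0..2*pi} (\<lambda>t. \<phi> (z + cis t *s (r *\<^sub>R w)))"
    using psh unfolding plurisubharmonic_def by (simp add: field_simps)
  finally show False by simp
qed

section \<open>Control of all entries of the complex Hessian by its trace\<close>

lemma dir_deriv_of_real:
  assumes "C_k (Suc k) \<phi>"
  shows "dir_deriv v (\<lambda>x. complex_of_real (\<phi> x)) = (\<lambda>x. complex_of_real (dir_deriv v \<phi> x))"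
  using dir_deriv_eq[OF has_derivative_of_real[OF C_k_Suc_has_derivative[OF assms]]] by auto

lemma dir_deriv_wirtinger:
  fixes f g :: "'a::euclidean_space \<Rightarrow> real"
  assumes "C_k (Suc k) f" "C_k (Suc l) g"
  shows "dir_deriv v (\<lambda>x. (complex_of_real (f x) + c * complex_of_real (g x)) / 2) x
     = (complex_of_real (dir_deriv v f x) + c * complex_of_real (dir_deriv v g x)) / 2"
proof -
  have "((\<lambda>x. (complex_of_real (f x) + c * complex_of_real (g x)) * (1/2)) has_derivative
     (\<lambda>v. (complex_of_real (dir_deriv v f x) + c * complex_of_real (dir_deriv v g x)) * (1/2))) (at x)"
    by (intro has_derivative_mult_left has_derivative_add has_derivative_mult_right has_derivative_of_real
      C_k_Suc_has_derivative[OF assms(1)] C_k_Suc_has_derivative[OF assms(2)])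
  from dir_deriv_eq[OF this] show ?thesis by simp
qed

lemma axis_ii: "axis j \<i> = \<i> *s (axis j 1 :: complex^'n)"
  by (simp add: vec_eq_iff axis_def)

context
  fixes \<phi> :: "complex^'n \<Rightarrow> real"
  assumes \<phi>: "C_k (Suc (Suc 0)) \<phi>"
begin

lemma d_z_d_zbar:
  "d_z j (d_zbar k (\<lambda>w. complex_of_real (\<phi> w))) z =
    (complex_of_real (second_deriv \<phi> z (axis k 1) (axis j 1) + second_deriv \<phi> z (axis k \<i>) (axis j \<i>)) +
     \<i> * complex_of_real (second_deriv \<phi> z (axis k \<i>) (axis j 1) - second_deriv \<phi> z (axis k 1) (axis j \<i>))) / 4"
proof -
  have "d_zbar k (\<lambda>w. complex_of_real (\<phi> w)) = (\<lambda>w. (complex_of_real (dir_deriv (axis k 1) \<phi> w) + \<i> * complex_of_real (dir_deriv (axis k \<i>) \<phi> w)) / 2)"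
    by (simp add: d_zbar_def fun_eq_iff dir_deriv_of_real[OF \<phi>, THEN fun_cong])
  thus ?thesis
    unfolding d_z_def
    by (simp add: dir_deriv_wirtinger[OF C_k_Suc_dir_deriv[OF \<phi>] C_k_Suc_dir_deriv[OF \<phi>]] field_simps)
qed

text \<open>This order of differentiation comes from the commutator with \<open>delta\<close>, the
  other one from \<open>complex_hessian\<close>; reduction to real second derivatives makes the two
  comparable.\<close>

lemma d_zbar_d_z:
  "d_zbar k (d_z j (\<lambda>w. complex_of_real (\<phi> w))) z =
    (complex_of_real (second_deriv \<phi> z (axis j 1) (axis k 1) + second_deriv \<phi> z (axis j \<i>) (axis k \<i>)) +
     \<i> * complex_of_real (second_deriv \<phi> z (axis j 1) (axis k \<i>) - second_deriv \<phi> z (axis j \<i>) (axis k 1))) / 4"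
proof -
  have "d_z j (\<lambda>w. complex_of_real (\<phi> w)) = (\<lambda>w. (complex_of_real (dir_deriv (axis j 1) \<phi> w) + (- \<i>) * complex_of_real (dir_deriv (axis j \<i>) \<phi> w)) / 2)"
    by (simp add: d_z_def fun_eq_iff dir_deriv_of_real[OF \<phi>, THEN fun_cong])
  thus ?thesis
    unfolding d_zbar_def
    by (simp only: dir_deriv_wirtinger[OF C_k_Suc_dir_deriv[OF \<phi>] C_k_Suc_dir_deriv[OF \<phi>]]) (simp add: field_simps)
qed

lemma second_deriv_minus [simp]: "second_deriv \<phi> z (- u) v = - second_deriv \<phi> z u v"
  "second_deriv \<phi> z u (- v) = - second_deriv \<phi> z u v"
  using linear_neg[OF second_deriv_linear_left[OF \<phi>]] linear_neg[OF second_deriv_linear_right[OF \<phi>]] by auto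

text \<open>Four times the Hermitian form of the complex Hessian at w, that is, the real Laplacian
  of \<zeta> \<mapsto> \<phi> (z + \<zeta> w) at \<zeta> = 0.\<close>

definition levi :: "complex^'n \<Rightarrow> complex^'n \<Rightarrow> real" where
  "levi z w = second_deriv \<phi> z w w + second_deriv \<phi> z (\<i> *s w) (\<i> *s w)"

lemma levi_add:
  "levi z (u + v) = levi z u + levi z v + 2 * (second_deriv \<phi> z u v + second_deriv \<phi> z (\<i> *s u) (\<i> *s v))"
proof -
  have "\<i> *s (u + v) = \<i> *s u + \<i> *s v" by (simp add: vec_eq_iff algebra_simps)
  thus ?thesis
    unfolding levi_def using second_deriv_symmetric[OF \<phi>, where x=z and u=v and v=u]
      second_deriv_symmetric[OF \<phi>, where x=z and u="\<i> *s v" and v="\<i> *s u"]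
    by (simp add: linear_add[OF second_deriv_linear_left[OF \<phi>]] linear_add[OF second_deriv_linear_right[OF \<phi>]])
qed

lemma ii_ii_scale: "\<i> *s (\<i> *s w) = - (w :: complex^'n)"
  by (simp add: vec_eq_iff)

lemma levi_minus: "levi z (- w) = levi z w"
proof -
  have "\<i> *s (- w) = - (\<i> *s w)" by (simp add: vec_eq_iff)
  thus ?thesis by (simp add: levi_def)
qed

lemma levi_ii: "levi z (\<i> *s w) = levi z w"
  by (simp add: levi_def ii_ii_scale)

text \<open>Nonnegativity at u + v and at u - v bounds the polarised term from both sides.\<close>

lemma levi_off_diagonal:
  assumes psh: "plurisubharmonic \<phi>"
  shows "2 * \<bar>second_deriv \<phi> z u v + second_deriv \<phi> z (\<i> *s u) (\<i> *s v)\<bar> \<le> levi z u + levi z v"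
proof -
  have pos: "0 \<le> levi z w" for w
    using plurisubharmonic_second_deriv_nonneg[OF \<phi> psh] by (simp add: levi_def)
  have "\<i> *s (- v) = - (\<i> *s v)" by (simp add: vec_eq_iff)
  thus ?thesis
    using pos[of "u + v"] pos[of "u + (- v)"] unfolding levi_add levi_minus by (simp add: abs_if)
qed

text \<open>Up to the factor 1/4, real and imaginary part are the polarised terms at (e_j, e_k) and
  (e_j, i e_k). Each is at most half the sum of two diagonal values, and a diagonal value is at most
  four times the trace, all of them being nonnegative.\<close>

lemma cmod_d_zbar_d_z_le:
  assumes psh: "plurisubharmonic \<phi>"
  shows "cmod (d_zbar k (d_z j (\<lambda>w. complex_of_real (\<phi> w))) z) \<le> 2 * Re (trace (complex_hessian \<phi> z))"
proof -
  have tr: "Re (trace (complex_hessian \<phi> z)) = (\<Sum>j\<in>UNIV. levi z (axis j 1)) / 4"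
    unfolding trace_def complex_hessian_def
    by (simp add: d_z_d_zbar levi_def axis_ii sum_divide_distrib)
  have le: "levi z (axis j 1) \<le> (\<Sum>j\<in>UNIV. levi z (axis j 1))" for j
    using plurisubharmonic_second_deriv_nonneg[OF \<phi> psh] by (intro member_le_sum) (auto simp: levi_def)
  let ?a = "second_deriv \<phi> z (axis j 1) (axis k 1) + second_deriv \<phi> z (axis j \<i>) (axis k \<i>)"
  let ?b = "second_deriv \<phi> z (axis j 1) (axis k \<i>) - second_deriv \<phi> z (axis j \<i>) (axis k 1)"
  have a: "2 * \<bar>?a\<bar> \<le> levi z (axis j 1) + levi z (axis k 1)"
    using levi_off_diagonal[OF psh, where z=z and u="axis j 1" and v="axis k 1"] by (simp add: axis_ii)
  have b: "2 * \<bar>?b\<bar> \<le> levi z (axis j 1) + levi z (axis k 1)"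
    using levi_off_diagonal[OF psh, where z=z and u="axis j 1" and v="\<i> *s axis k 1"]
    by (simp add: axis_ii ii_ii_scale levi_ii)
  have "cmod (d_zbar k (d_z j (\<lambda>w. complex_of_real (\<phi> w))) z) \<le> (\<bar>?a\<bar> + \<bar>?b\<bar>) / 4"
    unfolding d_zbar_d_z norm_divide norm_numeral
    by (intro divide_right_mono order_trans[OF norm_triangle_ineq]) (simp_all add: norm_mult del: of_real_add of_real_diff)
  also have "\<dots> \<le> 2 * Re (trace (complex_hessian \<phi> z))"
    using a b le[of j] le[of k] unfolding tr by simp
  finally show ?thesis .
qed

lemma continuous_trace_hessian: "continuous_on UNIV (\<lambda>z. Re (trace (complex_hessian \<phi> z)))"
  unfolding trace_def complex_hessian_def
  by (simp add: d_z_d_zbar) (auto intro!: continuous_intros second_deriv_continuous[OF \<phi>])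

text \<open>The limsup bounds the trace outside some ball, continuity bounds it inside, and the
  trace dominates every entry.\<close>

lemma hessian_bounded:
  assumes psh: "plurisubharmonic \<phi>"
    and ls: "Limsup at_infinity (\<lambda>z. ereal (Re (trace (complex_hessian \<phi> z)))) \<noteq> \<infinity>"
  obtains C where "C > 0" "\<And>j k z. cmod (d_zbar k (d_z j (\<lambda>w. complex_of_real (\<phi> w))) z) \<le> C"
proof -
  let ?tr = "\<lambda>z. Re (trace (complex_hessian \<phi> z))"
  obtain c :: nat where "Limsup at_infinity (\<lambda>z. ereal (?tr z)) < ereal c"
    using ls less_PInf_Ex_of_nat by auto
  hence "eventually (\<lambda>z. ereal (?tr z) < ereal c) at_infinity"
    by (rule Limsup_lessD)
  then obtain b where b: "\<And>z. norm z \<ge> b \<Longrightarrow> ?tr z < c"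
    by (auto simp: eventually_at_infinity)
  have "compact (?tr ` cball 0 b)"
    using continuous_trace_hessian by (intro compact_continuous_image) (auto intro: continuous_on_subset)
  then obtain M where M: "\<And>z. norm z \<le> b \<Longrightarrow> \<bar>?tr z\<bar> \<le> M"
    using compact_imp_bounded bounded_iff by (metis imageI mem_cball_0 real_norm_def)
  have "?tr z \<le> \<bar>c\<bar> + \<bar>M\<bar> + 1" for z
    using b[of z] M[of z] by (cases "norm z \<le> b") auto
  hence "cmod (d_zbar k (d_z j (\<lambda>w. complex_of_real (\<phi> w))) z) \<le> 2 * (\<bar>c\<bar> + \<bar>M\<bar> + 1)" for j k z
    using cmod_d_zbar_d_z_le[OF psh, of k j z] by (smt (verit))
  moreover have "2 * (\<bar>c\<bar> + \<bar>M\<bar> + 1) > 0" by simp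
  ultimately show ?thesis using that by blast
qed

end

section \<open>Wirtinger calculus\<close>

declare C_k.simps(2) [simp del]

lemma dir_deriv_cnj:
  "C_k (Suc k) f \<Longrightarrow> dir_deriv v (\<lambda>x. cnj (f x)) x = cnj (dir_deriv v f x)"
  by (rule dir_deriv_eq[OF has_derivative_cnj[OF C_k_Suc_has_derivative]])

lemma dir_deriv_diff:
  "C_k (Suc k) f \<Longrightarrow> C_k (Suc l) g \<Longrightarrow> dir_deriv v (\<lambda>x. f x - g x) x = dir_deriv v f x - dir_deriv v g x"
  by (rule dir_deriv_eq[OF has_derivative_diff[OF C_k_Suc_has_derivative C_k_Suc_has_derivative]])

lemma dir_deriv_sum:
  "(\<And>i. i \<in> I \<Longrightarrow> C_k (Suc k) (f i)) \<Longrightarrow> dir_deriv v (\<lambda>x. \<Sum>i\<in>I. f i x) x = (\<Sum>i\<in>I. dir_deriv v (f i) x)"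
  by (rule dir_deriv_eq[OF has_derivative_sum[OF C_k_Suc_has_derivative]])

lemma dir_deriv_const: "dir_deriv v (\<lambda>x. c) x = 0"
  by (rule dir_deriv_eq[OF has_derivative_const])

lemma d_zbar_mult:
  "C_k (Suc k) f \<Longrightarrow> C_k (Suc l) g \<Longrightarrow> d_zbar j (\<lambda>x. f x * g x) z = f z * d_zbar j g z + d_zbar j f z * g z"
  by (simp add: d_zbar_def dir_deriv_mult field_simps)

lemma d_z_mult:
  "C_k (Suc k) f \<Longrightarrow> C_k (Suc l) g \<Longrightarrow> d_z j (\<lambda>x. f x * g x) z = f z * d_z j g z + d_z j f z * g z"
  by (simp add: d_z_def dir_deriv_mult field_simps)

lemma d_zbar_cnj: "C_k (Suc k) f \<Longrightarrow> d_zbar j (\<lambda>x. cnj (f x)) z = cnj (d_z j f z)"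
  by (simp add: d_zbar_def d_z_def dir_deriv_cnj)

lemma d_z_cnj: "C_k (Suc k) f \<Longrightarrow> d_z j (\<lambda>x. cnj (f x)) z = cnj (d_zbar j f z)"
  by (simp add: d_zbar_def d_z_def dir_deriv_cnj)

lemma d_zbar_diff:
  "C_k (Suc k) f \<Longrightarrow> C_k (Suc l) g \<Longrightarrow> d_zbar j (\<lambda>x. f x - g x) z = d_zbar j f z - d_zbar j g z"
  by (simp add: d_zbar_def dir_deriv_diff field_simps)

lemma d_zbar_const: "d_zbar j (\<lambda>x. c) z = 0"
  by (simp add: d_zbar_def dir_deriv_const)

lemma d_zbar_cmult: "C_k (Suc k) f \<Longrightarrow> d_zbar j (\<lambda>x. c * f x) z = c * d_zbar j f z"
  by (simp add: d_zbar_mult[OF C_k_const] d_zbar_const)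

lemma d_zbar_sum:
  "(\<And>i. i \<in> I \<Longrightarrow> C_k (Suc k) (f i)) \<Longrightarrow> d_zbar j (\<lambda>x. \<Sum>i\<in>I. f i x) z = (\<Sum>i\<in>I. d_zbar j (f i) z)"
  by (simp add: d_zbar_def dir_deriv_sum[where k=k] sum.distrib sum_distrib_left flip: sum_divide_distrib)

lemma C_k_wirtinger:
  assumes "C_k (Suc k) f" shows "C_k k (d_zbar j f)" "C_k k (d_z j f)"
proof -
  have 1: "d_zbar j f = (\<lambda>z. (1/2) * dir_deriv (axis j 1) f z + (\<i>/2) * dir_deriv (axis j \<i>) f z)"
    and 2: "d_z j f = (\<lambda>z. (1/2) * dir_deriv (axis j 1) f z + (- \<i>/2) * dir_deriv (axis j \<i>) f z)"
    by (auto simp: d_zbar_def d_z_def field_simps)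
  show "C_k k (d_zbar j f)" "C_k k (d_z j f)"
    unfolding 1 2 by (intro C_k_add C_k_mult C_k_const C_k_Suc_dir_deriv[OF assms])+
qed

lemma wirtinger_compact_support:
  fixes f :: "complex^'n \<Rightarrow> complex"
  assumes "\<And>x. norm x > R \<Longrightarrow> f x = 0" "norm x > R"
  shows "d_zbar j f x = 0" "d_z j f x = 0"
  using dir_deriv_compact_support[of R f x] assms by (auto simp: d_zbar_def d_z_def)

lemma d_zbar_entire: "entire f \<Longrightarrow> d_zbar j f z = 0"
  by (simp add: d_zbar_def axis_ii entire_dir_deriv_scale)

lemma d_z_entire: "entire f \<Longrightarrow> d_z j f = dir_deriv (axis j 1) f"
  by (simp add: d_z_def axis_ii entire_dir_deriv_scale fun_eq_iff flip: mult.assoc)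

lemma
  fixes f g :: "complex^'n \<Rightarrow> complex"
  assumes f: "C_k (Suc 0) f" and g: "C_k (Suc 0) g" and R: "\<And>x. norm x > R \<Longrightarrow> g x = 0"
  shows integration_by_parts_d_zbar: "(LINT x|lborel. f x * d_zbar j g x) = - (LINT x|lborel. d_zbar j f x * g x)"
    and integration_by_parts_d_z: "(LINT x|lborel. f x * d_z j g x) = - (LINT x|lborel. d_z j f x * g x)"
proof -
  note c = C_k_continuous[OF C_k_Suc_dir_deriv[OF f]] C_k_continuous[OF C_k_Suc_dir_deriv[OF g]]
    C_k_continuous[OF f] C_k_continuous[OF g]
  have i: "integrable lborel (\<lambda>x. f x * dir_deriv v g x)" "integrable lborel (\<lambda>x. dir_deriv v f x * g x)" for v
    by (rule integrable_compact_support[where R=R]; use c R dir_deriv_compact_support[of R g] in \<open>auto intro: continuous_on_mult\<close>)+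
  have s: "(LINT x|lborel. f x * ((dir_deriv u g x + c * dir_deriv v g x) / 2))
      = ((LINT x|lborel. f x * dir_deriv u g x) + c * (LINT x|lborel. f x * dir_deriv v g x)) / 2"
    "(LINT x|lborel. (dir_deriv u f x + c * dir_deriv v f x) / 2 * g x)
      = ((LINT x|lborel. dir_deriv u f x * g x) + c * (LINT x|lborel. dir_deriv v f x * g x)) / 2" for c u v
  proof -
    have "(\<lambda>x. f x * ((dir_deriv u g x + c * dir_deriv v g x) / 2)) = (\<lambda>x. (f x * dir_deriv u g x + c * (f x * dir_deriv v g x)) / 2)"
      "(\<lambda>x. (dir_deriv u f x + c * dir_deriv v f x) / 2 * g x) = (\<lambda>x. (dir_deriv u f x * g x + c * (dir_deriv v f x * g x)) / 2)"
      by (auto simp: algebra_simps)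
    thus "(LINT x|lborel. f x * ((dir_deriv u g x + c * dir_deriv v g x) / 2))
      = ((LINT x|lborel. f x * dir_deriv u g x) + c * (LINT x|lborel. f x * dir_deriv v g x)) / 2"
      "(LINT x|lborel. (dir_deriv u f x + c * dir_deriv v f x) / 2 * g x)
      = ((LINT x|lborel. dir_deriv u f x * g x) + c * (LINT x|lborel. dir_deriv v f x * g x)) / 2"
      using i by simp_all
  qed
  have ibp: "(LINT x|lborel. f x * dir_deriv v g x) = - (LINT x|lborel. dir_deriv v f x * g x)" for v
    by (rule integration_by_parts[OF f g R])
  show "(LINT x|lborel. f x * d_zbar j g x) = - (LINT x|lborel. d_zbar j f x * g x)"
    unfolding d_zbar_def s ibp by (simp add: field_simps)
  have m: "a - \<i> * b = a + (- \<i>) * b" for a b by simp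
  show "(LINT x|lborel. f x * d_z j g x) = - (LINT x|lborel. d_z j f x * g x)"
    unfolding d_z_def m s ibp by (simp add: field_simps)
qed

section \<open>Cutoff functions\<close>

text \<open>Squaring the positive part removes its kink. C^1 is enough thanks to the mollification
  above, and the quadratic profile keeps the gradient bounds explicit.\<close>

definition cutoff :: "real \<Rightarrow> 'a::euclidean_space \<Rightarrow> real" where
  "cutoff R z = (max 0 (1 - (z \<bullet> z) / R\<^sup>2))\<^sup>2"

lemma max_square_derivative: "((\<lambda>t. (max 0 t)\<^sup>2) has_real_derivative 2 * max 0 t) (at (t::real))"
proof -
  consider "t < 0" | "t > 0" | "t = 0" by linarith
  thus ?thesis
  proof cases
    case 1
    have "eventually (\<lambda>s. (0::real) = (max 0 s)\<^sup>2) (nhds t)"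
      using eventually_nhds_in_open[of "{..<0}" t] 1 by (auto simp: max_def elim: eventually_mono)
    from DERIV_cong_ev[OF refl this refl, THEN iffD1, OF DERIV_const] show ?thesis
      using 1 by (simp add: max_def)
  next
    case 2
    have "((\<lambda>t::real. t\<^sup>2) has_real_derivative 2 * t) (at t)" by (auto intro!: derivative_eq_intros)
    moreover have "eventually (\<lambda>s. s\<^sup>2 = (max 0 s)\<^sup>2) (nhds t)"
      using eventually_nhds_in_open[of "{0<..}" t] 2 by (auto simp: max_def elim: eventually_mono)
    ultimately show ?thesis using DERIV_cong_ev[OF refl _ refl, THEN iffD1] 2 by (metis max.absorb2 less_imp_le)
  next
    case 3
    have "((\<lambda>h::real. (max 0 h)\<^sup>2 / h) \<longlongrightarrow> 0) (at 0)"
    proof (rule Lim_null_comparison)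
      show "\<forall>\<^sub>F h in at 0. norm ((max 0 h)\<^sup>2 / h) \<le> \<bar>h\<bar>"
        by (intro always_eventually allI) (auto simp: max_def power2_eq_square)
      show "((\<lambda>h. \<bar>h\<bar>) \<longlongrightarrow> 0) (at (0::real))" by (auto intro!: tendsto_eq_intros)
    qed
    thus ?thesis using 3 by (simp add: DERIV_def)
  qed
qed

lemma cutoff_has_derivative:
  "(cutoff R has_derivative (\<lambda>v. 2 * max 0 (1 - (z \<bullet> z) / R\<^sup>2) * (- (2 * (z \<bullet> v) / R\<^sup>2)))) (at z)"
proof -
  have "((\<lambda>z. 1 - (z \<bullet> z) / R\<^sup>2) has_derivative (\<lambda>v. - (2 * (z \<bullet> v) / R\<^sup>2))) (at z)"
    by (auto intro!: derivative_eq_intros simp: divide_inverse inner_commute algebra_simps)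
  from has_derivative_compose[OF this max_square_derivative[unfolded has_field_derivative_def]]
  show ?thesis unfolding cutoff_def by simp
qed

lemma C_1_cutoff: "C_k (Suc 0) (cutoff R)"
  by (rule C_k_SucI[OF cutoff_has_derivative]) (auto simp: divide_inverse intro!: continuous_intros)

lemma cutoff_nonneg: "0 \<le> cutoff R z" by (simp add: cutoff_def)

lemma cutoff_le_1: "cutoff R z \<le> 1"
  unfolding cutoff_def by (intro power_le_one) (auto simp: max_def)

lemma cutoff_eq_0: "R > 0 \<Longrightarrow> norm z > R \<Longrightarrow> cutoff R z = 0"
proof -
  assume "R > 0" "norm z > R"
  hence "R\<^sup>2 < (norm z)\<^sup>2" by (intro power_strict_mono) auto
  hence "1 - (z \<bullet> z) / R\<^sup>2 \<le> 0" using \<open>R > 0\<close> by (simp add: dot_square_norm pos_le_divide_eq less_imp_le del: power2_le_iff_abs_le)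
  thus ?thesis by (simp add: cutoff_def max_absorb1)
qed

text \<open>On the support |z| \<le> R, and the derivative is at most 4 |v| |z| / R^2. The bound by
  1/R makes gradient terms disappear in the limit; the one with the factor |z| is uniform in R and
  compensates linear growth.\<close>

lemma cutoff_dir_deriv_le:
  assumes R: "R > 0" shows "norm z * \<bar>dir_deriv v (cutoff R) z\<bar> \<le> 4 * norm v" "\<bar>dir_deriv v (cutoff R) z\<bar> \<le> 4 * norm v / R"
proof -
  have "norm z * \<bar>dir_deriv v (cutoff R) z\<bar> \<le> 4 * norm v \<and> \<bar>dir_deriv v (cutoff R) z\<bar> \<le> 4 * norm v / R"
  proof (cases "norm z > R")
    case True
    hence "dir_deriv v (cutoff R) z = 0"
      using cutoff_eq_0[OF R] by (intro dir_deriv_compact_support[where R=R]) auto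
    thus ?thesis using R by simp
  next
    case False
    let ?m = "max 0 (1 - (z \<bullet> z) / R\<^sup>2)"
    have m: "0 \<le> ?m" "?m \<le> 1" by (auto simp: max_def)
    have "\<bar>dir_deriv v (cutoff R) z\<bar> = 2 * ?m * (2 * \<bar>z \<bullet> v\<bar> / R\<^sup>2)"
      using m by (simp add: dir_deriv_eq[OF cutoff_has_derivative] abs_mult)
    also have "\<dots> \<le> 2 * 1 * (2 * (norm z * norm v) / R\<^sup>2)"
      using m Cauchy_Schwarz_ineq2[of z v] by (intro mult_mono divide_right_mono) auto
    finally have *: "\<bar>dir_deriv v (cutoff R) z\<bar> \<le> 4 * norm v * norm z / R\<^sup>2" by (simp add: mult_ac)
    also have "\<dots> \<le> 4 * norm v * R / R\<^sup>2" using False by (intro divide_right_mono mult_left_mono) auto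
    also have "\<dots> = 4 * norm v / R" using R by (simp add: power2_eq_square)
    finally have a: "\<bar>dir_deriv v (cutoff R) z\<bar> \<le> 4 * norm v / R" .
    have "norm z * \<bar>dir_deriv v (cutoff R) z\<bar> \<le> R * (4 * norm v / R)"
      using a False R by (intro mult_mono) auto
    thus ?thesis using a R by simp
  qed
  thus "norm z * \<bar>dir_deriv v (cutoff R) z\<bar> \<le> 4 * norm v" "\<bar>dir_deriv v (cutoff R) z\<bar> \<le> 4 * norm v / R" by auto
qed

lemma cutoff_tendsto: "(\<lambda>n. cutoff (real (Suc n)) z) \<longlonglongrightarrow> 1"
proof -
  have "(\<lambda>n. 1 / real (Suc n)) \<longlonglongrightarrow> 0" using LIMSEQ_inverse_real_of_nat by (simp add: inverse_eq_divide)
  hence "(\<lambda>n. (max 0 (1 - (z \<bullet> z) * (1 / real (Suc n))\<^sup>2))\<^sup>2) \<longlonglongrightarrow> (max 0 (1 - (z \<bullet> z) * 0\<^sup>2))\<^sup>2"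
    by (intro tendsto_intros)
  thus ?thesis by (simp add: cutoff_def power_divide)
qed

definition complex_cutoff :: "real \<Rightarrow> complex^'n \<Rightarrow> complex" where
  "complex_cutoff R z = complex_of_real (cutoff R z)"

lemma C_1_complex_cutoff: "C_k (Suc 0) (complex_cutoff R)"
  using C_k_of_real[OF C_1_cutoff] by (simp add: complex_cutoff_def[abs_def])

lemma complex_cutoff_eq_0: "R > 0 \<Longrightarrow> norm z > R \<Longrightarrow> complex_cutoff R z = 0"
  by (simp add: complex_cutoff_def cutoff_eq_0)

lemma cmod_complex_cutoff_le: "cmod (complex_cutoff R z) \<le> 1"
  using cutoff_nonneg[of R z] cutoff_le_1[of R z] by (simp add: complex_cutoff_def)

lemma complex_cutoff_tendsto: "(\<lambda>n. complex_cutoff (real (Suc n)) z) \<longlonglongrightarrow> 1"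
  using tendsto_of_real[OF cutoff_tendsto[of z]] by (simp add: complex_cutoff_def)

lemma complex_cutoff_wirtinger_le:
  assumes R: "R > 0"
  shows "cmod (d_zbar j (complex_cutoff R) z) \<le> 4 / R" "cmod (d_z j (complex_cutoff R) z) \<le> 4 / R" "norm z * cmod (d_zbar j (complex_cutoff R) z) \<le> 4"
proof -
  let ?a = "dir_deriv (axis j 1) (cutoff R) z" and ?b = "dir_deriv (axis j \<i>) (cutoff R) z"
  have b: "\<bar>?a\<bar> \<le> 4 / R" "\<bar>?b\<bar> \<le> 4 / R" "norm z * \<bar>?a\<bar> \<le> 4" "norm z * \<bar>?b\<bar> \<le> 4"
    using cutoff_dir_deriv_le[OF R, of z "axis j 1"] cutoff_dir_deriv_le[OF R, of z "axis j \<i>"] by simp_all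
  have e: "dir_deriv v (complex_cutoff R) z = complex_of_real (dir_deriv v (cutoff R) z)" for v
    using fun_cong[OF dir_deriv_of_real[OF C_1_cutoff]] by (simp add: complex_cutoff_def[abs_def])
  have n: "cmod (d_zbar j (complex_cutoff R) z) \<le> (\<bar>?a\<bar> + \<bar>?b\<bar>) / 2" "cmod (d_z j (complex_cutoff R) z) \<le> (\<bar>?a\<bar> + \<bar>?b\<bar>) / 2"
    unfolding d_zbar_def d_z_def e norm_divide norm_numeral
    by (intro divide_right_mono order_trans[OF norm_triangle_ineq] order_trans[OF norm_triangle_ineq4]; simp add: norm_mult)+
  show "cmod (d_zbar j (complex_cutoff R) z) \<le> 4 / R" "cmod (d_z j (complex_cutoff R) z) \<le> 4 / R" 
    using n(1) n(2) b(1,2) by (auto simp: field_simps)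
  have "norm z * cmod (d_zbar j (complex_cutoff R) z) \<le> norm z * ((\<bar>?a\<bar> + \<bar>?b\<bar>) / 2)" by (rule mult_left_mono[OF n(1)]) simp
  also have "\<dots> = (norm z * \<bar>?a\<bar> + norm z * \<bar>?b\<bar>) / 2" by (simp add: algebra_simps)
  finally show "norm z * cmod (d_zbar j (complex_cutoff R) z) \<le> 4" using b(3,4) by argo
qed

lemma d_zbar_complex_cutoff_tendsto: "(\<lambda>n. d_zbar j (complex_cutoff (real (Suc n))) z) \<longlonglongrightarrow> 0"
proof (rule Lim_null_comparison)
  show "\<forall>\<^sub>F n in sequentially. norm (d_zbar j (complex_cutoff (real (Suc n))) z) \<le> 4 * (1 / real (Suc n))"
    using complex_cutoff_wirtinger_le(1)[of "real (Suc _)" j z] by (intro always_eventually allI) (simp del: of_nat_Suc)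
  have "(\<lambda>n. 1 / real (Suc n)) \<longlonglongrightarrow> 0" using LIMSEQ_inverse_real_of_nat by (simp add: inverse_eq_divide)
  from tendsto_mult_right_zero[OF this] show "(\<lambda>n. 4 * (1 / real (Suc n))) \<longlonglongrightarrow> 0" .
qed

section \<open>Weighted square integrability\<close>

lemma norm_add_square_le: "(norm (a + b))\<^sup>2 \<le> 2 * (norm a)\<^sup>2 + 2 * (norm b)\<^sup>2"
proof -
  have "(norm (a + b))\<^sup>2 \<le> (norm a + norm b)\<^sup>2" by (intro power_mono norm_triangle_ineq) auto
  also have "\<dots> \<le> 2 * (norm a)\<^sup>2 + 2 * (norm b)\<^sup>2"
    using zero_le_power2[of "norm a - norm b"] by (simp add: power2_eq_square algebra_simps)
  finally show ?thesis .
qed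

lemma mult_le_add_square: "a * b \<le> a\<^sup>2 + (b::real)\<^sup>2"
proof -
  have "2 * (a * b) \<le> a\<^sup>2 + b\<^sup>2" "0 \<le> a\<^sup>2 + b\<^sup>2"
    using zero_le_power2[of "a - b"] by (simp_all add: power2_eq_square algebra_simps)
  thus ?thesis by linarith
qed

lemma borel_measurable_cnj [measurable]: "cnj \<in> borel_measurable borel"
  by (intro borel_measurable_continuous_onI continuous_intros)

definition sq_int :: "(complex^'n \<Rightarrow> real) \<Rightarrow> (complex^'n \<Rightarrow> complex) \<Rightarrow> bool" where
  "sq_int \<phi> f \<longleftrightarrow> f \<in> borel_measurable lborel \<and> integrable lborel (\<lambda>z. (cmod (f z))\<^sup>2 * exp (- \<phi> z))"

lemma L2_iff: "u \<in> L2 \<phi> q \<longleftrightarrow> (\<forall>J. card J = q \<longrightarrow> sq_int \<phi> (u J)) \<and> (\<forall>J. card J \<noteq> q \<longrightarrow> u J = 0)"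
  by (auto simp: L2_def sq_int_def)

lemma sq_int_measurable [measurable_dest]: "sq_int \<phi> f \<Longrightarrow> f \<in> borel_measurable borel"
  by (simp add: sq_int_def)

context
  fixes \<phi> :: "complex^'n \<Rightarrow> real"
  assumes \<phi>_meas [measurable]: "\<phi> \<in> borel_measurable borel"
begin

lemma sq_int_bound:
  assumes [measurable]: "g \<in> borel_measurable borel" and f: "sq_int \<phi> f" and le: "\<And>z. cmod (g z) \<le> C * cmod (f z)"
  shows "sq_int \<phi> g"
    "(LINT z|lborel. (cmod (g z))\<^sup>2 * exp (- \<phi> z)) \<le> C\<^sup>2 * (LINT z|lborel. (cmod (f z))\<^sup>2 * exp (- \<phi> z))"
proof -
  have b: "(cmod (g z))\<^sup>2 * exp (- \<phi> z) \<le> C\<^sup>2 * ((cmod (f z))\<^sup>2 * exp (- \<phi> z))" for z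
  proof -
    have "(cmod (g z))\<^sup>2 \<le> (C * cmod (f z))\<^sup>2" using le by (intro power_mono) auto
    hence "(cmod (g z))\<^sup>2 * exp (- \<phi> z) \<le> (C * cmod (f z))\<^sup>2 * exp (- \<phi> z)" by (rule mult_right_mono) simp
    thus ?thesis by (simp add: power_mult_distrib)
  qed
  have i: "integrable lborel (\<lambda>z. C\<^sup>2 * ((cmod (f z))\<^sup>2 * exp (- \<phi> z)))"
    using f by (simp add: sq_int_def)
  have j: "integrable lborel (\<lambda>z. (cmod (g z))\<^sup>2 * exp (- \<phi> z))"
    by (rule Bochner_Integration.integrable_bound[OF i]) (use b in auto)
  show "sq_int \<phi> g" using j by (simp add: sq_int_def)
  show "(LINT z|lborel. (cmod (g z))\<^sup>2 * exp (- \<phi> z)) \<le> C\<^sup>2 * (LINT z|lborel. (cmod (f z))\<^sup>2 * exp (- \<phi> z))"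
    using integral_mono[OF j i] b by simp
qed

lemma sq_int_cmult: "sq_int \<phi> f \<Longrightarrow> sq_int \<phi> (\<lambda>z. c * f z)"
  by (rule sq_int_bound(1)[where C="cmod c"]) (auto simp: norm_mult)

lemma sq_int_add:
  assumes "sq_int \<phi> f" "sq_int \<phi> g"
  shows "sq_int \<phi> (\<lambda>z. f z + g z)"
    "(LINT z|lborel. (cmod (f z + g z))\<^sup>2 * exp (- \<phi> z)) \<le>
       2 * (LINT z|lborel. (cmod (f z))\<^sup>2 * exp (- \<phi> z)) + 2 * (LINT z|lborel. (cmod (g z))\<^sup>2 * exp (- \<phi> z))"
proof -
  note [measurable] = assms[THEN sq_int_measurable]
  have b: "(cmod (f z + g z))\<^sup>2 * exp (- \<phi> z) \<le> 2 * ((cmod (f z))\<^sup>2 * exp (- \<phi> z)) + 2 * ((cmod (g z))\<^sup>2 * exp (- \<phi> z))" for z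
    using mult_right_mono[OF norm_add_square_le[of "f z" "g z"], of "exp (- \<phi> z)"] by (simp add: algebra_simps)
  have i: "integrable lborel (\<lambda>z. 2 * ((cmod (f z))\<^sup>2 * exp (- \<phi> z)) + 2 * ((cmod (g z))\<^sup>2 * exp (- \<phi> z)))"
    using assms by (simp add: sq_int_def)
  have j: "integrable lborel (\<lambda>z. (cmod (f z + g z))\<^sup>2 * exp (- \<phi> z))"
    by (rule Bochner_Integration.integrable_bound[OF i]) (use b in auto)
  show "sq_int \<phi> (\<lambda>z. f z + g z)" using j by (simp add: sq_int_def)
  show "(LINT z|lborel. (cmod (f z + g z))\<^sup>2 * exp (- \<phi> z)) \<le>
       2 * (LINT z|lborel. (cmod (f z))\<^sup>2 * exp (- \<phi> z)) + 2 * (LINT z|lborel. (cmod (g z))\<^sup>2 * exp (- \<phi> z))"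
    using integral_mono[OF j i] b assms by (simp add: sq_int_def)
qed

lemma sq_int_zero: "sq_int \<phi> (\<lambda>z. 0)"
  by (simp add: sq_int_def)

lemma sq_int_sum: "(\<And>i. i \<in> I \<Longrightarrow> sq_int \<phi> (f i)) \<Longrightarrow> sq_int \<phi> (\<lambda>z. \<Sum>i\<in>I. f i z)"
  by (induction I rule: infinite_finite_induct) (auto intro: sq_int_zero sq_int_add)

lemma sq_int_diff: "sq_int \<phi> f \<Longrightarrow> sq_int \<phi> g \<Longrightarrow> sq_int \<phi> (\<lambda>z. f z - g z)"
  using sq_int_add(1)[of f "\<lambda>z. (-1) * g z"] sq_int_cmult[of g "-1"] by simp

lemma sq_int_inner_bound:
  "cmod (f z * cnj (g z) * of_real (exp (- \<phi> z))) \<le> (cmod (f z))\<^sup>2 * exp (- \<phi> z) + (cmod (g z))\<^sup>2 * exp (- \<phi> z)"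
  using mult_right_mono[OF mult_le_add_square[of "cmod (f z)" "cmod (g z)"], of "exp (- \<phi> z)"]
  by (simp add: norm_mult algebra_simps)

lemma sq_int_inner_integrable:
  assumes "sq_int \<phi> f" "sq_int \<phi> g"
  shows "integrable lborel (\<lambda>z. f z * cnj (g z) * complex_of_real (exp (- \<phi> z)))"
proof (rule Bochner_Integration.integrable_bound)
  note [measurable] = assms[THEN sq_int_measurable]
  show "integrable lborel (\<lambda>z. (cmod (f z))\<^sup>2 * exp (- \<phi> z) + (cmod (g z))\<^sup>2 * exp (- \<phi> z))"
    using assms by (simp add: sq_int_def)
  show "(\<lambda>z. f z * cnj (g z) * complex_of_real (exp (- \<phi> z))) \<in> borel_measurable lborel" by measurable
qed (use sq_int_inner_bound[of f _ g] in \<open>auto intro!: AE_I2 order_trans[OF _ abs_ge_self]\<close>)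

text \<open>Dominated convergence with a majorant from a b \<le> a^2 + b^2; the sequence has to be
  controlled by one fixed square integrable function.\<close>

lemma sq_int_inner_tendsto:
  assumes "sq_int \<phi> f" "sq_int \<phi> g" and [measurable]: "\<And>n. h n \<in> borel_measurable borel"
    and lim: "\<And>z. (\<lambda>n. h n z) \<longlonglongrightarrow> l z" and le: "\<And>n z. cmod (h n z) \<le> C * cmod (f z)"
  shows "(\<lambda>n. LINT z|lborel. h n z * cnj (g z) * complex_of_real (exp (- \<phi> z))) \<longlonglongrightarrow>
     (LINT z|lborel. l z * cnj (g z) * complex_of_real (exp (- \<phi> z)))"
proof (rule integral_dominated_convergence)
  note [measurable] = assms(1,2)[THEN sq_int_measurable]
  have [measurable]: "l \<in> borel_measurable borel"
    by (rule borel_measurable_LIMSEQ_metric[where f=h]) (use lim in auto)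
  let ?w = "\<lambda>z. (cmod (complex_of_real C * f z))\<^sup>2 * exp (- \<phi> z) + (cmod (g z))\<^sup>2 * exp (- \<phi> z)"
  show "integrable lborel ?w"
    using sq_int_cmult[OF assms(1), of "complex_of_real C"] assms(2) by (simp add: sq_int_def)
  show "AE z in lborel. (\<lambda>n. h n z * cnj (g z) * complex_of_real (exp (- \<phi> z))) \<longlonglongrightarrow> l z * cnj (g z) * complex_of_real (exp (- \<phi> z))"
    by (intro AE_I2 tendsto_intros lim)
  show "AE z in lborel. norm (h n z * cnj (g z) * complex_of_real (exp (- \<phi> z))) \<le> ?w z" for n
  proof (rule AE_I2)
    fix z
    have "cmod (h n z) \<le> cmod (complex_of_real C * f z)"
      using le[of n z] by (simp add: norm_mult) (metis abs_ge_self mult_right_mono norm_ge_zero order_trans)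
    hence "cmod (h n z * cnj (g z) * complex_of_real (exp (- \<phi> z))) \<le> cmod ((complex_of_real C * f z) * cnj (g z) * complex_of_real (exp (- \<phi> z)))"
      by (simp only: norm_mult) (intro mult_right_mono; simp)
    also have "\<dots> \<le> ?w z" by (rule sq_int_inner_bound)
    finally show "norm (h n z * cnj (g z) * complex_of_real (exp (- \<phi> z))) \<le> ?w z" .
  qed
  show "(\<lambda>z. l z * cnj (g z) * complex_of_real (exp (- \<phi> z))) \<in> borel_measurable lborel" by measurable
  show "(\<lambda>z. h n z * cnj (g z) * complex_of_real (exp (- \<phi> z))) \<in> borel_measurable lborel" for n by measurable
qed

end

text \<open>Write |f| as |f| e^{-\<phi>/2} times e^{\<phi>/2} and apply a b \<le> a^2 + b^2;
  e^\<phi> is bounded on balls. This matters because weak derivatives are tested without the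
  weight.\<close>

lemma sq_int_locally_integrable:
  fixes \<phi> :: "complex^'n \<Rightarrow> real"
  assumes \<phi>: "continuous_on UNIV \<phi>" and f: "sq_int \<phi> f"
  shows "integrable lborel (\<lambda>z. indicator (cball 0 R) z * cmod (f z))"
proof (rule Bochner_Integration.integrable_bound)
  note [measurable] = borel_measurable_continuous_onI[OF \<phi>] sq_int_measurable[OF f]
  have [measurable]: "cball (0::complex^'n) R \<in> sets borel" by simp
  have "integrable lborel (\<lambda>z. indicator (cball 0 R) z *\<^sub>R exp (\<phi> z))"
    using \<phi> by (intro borel_integrable_compact continuous_on_exp) (auto intro: continuous_on_subset)
  thus "integrable lborel (\<lambda>z. (cmod (f z))\<^sup>2 * exp (- \<phi> z) + indicator (cball 0 R) z *\<^sub>R exp (\<phi> z))"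
    using f by (simp add: sq_int_def)
  show "AE z in lborel. norm (indicator (cball 0 R) z * cmod (f z)) \<le> norm ((cmod (f z))\<^sup>2 * exp (- \<phi> z) + indicator (cball 0 R) z *\<^sub>R exp (\<phi> z))"
  proof (rule AE_I2)
    fix z
    define e where "e = exp (\<phi> z / 2)"
    have e: "e > 0" "exp (\<phi> z) = e\<^sup>2" "exp (- \<phi> z) = (1/e)\<^sup>2"
      by (auto simp: e_def power2_eq_square exp_minus inverse_eq_divide simp flip: exp_add)
    have "cmod (f z) \<le> (cmod (f z))\<^sup>2 * exp (- \<phi> z) + exp (\<phi> z)"
      using mult_le_add_square[of "cmod (f z) * (1/e)" e] e(1) unfolding e(2,3) power_mult_distrib by simp
    thus "norm (indicator (cball 0 R) z * cmod (f z)) \<le> norm ((cmod (f z))\<^sup>2 * exp (- \<phi> z) + indicator (cball 0 R) z *\<^sub>R exp (\<phi> z))"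
      by (auto simp: indicator_def)
  qed
  show "(\<lambda>z. indicator (cball 0 R) z * cmod (f z)) \<in> borel_measurable lborel" by measurable
qed

lemma sq_int_test_tendsto:
  fixes \<phi> :: "complex^'n \<Rightarrow> real"
  assumes \<phi>: "continuous_on UNIV \<phi>" and f: "sq_int \<phi> f"
    and [measurable]: "\<And>n. h n \<in> borel_measurable borel"
    and lim: "\<And>z. (\<lambda>n. h n z) \<longlonglongrightarrow> l z"
    and le: "\<And>n z. cmod (h n z) \<le> M" and supp: "\<And>n z. norm z > R \<Longrightarrow> h n z = 0"
  shows "(\<lambda>n. LINT z|lborel. f z * h n z) \<longlonglongrightarrow> (LINT z|lborel. f z * l z)"
proof (rule integral_dominated_convergence)
  note [measurable] = sq_int_measurable[OF f]
  have [measurable]: "l \<in> borel_measurable borel"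
    by (rule borel_measurable_LIMSEQ_metric[where f=h]) (use lim in auto)
  show "integrable lborel (\<lambda>z. M * (indicator (cball 0 R) z * cmod (f z)))"
    by (intro integrable_mult_right sq_int_locally_integrable[OF \<phi> f])
  show "AE z in lborel. (\<lambda>n. f z * h n z) \<longlonglongrightarrow> f z * l z" by (intro AE_I2 tendsto_intros lim)
  show "AE z in lborel. norm (f z * h n z) \<le> M * (indicator (cball 0 R) z * cmod (f z))" for n
  proof (rule AE_I2)
    fix z
    show "norm (f z * h n z) \<le> M * (indicator (cball 0 R) z * cmod (f z))"
      using mult_left_mono[OF le[of n z], of "cmod (f z)"] supp[where n=n and z=z]
      by (cases "norm z > R") (auto simp: norm_mult mult_ac)
  qed
  show "(\<lambda>z. f z * l z) \<in> borel_measurable lborel" by measurable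
  show "(\<lambda>z. f z * h n z) \<in> borel_measurable lborel" for n by measurable
qed

section \<open>The Cauchy-Riemann operator on regular forms\<close>

lemma dbarD:
  "(u, w) \<in> dbar \<phi> q \<Longrightarrow> u \<in> L2 \<phi> q" "(u, w) \<in> dbar \<phi> q \<Longrightarrow> w \<in> L2 \<phi> (Suc q)" "(u, w) \<in> dbar \<phi> q \<Longrightarrow> weak_dbar q u w"
  by (auto simp: dbar_def)

text \<open>Both sides pass to the limit along smooth approximations: these share a compact support,
  on which the coefficients are integrable.\<close>

lemma dbar_weak_C1:
  fixes \<phi> :: "complex^'n::{finite,linorder} \<Rightarrow> real"
  assumes \<phi>: "continuous_on UNIV \<phi>" and uw: "(u, w) \<in> dbar \<phi> q"
    and \<psi>: "C_k (Suc 0) \<psi>" and supp: "\<And>x. norm x > R \<Longrightarrow> \<psi> x = 0" and K: "card K = Suc q"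
  shows "(LINT z|lborel. w K z * \<psi> z) =
        (\<Sum>J | card J = q. \<Sum>j\<in>UNIV. wedge_coeff j J K * - (LINT z|lborel. u J z * d_zbar j \<psi> z))"
proof -
  obtain \<Psi> where \<Psi>: "\<And>n. test_function (\<Psi> n)" "\<And>n x. norm x > R + 1 \<Longrightarrow> \<Psi> n x = 0"
    "\<And>x. (\<lambda>n. \<Psi> n x) \<longlonglongrightarrow> \<psi> x" "\<And>v x. (\<lambda>n. dir_deriv v (\<Psi> n) x) \<longlonglongrightarrow> dir_deriv v \<psi> x"
    "\<exists>M. \<forall>n x. norm (\<Psi> n x) \<le> M" "\<And>v. \<exists>M. \<forall>n x. norm (dir_deriv v (\<Psi> n) x) \<le> M"
    using test_function_approximation[OF \<psi> supp] by blast
  have C: "C_k k (\<Psi> n)" for n k using \<Psi>(1) by (simp add: test_function_def)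
  have "(\<lambda>n. LINT z|lborel. w K z * \<Psi> n z) \<longlonglongrightarrow> (LINT z|lborel. w K z * \<psi> z)"
  proof -
    obtain M where "\<And>n z. cmod (\<Psi> n z) \<le> M" using \<Psi>(5) by blast
    moreover have "sq_int \<phi> (w K)" using dbarD(2)[OF uw] K by (simp add: L2_iff)
    ultimately show ?thesis using \<Psi>(2,3) C_k_borel_measurable[OF C[of 0]] by (intro sq_int_test_tendsto[OF \<phi>, where R="R+1"])
  qed
  moreover have "(\<lambda>n. \<Sum>J | card J = q. \<Sum>j\<in>UNIV. wedge_coeff j J K * - (LINT z|lborel. u J z * d_zbar j (\<Psi> n) z))
     \<longlonglongrightarrow> (\<Sum>J | card J = q. \<Sum>j\<in>UNIV. wedge_coeff j J K * - (LINT z|lborel. u J z * d_zbar j \<psi> z))"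
  proof (intro tendsto_sum tendsto_mult tendsto_const tendsto_minus)
    fix J j assume "J \<in> {J :: 'n set. card J = q}"
    hence u: "sq_int \<phi> (u J)" using dbarD(1)[OF uw] by (simp add: L2_iff)
    obtain M1 M2 where M: "\<And>n x. norm (dir_deriv (axis j 1) (\<Psi> n) x) \<le> M1" "\<And>n x. norm (dir_deriv (axis j \<i>) (\<Psi> n) x) \<le> M2"
      using \<Psi>(6) by metis
    have "cmod (d_zbar j (\<Psi> n) z) \<le> (M1 + M2) / 2" for n z
      unfolding d_zbar_def norm_divide norm_numeral
      using M by (intro divide_right_mono order_trans[OF norm_triangle_ineq] add_mono) (auto simp: norm_mult)
    moreover have "(\<lambda>n. d_zbar j (\<Psi> n) z) \<longlonglongrightarrow> d_zbar j \<psi> z" for z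
      unfolding d_zbar_def by (intro tendsto_intros \<Psi>(4)) simp
    ultimately show "(\<lambda>n. LINT z|lborel. u J z * d_zbar j (\<Psi> n) z) \<longlonglongrightarrow> (LINT z|lborel. u J z * d_zbar j \<psi> z)"
      using wirtinger_compact_support(1)[OF \<Psi>(2)] C_k_borel_measurable[OF C_k_wirtinger(1)[OF C]]
      by (intro sq_int_test_tendsto[OF \<phi> u, where R="R+1"])
  qed
  moreover have "(LINT z|lborel. w K z * \<Psi> n z) = (\<Sum>J | card J = q. \<Sum>j\<in>UNIV. wedge_coeff j J K * - (LINT z|lborel. u J z * d_zbar j (\<Psi> n) z))" for n
    using dbarD(3)[OF uw] K \<Psi>(1) by (simp add: weak_dbar_def)
  ultimately show ?thesis using LIMSEQ_unique by simp
qed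

text \<open>Integration by parts in each coefficient turns the classical formula into the weak one.
  The explicit pairs of \<open>dbar\<close> constructed below all arise in this way.\<close>

lemma dbar_C1:
  fixes \<phi> :: "complex^'n::{finite,linorder} \<Rightarrow> real"
  assumes g: "g \<in> L2 \<phi> p" and w: "w \<in> L2 \<phi> (Suc p)"
    and C: "\<And>J. card J = p \<Longrightarrow> C_k (Suc 0) (g J)"
    and eq: "\<And>K z. card K = Suc p \<Longrightarrow> w K z = (\<Sum>J | card J = p. \<Sum>j\<in>UNIV. wedge_coeff j J K * d_zbar j (g J) z)"
  shows "(g, w) \<in> dbar \<phi> p"
proof -
  have "weak_dbar p g w"
    unfolding weak_dbar_def
  proof (intro allI impI)
    fix K :: "'n set" and \<psi> :: "(complex, 'n) vec \<Rightarrow> complex"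
    assume K: "card K = Suc p" and \<psi>: "test_function \<psi>"
    have C\<psi>: "C_k k \<psi>" for k using \<psi> by (simp add: test_function_def)
    have "bounded (closure {x. \<psi> x \<noteq> 0})" using \<psi> by (simp add: test_function_def compact_imp_bounded)
    then obtain R where "\<And>z. z \<in> closure {x. \<psi> x \<noteq> 0} \<Longrightarrow> norm z \<le> R"
      by (auto simp: bounded_iff)
    hence R: "\<psi> z = 0" if "norm z > R" for z
      using that closure_subset[of "{x. \<psi> x \<noteq> 0}"] by (metis (mono_tags) mem_Collect_eq not_le subsetD)
    have i: "integrable lborel (\<lambda>z. d_zbar j (g J) z * \<psi> z)" if "card J = p" for j J
      using R C_k_continuous[OF C_k_wirtinger(1)[OF C[OF that]]] C_k_continuous[OF C\<psi>]
      by (intro integrable_compact_support[where R=R] continuous_on_mult) auto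
    have "(LINT z|lborel. w K z * \<psi> z) = (LINT z|lborel. (\<Sum>J | card J = p. \<Sum>j\<in>UNIV. wedge_coeff j J K * (d_zbar j (g J) z * \<psi> z)))"
      by (simp add: eq[OF K] sum_distrib_right mult.assoc)
    also have "\<dots> = (\<Sum>J | card J = p. \<Sum>j\<in>UNIV. wedge_coeff j J K * (LINT z|lborel. d_zbar j (g J) z * \<psi> z))"
      using i by (simp add: Bochner_Integration.integral_sum)
    also have "\<dots> = (\<Sum>J | card J = p. \<Sum>j\<in>UNIV. wedge_coeff j J K * - (LINT z|lborel. g J z * d_zbar j \<psi> z))"
    proof (intro sum.cong refl)
      fix J j assume "J \<in> {J :: 'n set. card J = p}"
      hence "(LINT z|lborel. g J z * d_zbar j \<psi> z) = - (LINT z|lborel. d_zbar j (g J) z * \<psi> z)"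
        using R by (intro integration_by_parts_d_zbar C C\<psi>) auto
      thus "wedge_coeff j J K * (LINT z|lborel. d_zbar j (g J) z * \<psi> z) = wedge_coeff j J K * - (LINT z|lborel. g J z * d_zbar j \<psi> z)"
        by simp
    qed
    finally show "(LINT z|lborel. w K z * \<psi> z) = (\<Sum>J | card J = p. \<Sum>j\<in>UNIV. wedge_coeff j J K * - (LINT z|lborel. g J z * d_zbar j \<psi> z))" .
  qed
  thus ?thesis using g w by (simp add: dbar_def)
qed

section \<open>The weighted adjoint of the Wirtinger derivative on entire functions\<close>

definition delta :: "(complex^'n \<Rightarrow> real) \<Rightarrow> 'n \<Rightarrow> (complex^'n \<Rightarrow> complex) \<Rightarrow> complex^'n \<Rightarrow> complex" where
  "delta \<phi> j f z = d_z j (\<lambda>w. complex_of_real (\<phi> w)) z * f z - d_z j f z"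

abbreviation weight :: "(complex^'n \<Rightarrow> real) \<Rightarrow> complex^'n \<Rightarrow> complex" where
  "weight \<phi> z \<equiv> complex_of_real (exp (- \<phi> z))"

abbreviation hess :: "(complex^'n \<Rightarrow> real) \<Rightarrow> 'n \<Rightarrow> 'n \<Rightarrow> complex^'n \<Rightarrow> complex" where
  "hess \<phi> j k \<equiv> d_zbar k (d_z j (\<lambda>w. complex_of_real (\<phi> w)))"

lemma C_1_d_z_entire: "entire f \<Longrightarrow> C_k (Suc 0) (d_z j f)"
  by (simp add: d_z_entire C_1_entire entire_dir_deriv)

context
  fixes \<phi> :: "complex^'n \<Rightarrow> real"
  assumes \<phi>: "C_k (Suc (Suc 0)) \<phi>"
begin

lemma continuous_weight: "continuous_on UNIV \<phi>"
  by (rule C_k_continuous[OF \<phi>])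

lemma measurable_weight [measurable]: "\<phi> \<in> borel_measurable borel"
  by (rule C_k_borel_measurable[OF \<phi>])

lemma weight_has_derivative:
  "(weight \<phi> has_derivative (\<lambda>v. - (weight \<phi> z * complex_of_real (dir_deriv v \<phi> z)))) (at z)"
proof -
  have "((\<lambda>z. exp (- \<phi> z)) has_derivative (\<lambda>v. - dir_deriv v \<phi> z * exp (- \<phi> z))) (at z)"
    by (rule has_derivative_exp[OF has_derivative_minus[OF C_k_Suc_has_derivative[OF \<phi>]]])
  from has_derivative_of_real[OF this] show ?thesis by (simp add: mult.commute)
qed

lemma C_1_weight: "C_k (Suc 0) (weight \<phi>)"
  by (rule C_k_SucI[OF weight_has_derivative])
    (auto intro!: continuous_intros continuous_weight C_k_continuous[OF C_k_Suc_dir_deriv[OF \<phi>]])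

lemma C_1_d_z_potential: "C_k (Suc 0) (d_z j (\<lambda>w. complex_of_real (\<phi> w)))"
  by (rule C_k_wirtinger(2)[OF C_k_of_real[OF \<phi>]])

lemma continuous_hess: "continuous_on UNIV (hess \<phi> j k)"
  by (rule C_k_continuous[OF C_k_wirtinger(1)[OF C_1_d_z_potential]])

lemma measurable_hess [measurable]: "hess \<phi> j k \<in> borel_measurable borel"
  by (rule borel_measurable_continuous_onI[OF continuous_hess])

lemma d_z_weight: "d_z j (weight \<phi>) z = - (weight \<phi> z * d_z j (\<lambda>w. complex_of_real (\<phi> w)) z)"
  by (simp add: d_z_def dir_deriv_eq[OF weight_has_derivative] fun_cong[OF dir_deriv_of_real[OF \<phi>]] field_simps)

lemma C_1_delta: "entire f \<Longrightarrow> C_k (Suc 0) (delta \<phi> j f)"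
  unfolding delta_def[abs_def] by (intro C_k_diff C_k_mult C_1_d_z_potential C_1_entire C_1_d_z_entire)

text \<open>Both f and its holomorphic derivative are annihilated by \<open>d_zbar k\<close>, so
  only the derivative of the potential term survives, a multiplication operator.\<close>

lemma d_zbar_delta:
  assumes f: "entire f"
  shows "d_zbar k (delta \<phi> j f) z = hess \<phi> j k z * f z"
proof -
  have "d_zbar k (d_z j f) z = 0"
    by (simp add: d_z_entire[OF f] d_zbar_entire[OF entire_dir_deriv[OF f]])
  thus ?thesis
    unfolding delta_def[abs_def]
    by (simp add: d_zbar_diff[OF C_k_mult[OF C_1_d_z_potential C_1_entire[OF f]] C_1_d_z_entire[OF f]]
      d_zbar_mult[OF C_1_d_z_potential C_1_entire[OF f]] d_zbar_entire[OF f])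
qed

text \<open>The divergence form of \<open>delta\<close>: it can now be moved to the other factor by
  integration by parts, as the adjoint of \<open>d_zbar j\<close> for the weight.\<close>

lemma d_z_weighted:
  assumes f: "entire f"
  shows "d_z j (\<lambda>z. f z * weight \<phi> z) z = - (delta \<phi> j f z * weight \<phi> z)"
  by (simp add: d_z_mult[OF C_1_entire[OF f] C_1_weight] d_z_weight delta_def algebra_simps)

text \<open>A Caccioppoli inequality. With D = \<open>delta \<phi> j f\<close> and \<chi> the
  cutoff, integration by parts moves the derivative hidden in one D onto \<chi>^2 times the
  conjugate of D. The resulting Hessian term is at most C |f|^2, and half of the left side absorbs
  the gradient term. The absorption is legitimate because the cutoff makes the left side finite
  before D is known to be square integrable.\<close>

lemma cutoff_delta_bound:
  assumes f: "entire f" "sq_int \<phi> f" and C: "\<And>j k z. cmod (hess \<phi> j k z) \<le> C" and R: "R \<ge> 1"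
  shows "(LINT z|lborel. (cutoff R z * cmod (delta \<phi> j f z))\<^sup>2 * exp (- \<phi> z))
     \<le> 2 * (32 + C) * (LINT z|lborel. (cmod (f z))\<^sup>2 * exp (- \<phi> z))"
proof -
  let ?G = "delta \<phi> j f"
  let ?X = "\<lambda>z. (cutoff R z * cmod (?G z))\<^sup>2 * exp (- \<phi> z)"
  \<comment> \<open>Two factors of the cutoff: after differentiation the gradient term still has one
    of them next to D, as absorption requires.\<close>
  define g where "g z = (complex_cutoff R z * complex_cutoff R z) * cnj (?G z)" for z
  have R0: "R > 0" using R by simp
  have Cc: "C_k (Suc 0) (\<lambda>z. complex_cutoff R z * complex_cutoff R z)" by (intro C_k_mult C_1_complex_cutoff)
  have Cg: "C_k (Suc 0) g" unfolding g_def by (intro C_k_mult C_1_complex_cutoff C_k_cnj C_1_delta f)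
  have g0: "g z = 0" if "norm z > R" for z using complex_cutoff_eq_0[OF R0 that] by (simp add: g_def)
  have Cfw: "C_k (Suc 0) (\<lambda>z. f z * weight \<phi> z)" by (intro C_k_mult C_1_entire f C_1_weight)
  have iX: "integrable lborel ?X"
    using C_k_continuous[OF C_1_cutoff] C_k_continuous[OF C_1_delta[OF f(1)]] continuous_weight cutoff_eq_0[OF R0]
    by (intro integrable_compact_support[where R=R]) (auto intro!: continuous_intros)
  have dg: "d_z j g z = 2 * complex_cutoff R z * d_z j (complex_cutoff R) z * cnj (?G z) + (complex_cutoff R z)\<^sup>2 * cnj (hess \<phi> j j z * f z)" for z
    unfolding g_def d_z_mult[OF Cc C_k_cnj[OF C_1_delta[OF f(1)]]] d_z_mult[OF C_1_complex_cutoff C_1_complex_cutoff]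
      d_z_cnj[OF C_1_delta[OF f(1)]] d_zbar_delta[OF f(1)]
    by (simp add: power2_eq_square algebra_simps)
  have "complex_of_real (?X z) = g z * (?G z * weight \<phi> z)" for z
    unfolding power_mult_distrib of_real_mult complex_norm_square g_def complex_cutoff_def
    by (simp add: power2_eq_square mult_ac)
  hence "complex_of_real (LINT z|lborel. ?X z) = (LINT z|lborel. g z * (?G z * weight \<phi> z))"
    unfolding integral_complex_of_real[symmetric] by presburger
  also have "\<dots> = - (LINT z|lborel. d_z j (\<lambda>z. f z * weight \<phi> z) z * g z)"
    by (simp add: d_z_weighted[OF f(1)] mult_ac)
  also have "\<dots> = (LINT z|lborel. (f z * weight \<phi> z) * d_z j g z)"
    by (rule integration_by_parts_d_z[OF Cfw Cg g0, symmetric])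
  finally have eq: "complex_of_real (LINT z|lborel. ?X z) = (LINT z|lborel. (f z * weight \<phi> z) * d_z j g z)" .
  let ?B = "\<lambda>z. 1/2 * ?X z + (32 + C) * ((cmod (f z))\<^sup>2 * exp (- \<phi> z))"
  have iB: "integrable lborel ?B" using iX f(2) by (simp add: sq_int_def)
  have "\<bar>LINT z|lborel. ?X z\<bar> = cmod (LINT z|lborel. (f z * weight \<phi> z) * d_z j g z)"
    unfolding eq[symmetric] by simp
  also have "\<dots> \<le> (LINT z|lborel. ?B z)"
  proof (rule Bochner_Integration.integral_norm_bound_integral[OF _ iB])
    show "integrable lborel (\<lambda>z. (f z * weight \<phi> z) * d_z j g z)"
    proof (rule integrable_compact_support[where R=R])
      show "continuous_on UNIV (\<lambda>z. (f z * weight \<phi> z) * d_z j g z)"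
        by (rule continuous_on_mult[OF C_k_continuous[OF Cfw] C_k_continuous[OF C_k_wirtinger(2)[OF Cg]]])
      show "(f z * weight \<phi> z) * d_z j g z = 0" if "norm z > R" for z
        using wirtinger_compact_support(2)[of R g z j] g0 that by simp
    qed
    fix z
    let ?c = "cutoff R z" and ?F = "cmod (f z)" and ?g = "cmod (?G z)" and ?d = "cmod (d_z j (complex_cutoff R) z)"
    have c: "0 \<le> ?c" "?c \<le> 1" by (rule cutoff_nonneg cutoff_le_1)+
    have "4 / R \<le> 4" using R by (simp add: divide_le_eq)
    hence d: "?d \<le> 4" using complex_cutoff_wirtinger_le(2)[OF R0, of j z] by linarith
    have C0: "0 \<le> C" using C norm_ge_zero order_trans by blast
    have "cmod (d_z j g z) \<le> 2 * ?c * ?d * ?g + ?c\<^sup>2 * (cmod (hess \<phi> j j z) * ?F)"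
      unfolding dg using c by (intro order_trans[OF norm_triangle_ineq]) (simp add: norm_mult norm_power complex_cutoff_def)
    also have "\<dots> \<le> 2 * ?c * 4 * ?g + 1 * (C * ?F)"
      using c d C C0 by (intro add_mono mult_mono power_le_one) auto
    finally have "?F * cmod (d_z j g z) \<le> ?F * (2 * ?c * 4 * ?g + 1 * (C * ?F))" by (rule mult_left_mono) simp
    \<comment> \<open>From (a - 8 b)^2 \<ge> 0 follows 8 a b \<le> a^2 / 2 + 32 b^2. The 8 is twice
      the gradient bound 4 / R \<le> 4; this is the origin of 32 in the statement.\<close>
    also have "\<dots> \<le> 1/2 * (?c * ?g)\<^sup>2 + (32 + C) * ?F\<^sup>2"
      using zero_le_power2[of "?c * ?g - 8 * ?F"] by (simp add: power2_eq_square algebra_simps)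
    finally have "?F * cmod (d_z j g z) * exp (- \<phi> z) \<le> (1/2 * (?c * ?g)\<^sup>2 + (32 + C) * ?F\<^sup>2) * exp (- \<phi> z)"
      by (rule mult_right_mono) simp
    thus "norm ((f z * weight \<phi> z) * d_z j g z) \<le> ?B z"
      by (simp add: norm_mult algebra_simps)
  qed
  also have "\<dots> = 1/2 * (LINT z|lborel. ?X z) + (32 + C) * (LINT z|lborel. (cmod (f z))\<^sup>2 * exp (- \<phi> z))"
    using iX f(2) by (simp add: sq_int_def)
  finally show ?thesis by (simp add: algebra_simps abs_if split: if_splits)
qed

text \<open>Fatou's lemma along cutoffs of radius n + 1, for which the previous bound is
  uniform.\<close>

lemma sq_int_delta:
  assumes f: "entire f" "sq_int \<phi> f" and C: "\<And>j k z. cmod (hess \<phi> j k z) \<le> C"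
  shows "sq_int \<phi> (delta \<phi> j f)"
proof -
  let ?G = "delta \<phi> j f"
  let ?X = "\<lambda>n z. (cutoff (real (Suc n)) z * cmod (?G z))\<^sup>2 * exp (- \<phi> z)"
  have [measurable]: "?G \<in> borel_measurable borel" by (rule C_k_borel_measurable[OF C_1_delta[OF f(1)]])
  have [measurable]: "cutoff R \<in> borel_measurable (borel :: (complex^'n) measure)" for R by (rule C_k_borel_measurable[OF C_1_cutoff])
  let ?B = "2 * (32 + C) * (LINT z|lborel. (cmod (f z))\<^sup>2 * exp (- \<phi> z))"
  have X: "(\<integral>\<^sup>+ z. ennreal (?X n z) \<partial>lborel) \<le> ennreal ?B" for n
  proof -
    have "integrable lborel (?X n)"
      using C_k_continuous[OF C_1_cutoff] C_k_continuous[OF C_1_delta[OF f(1)]] continuous_weight cutoff_eq_0[of "real (Suc n)"]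
      by (intro integrable_compact_support[where R="real (Suc n)"]) (auto intro!: continuous_intros)
    hence "(\<integral>\<^sup>+ z. ennreal (?X n z) \<partial>lborel) = ennreal (LINT z|lborel. ?X n z)"
      by (intro nn_integral_eq_integral) auto
    thus ?thesis using cutoff_delta_bound[OF f C, of "real (Suc n)" j] by (simp add: ennreal_leI)
  qed
  have lim: "(\<lambda>n. ennreal (?X n z)) \<longlonglongrightarrow> ennreal ((cmod (?G z))\<^sup>2 * exp (- \<phi> z))" for z
  proof -
    have X: "?X n z = (cutoff (real (Suc n)) z)\<^sup>2 * ((cmod (?G z))\<^sup>2 * exp (- \<phi> z))" for n by (simp add: power_mult_distrib)
    have "(\<lambda>n. (cutoff (real (Suc n)) z)\<^sup>2 * ((cmod (?G z))\<^sup>2 * exp (- \<phi> z))) \<longlonglongrightarrow> 1\<^sup>2 * ((cmod (?G z))\<^sup>2 * exp (- \<phi> z))"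
      by (intro tendsto_intros cutoff_tendsto)
    hence "?X 0 z = ?X 0 z \<and> (\<lambda>n. ?X n z) \<longlonglongrightarrow> (cmod (?G z))\<^sup>2 * exp (- \<phi> z)"
      unfolding X by simp
    thus ?thesis by (intro tendsto_ennrealI) blast
  qed
  have "(\<integral>\<^sup>+ z. ennreal ((cmod (?G z))\<^sup>2 * exp (- \<phi> z)) \<partial>lborel) = (\<integral>\<^sup>+ z. liminf (\<lambda>n. ennreal (?X n z)) \<partial>lborel)"
    using lim_imp_Liminf[OF _ lim] by simp
  also have "\<dots> \<le> liminf (\<lambda>n. \<integral>\<^sup>+ z. ennreal (?X n z) \<partial>lborel)" by (intro nn_integral_liminf) measurable
  also have "\<dots> \<le> liminf (\<lambda>n. ennreal ?B)" by (intro Liminf_mono always_eventually allI X)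
  also have "\<dots> = ennreal ?B" by (simp add: Liminf_const)
  finally have "(\<integral>\<^sup>+ z. ennreal ((cmod (?G z))\<^sup>2 * exp (- \<phi> z)) \<partial>lborel) < \<infinity>"
    by (simp add: le_less_trans)
  thus ?thesis unfolding sq_int_def by (auto intro!: integrableI_nonneg)
qed

end

section \<open>The forms \<open>f d\<zbar>\<^sub>J\<close> with holomorphic coefficient\<close>

lemma cnj_wedge_coeff [simp]: "cnj (wedge_coeff j J K) = wedge_coeff j J K"
  by (simp add: wedge_coeff_def)

lemma cmod_wedge_coeff_le: "cmod (wedge_coeff j J K) \<le> 1"
  by (simp add: wedge_coeff_def norm_power)

lemma bergman_space_iff: "f \<in> bergman_space \<phi> \<longleftrightarrow> entire f \<and> sq_int \<phi> f"
  using C_k_borel_measurable[OF C_1_entire] by (auto simp: bergman_space_def sq_int_def)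

definition single :: "'n set \<Rightarrow> (complex^'n \<Rightarrow> complex) \<Rightarrow> 'n form" where
  "single J f = (\<lambda>K. if K = J then f else 0)"

context
  fixes \<phi> :: "(complex, 'n::{finite,linorder}) vec \<Rightarrow> real" and J :: "'n set" and p :: nat and f and C :: real
  assumes \<phi>: "C_k (Suc (Suc 0)) \<phi>" and J: "card J = Suc p" and f: "entire f" "sq_int \<phi> f"
    and C: "\<And>j k z. cmod (hess \<phi> j k z) \<le> C"
begin

lemma single_L2: "single J f \<in> L2 \<phi> (Suc p)"
  using J f by (auto simp: L2_iff single_def zero_fun_def sq_int_zero[OF measurable_weight[OF \<phi>]])

text \<open>A term is nonzero only if J = insert j J', so each coefficient is, up to sign,
  \<delta>_j f for the index j deleted from J.\<close>

definition adjoint_form :: "'n form" where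
  "adjoint_form J' = (if card J' = p then (\<lambda>z. \<Sum>j\<in>UNIV. wedge_coeff j J' J * delta \<phi> j f z) else 0)"

text \<open>The \<open>dbar\<close> of \<open>adjoint_form\<close> after the commutation relation.
  No derivative of f is left, which is why a pointwise bound by |f| is possible.\<close>

definition laplacian_form :: "'n form" where
  "laplacian_form K = (if card K = Suc p then (\<lambda>z. \<Sum>J' | card J' = p. \<Sum>k\<in>UNIV. wedge_coeff k J' K *
     (\<Sum>j\<in>UNIV. wedge_coeff j J' J * (hess \<phi> j k z * f z))) else 0)"

lemma zero_L2: "0 \<in> L2 \<phi> q"
  by (simp add: L2_iff sq_int_zero[OF measurable_weight[OF \<phi>]] zero_fun_def)

lemma single_dbar: "(single J f, 0) \<in> dbar \<phi> (Suc p)"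
proof (rule dbar_C1[OF single_L2 zero_L2])
  show "C_k (Suc 0) (single J f K)" for K
    by (simp add: single_def C_1_entire f zero_fun_def C_k_const)
  have "d_zbar j (single J f K) z = 0" for j K z
    by (simp add: single_def d_zbar_entire f zero_fun_def d_zbar_const)
  thus "(0 :: 'n form) L z = (\<Sum>K | card K = Suc p. \<Sum>j\<in>UNIV. wedge_coeff j K L * d_zbar j (single J f K) z)" for L z
    by (simp add: zero_fun_def)
qed

lemma adjoint_form_L2: "adjoint_form \<in> L2 \<phi> p"
  unfolding L2_iff adjoint_form_def
  using sq_int_delta[OF \<phi> f C] measurable_weight[OF \<phi>] by (auto intro!: sq_int_sum sq_int_cmult)

lemma laplacian_form_bound:
  "cmod (laplacian_form K z) \<le> (\<Sum>J' :: 'n set | card J' = p. \<Sum>k::'n\<in>UNIV. \<Sum>j::'n\<in>UNIV. C) * cmod (f z)"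
proof -
  have C0: "0 \<le> C" using C norm_ge_zero order_trans by blast
  have 1: "cmod (wedge_coeff j J' J * (hess \<phi> j k z * f z)) \<le> C * cmod (f z)" for j k J'
    using cmod_wedge_coeff_le[of j J' J] C[of k j z] mult_mono[of "cmod (wedge_coeff j J' J)" 1 "cmod (hess \<phi> j k z) * cmod (f z)" "C * cmod (f z)"]
      mult_right_mono[of "cmod (hess \<phi> j k z)" C "cmod (f z)"] by (auto simp: norm_mult)
  have 2: "cmod (wedge_coeff k J' K * x) \<le> b" if "cmod x \<le> b" for k J' x b
    using mult_mono[OF cmod_wedge_coeff_le[of k J' K] that] by (simp add: norm_mult)
  have "cmod (\<Sum>J' | card J' = p. \<Sum>k\<in>UNIV. wedge_coeff k J' K * (\<Sum>j\<in>UNIV. wedge_coeff j J' J * (hess \<phi> j k z * f z)))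
    \<le> (\<Sum>J' :: 'n set | card J' = p. \<Sum>k::'n\<in>UNIV. \<Sum>j::'n\<in>UNIV. C * cmod (f z))"
    by (intro sum_norm_le 2 1)
  thus ?thesis using C0 by (auto simp: laplacian_form_def sum_distrib_right sum_nonneg)
qed

lemma laplacian_form_L2: "laplacian_form \<in> L2 \<phi> (Suc p)"
proof -
  have [measurable]: "f \<in> borel_measurable borel" using sq_int_measurable[OF f(2)] .
  note [measurable] = measurable_hess[OF \<phi>]
  have "laplacian_form K \<in> borel_measurable borel" for K
    unfolding laplacian_form_def zero_fun_def by (cases "card K = Suc p"; simp only: simp_thms if_True if_False; measurable)
  hence "sq_int \<phi> (laplacian_form K)" for K
    by (rule sq_int_bound(1)[OF measurable_weight[OF \<phi>] _ f(2) laplacian_form_bound])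
  moreover have "laplacian_form K = 0" if "card K \<noteq> Suc p" for K using that by (simp add: laplacian_form_def)
  ultimately show ?thesis by (simp add: L2_iff)
qed

lemma adjoint_form_dbar: "(adjoint_form, laplacian_form) \<in> dbar \<phi> p"
proof (rule dbar_C1[OF adjoint_form_L2 laplacian_form_L2])
  fix J' :: "'n set" assume J': "card J' = p"
  show "C_k (Suc 0) (adjoint_form J')"
    unfolding adjoint_form_def using J' by (simp add: C_k_sum C_k_mult C_k_const C_1_delta[OF \<phi> f(1)])
next
  fix K :: "'n set" and z assume K: "card K = Suc p"
  have "d_zbar k (adjoint_form J') z = (\<Sum>j\<in>UNIV. wedge_coeff j J' J * (hess \<phi> j k z * f z))" if "card J' = p" for J' k
  proof -
    have "d_zbar k (\<lambda>z. \<Sum>j\<in>UNIV. wedge_coeff j J' J * delta \<phi> j f z) z = (\<Sum>j\<in>UNIV. d_zbar k (\<lambda>z. wedge_coeff j J' J * delta \<phi> j f z) z)"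
      by (rule d_zbar_sum[where k=0]) (intro C_k_mult C_k_const C_1_delta[OF \<phi> f(1)])
    thus ?thesis using that
      by (simp add: adjoint_form_def d_zbar_cmult[OF C_1_delta[OF \<phi> f(1)]] d_zbar_delta[OF \<phi> f(1)])
  qed
  thus "laplacian_form K z = (\<Sum>J' | card J' = p. \<Sum>k\<in>UNIV. wedge_coeff k J' K * d_zbar k (adjoint_form J') z)"
    using K by (simp add: laplacian_form_def)
qed

lemma form_inner_single_right:
  "form_inner \<phi> (Suc p) w (single J f) = (LINT z|lborel. w J z * cnj (f z) * weight \<phi> z)"
proof -
  have "form_inner \<phi> (Suc p) w (single J f) = (\<Sum>K | card K = Suc p. if K = J then (LINT z|lborel. w J z * cnj (f z) * weight \<phi> z) else 0)"
    unfolding form_inner_def by (intro sum.cong) (auto simp: single_def)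
  thus ?thesis using J by (simp add: sum.delta)
qed

text \<open>The weak equation of an arbitrary pair (g, w) is tested with a cutoff times the
  conjugate of f e^{-\<phi>}. In the limit the gradient of the cutoff drops out, and the term with
  \<open>delta\<close> converges because \<open>delta \<phi> j f\<close> is square integrable. The
  sign of the weak derivative cancels the one in \<open>d_z_weighted\<close>.\<close>

lemma single_dbar_star: "(single J f, adjoint_form) \<in> dbar_star \<phi> p"
  unfolding dbar_star_def
proof (intro CollectI case_prodI conjI ballI single_L2 adjoint_form_L2)
  fix gw assume "gw \<in> dbar \<phi> p"
  then obtain g w where gw: "gw = (g, w)" "(g, w) \<in> dbar \<phi> p" by (cases gw) auto
  have g: "sq_int \<phi> (g J')" if "card J' = p" for J' using dbarD(1)[OF gw(2)] that by (simp add: L2_iff)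
  have w: "sq_int \<phi> (w J)" using dbarD(2)[OF gw(2)] J by (simp add: L2_iff)
  note [measurable] = measurable_weight[OF \<phi>]
  have D: "sq_int \<phi> (delta \<phi> j f)" for j using sq_int_delta[OF \<phi> f C] .
  let ?c = "\<lambda>n. complex_cutoff (real (Suc n)) :: (complex,'n) vec \<Rightarrow> complex"
  have cm [measurable]: "?c n \<in> borel_measurable borel" for n by (rule C_k_borel_measurable[OF C_1_complex_cutoff])
  have dm [measurable]: "d_zbar j (?c n) \<in> borel_measurable borel" for n j by (rule C_k_borel_measurable[OF C_k_wirtinger(1)[OF C_1_complex_cutoff]])
  let ?h = "\<lambda>z. cnj (f z * weight \<phi> z)"
  have Ch: "C_k (Suc 0) ?h" by (intro C_k_cnj C_k_mult C_1_entire f C_1_weight[OF \<phi>])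
  have dh: "d_zbar j ?h z = - (cnj (delta \<phi> j f z) * weight \<phi> z)" for j z
    by (simp add: d_zbar_cnj[OF C_k_mult[OF C_1_entire[OF f(1)] C_1_weight[OF \<phi>]]] d_z_weighted[OF \<phi> f(1)] del: complex_cnj_mult)
      simp
  define \<psi> where "\<psi> n z = ?c n z * ?h z" for n z
  have C\<psi>: "C_k (Suc 0) (\<psi> n)" for n unfolding \<psi>_def by (rule C_k_mult[OF C_1_complex_cutoff Ch])
  have \<psi>0: "\<psi> n z = 0" if "norm z > real (Suc n)" for n z unfolding \<psi>_def using that by (subst complex_cutoff_eq_0) auto
  have lhs: "(\<lambda>n. LINT z|lborel. w J z * \<psi> n z) \<longlonglongrightarrow> (LINT z|lborel. w J z * cnj (f z) * weight \<phi> z)"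
  proof -
    have "(\<lambda>n. LINT z|lborel. (?c n z * w J z) * cnj (f z) * weight \<phi> z) \<longlonglongrightarrow> (LINT z|lborel. (1 * w J z) * cnj (f z) * weight \<phi> z)"
    proof (rule sq_int_inner_tendsto[OF measurable_weight[OF \<phi>] w f(2), where C=1])
      show "(\<lambda>z. ?c n z * w J z) \<in> borel_measurable borel" for n using sq_int_measurable[OF w] by measurable
      show "(\<lambda>n. ?c n z * w J z) \<longlonglongrightarrow> 1 * w J z" for z by (intro tendsto_intros complex_cutoff_tendsto)
      show "cmod (?c n z * w J z) \<le> 1 * cmod (w J z)" for n z
        unfolding norm_mult by (intro mult_right_mono cmod_complex_cutoff_le) simp
    qed
    thus ?thesis by (simp add: \<psi>_def mult_ac)
  qed
  have rhs: "(\<lambda>n. LINT z|lborel. g J' z * d_zbar j (\<psi> n) z) \<longlonglongrightarrow> - (LINT z|lborel. g J' z * cnj (delta \<phi> j f z) * weight \<phi> z)"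
    if J': "card J' = p" for J' j
  proof -
    note gm [measurable] = sq_int_measurable[OF g[OF J']]
    have m [measurable]: "(\<lambda>z. ?c n z * g J' z) \<in> borel_measurable borel" "(\<lambda>z. d_zbar j (?c n) z * g J' z) \<in> borel_measurable borel" for n
      by measurable
    have s: "sq_int \<phi> (\<lambda>z. ?c n z * g J' z)" "sq_int \<phi> (\<lambda>z. d_zbar j (?c n) z * g J' z)" for n
    proof -
      show "sq_int \<phi> (\<lambda>z. ?c n z * g J' z)"
        by (rule sq_int_bound(1)[OF measurable_weight[OF \<phi>] m(1) g[OF J'], where C=1])
          (auto simp: norm_mult intro!: mult_left_le_one_le cmod_complex_cutoff_le)
      show "sq_int \<phi> (\<lambda>z. d_zbar j (?c n) z * g J' z)"
        by (rule sq_int_bound(1)[OF measurable_weight[OF \<phi>] m(2) g[OF J'], where C="4 / real (Suc n)"])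
          (unfold norm_mult, intro mult_right_mono complex_cutoff_wirtinger_le, simp_all)
    qed
    have 1: "(\<lambda>n. LINT z|lborel. (?c n z * g J' z) * cnj (delta \<phi> j f z) * weight \<phi> z) \<longlonglongrightarrow> (LINT z|lborel. (1 * g J' z) * cnj (delta \<phi> j f z) * weight \<phi> z)"
    proof (rule sq_int_inner_tendsto[OF measurable_weight[OF \<phi>] g[OF J'] D, where C=1])
      show "(\<lambda>z. ?c n z * g J' z) \<in> borel_measurable borel" for n by measurable
      show "(\<lambda>n. ?c n z * g J' z) \<longlonglongrightarrow> 1 * g J' z" for z by (intro tendsto_intros complex_cutoff_tendsto)
      show "cmod (?c n z * g J' z) \<le> 1 * cmod (g J' z)" for n z
        unfolding norm_mult by (intro mult_right_mono cmod_complex_cutoff_le) simp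
    qed
    have 2: "(\<lambda>n. LINT z|lborel. (d_zbar j (?c n) z * g J' z) * cnj (f z) * weight \<phi> z) \<longlonglongrightarrow> (LINT z|lborel. (0 * g J' z) * cnj (f z) * weight \<phi> z)"
    proof (rule sq_int_inner_tendsto[OF measurable_weight[OF \<phi>] g[OF J'] f(2), where C=4])
      show "(\<lambda>z. d_zbar j (?c n) z * g J' z) \<in> borel_measurable borel" for n by measurable
      show "(\<lambda>n. d_zbar j (?c n) z * g J' z) \<longlonglongrightarrow> 0 * g J' z" for z by (intro tendsto_intros d_zbar_complex_cutoff_tendsto)
      show "cmod (d_zbar j (?c n) z * g J' z) \<le> 4 * cmod (g J' z)" for n z
      proof -
        have "4 / real (Suc n) \<le> 4" by (simp add: divide_le_eq)
        thus ?thesis unfolding norm_mult using complex_cutoff_wirtinger_le(1)[of "real (Suc n)" j z] by (intro mult_right_mono) auto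
      qed
    qed
    have "(LINT z|lborel. g J' z * d_zbar j (\<psi> n) z) = (LINT z|lborel. (d_zbar j (?c n) z * g J' z) * cnj (f z) * weight \<phi> z)
       - (LINT z|lborel. (?c n z * g J' z) * cnj (delta \<phi> j f z) * weight \<phi> z)" for n
    proof -
      have "g J' z * d_zbar j (\<psi> n) z = (d_zbar j (?c n) z * g J' z) * cnj (f z) * weight \<phi> z - (?c n z * g J' z) * cnj (delta \<phi> j f z) * weight \<phi> z" for z
        unfolding \<psi>_def d_zbar_mult[OF C_1_complex_cutoff Ch] dh by (simp add: algebra_simps)
      thus ?thesis
        using sq_int_inner_integrable[OF measurable_weight[OF \<phi>] s(1)[of n] D[of j]] sq_int_inner_integrable[OF measurable_weight[OF \<phi>] s(2)[of n] f(2)]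
        by simp
    qed
    thus ?thesis using tendsto_diff[OF 2 1] by simp
  qed
  have "(\<lambda>n. \<Sum>J' | card J' = p. \<Sum>j\<in>UNIV. wedge_coeff j J' J * - (LINT z|lborel. g J' z * d_zbar j (\<psi> n) z))
     \<longlonglongrightarrow> (\<Sum>J' | card J' = p. \<Sum>j\<in>UNIV. wedge_coeff j J' J * - (- (LINT z|lborel. g J' z * cnj (delta \<phi> j f z) * weight \<phi> z)))"
    by (intro tendsto_intros rhs) auto
  moreover have "(\<Sum>J' | card J' = p. \<Sum>j\<in>UNIV. wedge_coeff j J' J * - (LINT z|lborel. g J' z * d_zbar j (\<psi> n) z)) = (LINT z|lborel. w J z * \<psi> n z)" for n
    by (rule dbar_weak_C1[OF continuous_weight[OF \<phi>] gw(2) C\<psi> \<psi>0 J, symmetric])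
  ultimately have "(LINT z|lborel. w J z * cnj (f z) * weight \<phi> z) =
     (\<Sum>J' | card J' = p. \<Sum>j\<in>UNIV. wedge_coeff j J' J * - (- (LINT z|lborel. g J' z * cnj (delta \<phi> j f z) * weight \<phi> z)))"
    using LIMSEQ_unique[OF lhs] by simp
  also have "\<dots> = form_inner \<phi> p g adjoint_form"
    unfolding form_inner_def
  proof (intro sum.cong refl)
    fix J' assume "J' \<in> {J' :: 'n set. card J' = p}"
    hence J': "card J' = p" by simp
    have "(LINT z|lborel. g J' z * cnj (adjoint_form J' z) * weight \<phi> z) = (LINT z|lborel. (\<Sum>j\<in>UNIV. wedge_coeff j J' J * (g J' z * cnj (delta \<phi> j f z) * weight \<phi> z)))"
      using J' by (simp add: adjoint_form_def sum_distrib_left sum_distrib_right mult_ac)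
    also have "\<dots> = (\<Sum>j\<in>UNIV. wedge_coeff j J' J * (LINT z|lborel. g J' z * cnj (delta \<phi> j f z) * weight \<phi> z))"
      using sq_int_inner_integrable[OF measurable_weight[OF \<phi>] g[OF J'] D] by (simp add: Bochner_Integration.integral_sum)
    finally show "(\<Sum>j\<in>UNIV. wedge_coeff j J' J * - (- (LINT z|lborel. g J' z * cnj (delta \<phi> j f z) * weight \<phi> z))) =
      (LINT z|lborel. g J' z * cnj (adjoint_form J' z) * weight \<phi> z)" by simp
  qed
  finally show "case gw of (g, w) \<Rightarrow> form_inner \<phi> (Suc p) w (single J f) = form_inner \<phi> p g adjoint_form"
    by (simp add: gw(1) form_inner_single_right)
qed

lemma single_laplacian: "(single J f, laplacian_form) \<in> complex_laplacian \<phi> (Suc p)"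
proof -
  have "(0, 0) \<in> dbar_star \<phi> (Suc p)"
    using zero_L2 by (auto simp: dbar_star_def form_inner_def zero_fun_def)
  hence "(single J f, 0) \<in> dbar \<phi> (Suc p) O dbar_star \<phi> (Suc p)" using single_dbar by blast
  moreover have "(single J f, laplacian_form) \<in> dbar_dbar_star \<phi> (Suc p)"
    using single_dbar_star adjoint_form_dbar by (auto simp: dbar_dbar_star_def)
  ultimately show ?thesis unfolding complex_laplacian_def by (intro CollectI exI[of _ "single J f"] exI[of _ laplacian_form] exI[of _ 0]) auto
qed

end

section \<open>Orthogonality to the kernel of the Laplacian\<close>

lemma form_inner_self:
  fixes u :: "'n::finite form"
  shows "form_inner \<phi> q u u = complex_of_real (\<Sum>J | card J = q. LINT z|lborel. (cmod (u J z))\<^sup>2 * exp (- \<phi> z))"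
proof -
  have "u J z * cnj (u J z) * weight \<phi> z = complex_of_real ((cmod (u J z))\<^sup>2 * exp (- \<phi> z))" for J z
    unfolding of_real_mult complex_norm_square ..
  thus ?thesis unfolding form_inner_def of_real_sum integral_complex_of_real[symmetric] by (simp only:)
qed

lemma form_norm_eq:
  fixes u :: "'n::finite form"
  shows "form_norm \<phi> q u = sqrt (\<Sum>J | card J = q. LINT z|lborel. (cmod (u J z))\<^sup>2 * exp (- \<phi> z))"
  by (simp add: form_norm_def form_inner_self)

lemma form_inner_commute: "form_inner \<phi> q v u = cnj (form_inner \<phi> q u v)"
proof -
  have "cnj (LINT z|lborel. u J z * cnj (v J z) * weight \<phi> z) = (LINT z|lborel. v J z * cnj (u J z) * weight \<phi> z)" for J
    unfolding Bochner_Integration.integral_cnj[symmetric] by (simp add: mult_ac)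
  thus ?thesis by (simp add: form_inner_def)
qed

text \<open>Pairing the equation for h with h itself makes the squared norms of its adjoint
  derivative c and of its \<open>dbar\<close> add up to zero. As forms are representatives modulo
  null sets, the outcome is a vanishing norm instead of c = 0.\<close>

lemma laplacian_kernel_adjoint:
  assumes h: "h \<in> laplacian_kernel \<phi> (Suc p)"
  obtains c where "(h, c) \<in> dbar_star \<phi> p" "form_inner \<phi> p c c = 0"
proof -
  obtain a b where ab: "a + b = 0" and a: "(h, a) \<in> dbar_star \<phi> p O dbar \<phi> p"
    and b: "(h, b) \<in> dbar \<phi> (Suc p) O dbar_star \<phi> (Suc p)"
    using h unfolding laplacian_kernel_def complex_laplacian_def dbar_dbar_star_def by auto
  obtain c where c: "(h, c) \<in> dbar_star \<phi> p" "(c, a) \<in> dbar \<phi> p" using a by auto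
  obtain r where r: "(h, r) \<in> dbar \<phi> (Suc p)" "(r, b) \<in> dbar_star \<phi> (Suc p)" using b by auto
  have 1: "form_inner \<phi> (Suc p) a h = form_inner \<phi> p c c" using c by (auto simp: dbar_star_def)
  have 2: "form_inner \<phi> (Suc (Suc p)) r r = form_inner \<phi> (Suc p) h b" using r by (auto simp: dbar_star_def)
  have "b K z = - a K z" for K z
    using fun_cong[OF fun_cong[OF ab, of K], of z] by (simp add: add_eq_0_iff zero_fun_def)
  hence "form_inner \<phi> (Suc p) b h = - form_inner \<phi> (Suc p) a h"
    by (simp add: form_inner_def sum_negf)
  hence "cnj (form_inner \<phi> (Suc (Suc p)) r r) = - form_inner \<phi> p c c"
    using 1 2 form_inner_commute[of \<phi> "Suc p" b h] by simp
  moreover define x where "x = (\<Sum>J | card J = p. LINT z|lborel. (cmod (c J z))\<^sup>2 * exp (- \<phi> z))"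
  moreover define y where "y = (\<Sum>J | card J = Suc (Suc p). LINT z|lborel. (cmod (r J z))\<^sup>2 * exp (- \<phi> z))"
  ultimately have "complex_of_real y = - complex_of_real x" by (simp add: form_inner_self)
  hence "y = - x" unfolding of_real_minus[symmetric] of_real_eq_iff .
  moreover have "x \<ge> 0" "y \<ge> 0" unfolding x_def y_def by (intro sum_nonneg integral_nonneg_AE; simp)+
  ultimately have "form_inner \<phi> p c c = 0" by (simp add: form_inner_self x_def)
  thus ?thesis using that c(1) by blast
qed

lemma form_inner_null:
  fixes \<phi> :: "complex^'n::finite \<Rightarrow> real"
  assumes c: "c \<in> L2 \<phi> p" and 0: "form_inner \<phi> p c c = 0"
  shows "form_inner \<phi> p g c = 0"
proof -
  have "(LINT z|lborel. (cmod (c J z))\<^sup>2 * exp (- \<phi> z)) = 0" if "card J = p" for J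
  proof -
    have "(\<Sum>J | card J = p. LINT z|lborel. (cmod (c J z))\<^sup>2 * exp (- \<phi> z)) = 0"
      using 0 unfolding form_inner_self of_real_eq_0_iff .
    thus ?thesis using that by (subst (asm) sum_nonneg_eq_0_iff) (auto intro!: integral_nonneg_AE)
  qed
  moreover have "integrable lborel (\<lambda>z. (cmod (c J z))\<^sup>2 * exp (- \<phi> z))" if "card J = p" for J
    using c that by (simp add: L2_def)
  ultimately have "AE z in lborel. (cmod (c J z))\<^sup>2 * exp (- \<phi> z) = 0" if "card J = p" for J
    using that by (subst integral_nonneg_eq_0_iff_AE[symmetric]) auto
  hence "(LINT z|lborel. g J z * cnj (c J z) * weight \<phi> z) = 0" if "card J = p" for J
    using that by (intro integral_eq_zero_AE) (fastforce elim: eventually_mono)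
  thus ?thesis by (simp add: form_inner_def)
qed

context
  fixes \<phi> :: "(complex, 'n::{finite,linorder}) vec \<Rightarrow> real" and J :: "'n set" and p :: nat and f
  assumes \<phi>: "C_k (Suc (Suc 0)) \<phi>" and J: "card J = Suc p" and f: "entire f" "sq_int \<phi> f"
begin

text \<open>Up to sign, \<open>f d\<zbar>\<^sub>J\<close> is the limit of the exact forms \<open>dbar (\<chi> \<zbar>\<^sub>i f d\<zbar>\<^sub>I)\<close> with \<open>J = insert i I\<close>:
  the gradient of the cutoff \<open>\<chi>\<close> is at most \<open>4 / \<bar>z\<bar>\<close>, which compensates the growth of \<open>\<zbar>\<^sub>i\<close>, so
  dominated convergence applies although \<open>\<zbar>\<^sub>i f\<close> need not be square integrable.\<close>

lemma single_orthogonal_kernel: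
  assumes h: "h \<in> laplacian_kernel \<phi> (Suc p)"
  shows "form_inner \<phi> (Suc p) (single J f) h = 0"
proof -
  note [measurable] = measurable_weight[OF \<phi>]
  obtain c where c: "(h, c) \<in> dbar_star \<phi> p" "form_inner \<phi> p c c = 0" using laplacian_kernel_adjoint[OF h] .
  have hL: "h \<in> L2 \<phi> (Suc p)" and cL: "c \<in> L2 \<phi> p" using c(1) by (auto simp: dbar_star_def)
  have exact: "form_inner \<phi> (Suc p) w h = 0" if "(g, w) \<in> dbar \<phi> p" for g w
    using c(1) that form_inner_null[OF cL c(2), of g] by (auto simp: dbar_star_def)
  have "J \<noteq> {}" using J by auto
  then obtain i where i: "i \<in> J" by blast
  define I where "I = J - {i}"
  have I: "card I = p" "i \<notin> I" "insert i I = J" using i J by (auto simp: I_def)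
  let ?c = "\<lambda>n. complex_cutoff (real (Suc n)) :: (complex,'n) vec \<Rightarrow> complex"
  \<comment> \<open>Among the \<open>d_zbar\<close> derivatives of F only the one in direction i is
    nonzero, and it equals f; hence the formal \<open>dbar\<close> of the form with coefficient F at
    I is f at J up to sign.\<close>
  define F where "F z = cnj (z $ i) * f z" for z
  have proj: "bounded_linear (\<lambda>z :: (complex,'n) vec. z $ i)" by (rule bounded_linear_vec_nth)
  have Cz: "C_k k (\<lambda>z :: (complex,'n) vec. cnj (z $ i))" for k
    by (rule C_k_cnj[OF C_k_linear[OF proj C_k_id]])
  have CF: "C_k (Suc 0) F" unfolding F_def by (intro C_k_mult Cz C_1_entire f)
  have dz: "d_zbar k (\<lambda>z :: (complex,'n) vec. cnj (z $ i)) z = (if k = i then 1 else 0)" for k z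
    by (simp add: d_zbar_def dir_deriv_eq[OF bounded_linear_imp_has_derivative[OF bounded_linear_compose[OF bounded_linear_cnj proj]]] axis_def)
  have dF: "d_zbar k F z = (if k = i then f z else 0)" for k z
    unfolding F_def by (simp add: d_zbar_mult[OF Cz C_1_entire[OF f(1)]] d_zbar_entire[OF f(1)] dz)
  define G where "G n = single I (\<lambda>z. ?c n z * F z)" for n
  define W where "W n K = (if card K = Suc p then (\<lambda>z. \<Sum>k\<in>UNIV. wedge_coeff k I K * (?c n z * d_zbar k F z + d_zbar k (?c n) z * F z)) else 0)" for n K
  have CG: "C_k (Suc 0) (\<lambda>z. ?c n z * F z)" for n by (intro C_k_mult C_1_complex_cutoff CF)
  have fm [measurable]: "f \<in> borel_measurable borel" by (rule sq_int_measurable[OF f(2)])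
  have Fm [measurable]: "F \<in> borel_measurable borel" by (rule C_k_borel_measurable[OF CF])
  have dFm [measurable]: "d_zbar k F \<in> borel_measurable borel" for k by (rule C_k_borel_measurable[OF C_k_wirtinger(1)[OF CF]])
  have cm [measurable]: "?c n \<in> borel_measurable borel" for n by (rule C_k_borel_measurable[OF C_1_complex_cutoff])
  have dm [measurable]: "d_zbar j (?c n) \<in> borel_measurable borel" for n j by (rule C_k_borel_measurable[OF C_k_wirtinger(1)[OF C_1_complex_cutoff]])
  have F_le: "cmod (F z) \<le> norm z * cmod (f z)" for z
    unfolding F_def norm_mult by (intro mult_right_mono) (auto intro: Finite_Cartesian_Product.norm_nth_le)
  have GL: "G n \<in> L2 \<phi> p" for n
  proof -
    have "sq_int \<phi> (\<lambda>z. ?c n z * F z)"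
    proof (rule sq_int_bound(1)[OF measurable_weight[OF \<phi>] _ f(2)])
      show "cmod (?c n z * F z) \<le> real (Suc n) * cmod (f z)" for z
      proof (cases "norm z > real (Suc n)")
        case True thus ?thesis by (subst complex_cutoff_eq_0) auto
      next
        case False
        have "cmod (?c n z * F z) \<le> 1 * (norm z * cmod (f z))"
          unfolding norm_mult by (intro mult_mono cmod_complex_cutoff_le F_le) auto
        also have "\<dots> \<le> 1 * (real (Suc n) * cmod (f z))" using False by (intro mult_left_mono mult_right_mono) auto
        finally show ?thesis by simp
      qed
    qed measurable
    thus ?thesis using I by (auto simp: L2_iff G_def single_def zero_fun_def sq_int_zero[OF measurable_weight[OF \<phi>]])
  qed
  \<comment> \<open>5 = 1 + 4: the cutoff itself, and |z| times its gradient. Unlike the bound for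
    \<open>G n\<close>, this one is uniform in n.\<close>
  have W_le: "cmod (W n K z) \<le> real CARD('n) * 5 * cmod (f z)" for n K z
  proof -
    have t: "cmod (wedge_coeff k I K * (?c n z * d_zbar k F z + d_zbar k (?c n) z * F z)) \<le> 5 * cmod (f z)" for k
    proof -
      have "cmod (?c n z * d_zbar k F z) \<le> 1 * cmod (f z)"
        unfolding norm_mult dF by (intro mult_mono cmod_complex_cutoff_le) auto
      moreover have "cmod (d_zbar k (?c n) z * F z) \<le> 4 * cmod (f z)"
      proof -
        have "cmod (d_zbar k (?c n) z * F z) \<le> cmod (d_zbar k (?c n) z) * (norm z * cmod (f z))"
          unfolding norm_mult by (intro mult_left_mono F_le) auto
        also have "\<dots> = (norm z * cmod (d_zbar k (?c n) z)) * cmod (f z)" by (simp add: mult_ac)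
        also have "\<dots> \<le> 4 * cmod (f z)" by (intro mult_right_mono complex_cutoff_wirtinger_le) auto
        finally show ?thesis .
      qed
      ultimately have "cmod (?c n z * d_zbar k F z + d_zbar k (?c n) z * F z) \<le> 5 * cmod (f z)"
        using norm_triangle_ineq[of "?c n z * d_zbar k F z" "d_zbar k (?c n) z * F z"] by linarith
      hence "cmod (wedge_coeff k I K) * cmod (?c n z * d_zbar k F z + d_zbar k (?c n) z * F z) \<le> 1 * (5 * cmod (f z))"
        by (intro mult_mono cmod_wedge_coeff_le) auto
      thus ?thesis by (simp add: norm_mult)
    qed
    have "cmod (\<Sum>k\<in>UNIV. wedge_coeff k I K * (?c n z * d_zbar k F z + d_zbar k (?c n) z * F z)) \<le> (\<Sum>k::'n\<in>UNIV. 5 * cmod (f z))"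
      by (rule sum_norm_le[OF t])
    thus ?thesis by (simp add: W_def)
  qed
  have Wm [measurable]: "W n K \<in> borel_measurable borel" for n K
    unfolding W_def zero_fun_def by (cases "card K = Suc p"; simp only: simp_thms if_True if_False; measurable)
  have WL: "W n \<in> L2 \<phi> (Suc p)" for n
    using sq_int_bound(1)[OF measurable_weight[OF \<phi>] Wm f(2) W_le] by (auto simp: L2_iff) (simp add: W_def)
  have GW: "(G n, W n) \<in> dbar \<phi> p" for n
  proof (rule dbar_C1[OF GL WL])
    show "C_k (Suc 0) (G n K)" for K
      using CG by (simp add: G_def single_def zero_fun_def C_k_const)
    fix K :: "'n set" and z assume K: "card K = Suc p"
    have "(\<Sum>J' | card J' = p. \<Sum>j\<in>UNIV. wedge_coeff j J' K * d_zbar j (G n J') z) =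
       (\<Sum>J' | card J' = p. if J' = I then \<Sum>j\<in>UNIV. wedge_coeff j I K * d_zbar j (G n I) z else 0)"
      by (intro sum.cong) (auto simp: G_def single_def zero_fun_def d_zbar_const)
    also have "\<dots> = (\<Sum>j\<in>UNIV. wedge_coeff j I K * d_zbar j (G n I) z)" using I by (simp add: sum.delta)
    also have "\<dots> = W n K z"
      using K by (simp add: W_def G_def single_def d_zbar_mult[OF C_1_complex_cutoff CF])
    finally show "W n K z = (\<Sum>J' | card J' = p. \<Sum>j\<in>UNIV. wedge_coeff j J' K * d_zbar j (G n J') z)" ..
  qed
  have "(\<lambda>n. form_inner \<phi> (Suc p) (W n) h) \<longlonglongrightarrow> (\<Sum>K | card K = Suc p. LINT z|lborel. (wedge_coeff i I K * f z) * cnj (h K z) * weight \<phi> z)"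
    unfolding form_inner_def
  proof (intro tendsto_sum)
    fix K assume "K \<in> {K :: 'n set. card K = Suc p}"
    hence K: "card K = Suc p" by simp
    have hK: "sq_int \<phi> (h K)" using hL K by (simp add: L2_iff)
    show "(\<lambda>n. LINT z|lborel. W n K z * cnj (h K z) * weight \<phi> z) \<longlonglongrightarrow> (LINT z|lborel. (wedge_coeff i I K * f z) * cnj (h K z) * weight \<phi> z)"
    proof (rule sq_int_inner_tendsto[OF measurable_weight[OF \<phi>] f(2) hK Wm _ W_le])
      fix z
      have "(\<lambda>n. \<Sum>k\<in>UNIV. wedge_coeff k I K * (?c n z * d_zbar k F z + d_zbar k (?c n) z * F z)) \<longlonglongrightarrow>
         (\<Sum>k\<in>UNIV. wedge_coeff k I K * (1 * d_zbar k F z + 0 * F z))"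
        by (intro tendsto_intros complex_cutoff_tendsto d_zbar_complex_cutoff_tendsto)
      also have "(\<Sum>k\<in>UNIV. wedge_coeff k I K * (1 * d_zbar k F z + 0 * F z)) = (\<Sum>k\<in>UNIV. if k = i then wedge_coeff i I K * f z else 0)"
        by (intro sum.cong) (auto simp: dF)
      also have "\<dots> = wedge_coeff i I K * f z" by simp
      finally show "(\<lambda>n. W n K z) \<longlonglongrightarrow> wedge_coeff i I K * f z" using K by (simp add: W_def)
    qed
  qed
  hence "(\<Sum>K | card K = Suc p. LINT z|lborel. (wedge_coeff i I K * f z) * cnj (h K z) * weight \<phi> z) = 0"
    using exact[OF GW] by (simp add: LIMSEQ_const_iff)
  \<comment> \<open>\<open>wedge_coeff i I K\<close> vanishes unless K = J, where it is a sign and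
    can be cancelled.\<close>
  also have "(\<Sum>K | card K = Suc p. LINT z|lborel. (wedge_coeff i I K * f z) * cnj (h K z) * weight \<phi> z) =
     (\<Sum>K | card K = Suc p. wedge_coeff i I J * (LINT z|lborel. single J f K z * cnj (h K z) * weight \<phi> z))"
    using I by (intro sum.cong) (auto simp: single_def wedge_coeff_def mult.assoc)
  also have "\<dots> = wedge_coeff i I J * form_inner \<phi> (Suc p) (single J f) h"
    by (simp add: form_inner_def sum_distrib_left)
  finally show ?thesis using I by (simp add: wedge_coeff_def)
qed

end

section \<open>Orthonormal sequences\<close>

definition weighted_norm_sq :: "(complex^'n \<Rightarrow> real) \<Rightarrow> (complex^'n \<Rightarrow> complex) \<Rightarrow> real" where
  "weighted_norm_sq \<phi> f = (LINT z|lborel. (cmod (f z))\<^sup>2 * exp (- \<phi> z))"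

definition weighted_inner :: "(complex^'n \<Rightarrow> real) \<Rightarrow> (complex^'n \<Rightarrow> complex) \<Rightarrow> (complex^'n \<Rightarrow> complex) \<Rightarrow> complex" where
  "weighted_inner \<phi> f g = (LINT z|lborel. f z * cnj (g z) * weight \<phi> z)"

lemma weighted_inner_self: "weighted_inner \<phi> f f = complex_of_real (weighted_norm_sq \<phi> f)"
proof -
  have "f z * cnj (f z) * weight \<phi> z = complex_of_real ((cmod (f z))\<^sup>2 * exp (- \<phi> z))" for z
    unfolding of_real_mult complex_norm_square ..
  thus ?thesis unfolding weighted_inner_def weighted_norm_sq_def integral_complex_of_real[symmetric] by (simp only:)
qed

lemma weighted_inner_commute: "weighted_inner \<phi> g f = cnj (weighted_inner \<phi> f g)"
  unfolding weighted_inner_def Bochner_Integration.integral_cnj[symmetric] by (simp add: mult_ac)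

lemma weighted_inner_cmult: "weighted_inner \<phi> (\<lambda>z. c * f z) g = c * weighted_inner \<phi> f g"
  unfolding weighted_inner_def by (simp add: mult.assoc)

lemma sum_apply_fun: "(\<Sum>i\<in>I. f i) x = (\<Sum>i\<in>I. f i x)"
  by (induction I rule: infinite_finite_induct) auto

lemma entire_cmult: "entire f \<Longrightarrow> entire (\<lambda>z. c * f z)"
  unfolding entire_def
proof
  fix z assume "\<forall>z. \<exists>f'. (f has_derivative f') (at z) \<and> (\<forall>c h. f' (c *s h) = c * f' h)"
  then obtain f' where "(f has_derivative f') (at z)" "\<forall>c h. f' (c *s h) = c * f' h" by blast
  thus "\<exists>f'. ((\<lambda>z. c * f z) has_derivative f') (at z) \<and> (\<forall>d h. f' (d *s h) = d * f' h)"
    by (intro exI[of _ "\<lambda>h. c * f' h"]) (auto intro: has_derivative_mult_right)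
qed

lemma entire_add: "entire f \<Longrightarrow> entire g \<Longrightarrow> entire (\<lambda>z. f z + g z)"
  unfolding entire_def
proof
  fix z assume "\<forall>z. \<exists>f'. (f has_derivative f') (at z) \<and> (\<forall>c h. f' (c *s h) = c * f' h)"
    "\<forall>z. \<exists>f'. (g has_derivative f') (at z) \<and> (\<forall>c h. f' (c *s h) = c * f' h)"
  then obtain f' g' where "(f has_derivative f') (at z)" "\<forall>c h. f' (c *s h) = c * f' h"
     "(g has_derivative g') (at z)" "\<forall>c h. g' (c *s h) = c * g' h" by blast
  thus "\<exists>f'. ((\<lambda>z. f z + g z) has_derivative f') (at z) \<and> (\<forall>d h. f' (d *s h) = d * f' h)"
    by (intro exI[of _ "\<lambda>h. f' h + g' h"]) (auto intro: has_derivative_add simp: distrib_left)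
qed

context
  fixes \<phi> :: "complex^'n \<Rightarrow> real"
  assumes \<phi>: "continuous_on UNIV \<phi>"
begin

lemma weight_measurable [measurable]: "\<phi> \<in> borel_measurable borel"
  by (rule borel_measurable_continuous_onI[OF \<phi>])

lemma bergman_space_cmult: "f \<in> bergman_space \<phi> \<Longrightarrow> (\<lambda>z. c * f z) \<in> bergman_space \<phi>"
  by (simp add: bergman_space_iff entire_cmult sq_int_cmult[OF weight_measurable])

lemma bergman_space_add: "f \<in> bergman_space \<phi> \<Longrightarrow> g \<in> bergman_space \<phi> \<Longrightarrow> (\<lambda>z. f z + g z) \<in> bergman_space \<phi>"
  by (simp add: bergman_space_iff entire_add sq_int_add[OF weight_measurable])

lemma bergman_space_diff: "f \<in> bergman_space \<phi> \<Longrightarrow> g \<in> bergman_space \<phi> \<Longrightarrow> (\<lambda>z. f z - g z) \<in> bergman_space \<phi>"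
  using bergman_space_add[of f "\<lambda>z. (-1) * g z"] bergman_space_cmult[of g "-1"] by simp

lemma bergman_space_sum:
  assumes "finite I" "I \<noteq> {}" "\<And>i. i \<in> I \<Longrightarrow> f i \<in> bergman_space \<phi>"
  shows "(\<lambda>z. \<Sum>i\<in>I. f i z) \<in> bergman_space \<phi>"
  using assms by (induction I rule: finite_ne_induct) (auto intro: bergman_space_add)

lemma weighted_inner_diff:
  assumes "sq_int \<phi> f" "sq_int \<phi> g" "sq_int \<phi> h"
  shows "weighted_inner \<phi> (\<lambda>z. f z - g z) h = weighted_inner \<phi> f h - weighted_inner \<phi> g h"
  using sq_int_inner_integrable[OF weight_measurable assms(1,3)] sq_int_inner_integrable[OF weight_measurable assms(2,3)]
  by (simp add: weighted_inner_def left_diff_distrib)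

lemma weighted_inner_sum:
  assumes "\<And>i. i \<in> I \<Longrightarrow> sq_int \<phi> (f i)" "sq_int \<phi> h"
  shows "weighted_inner \<phi> (\<lambda>z. \<Sum>i\<in>I. f i z) h = (\<Sum>i\<in>I. weighted_inner \<phi> (f i) h)"
  using sq_int_inner_integrable[OF weight_measurable assms(1) assms(2)]
  by (simp add: weighted_inner_def sum_distrib_right Bochner_Integration.integral_sum)

text \<open>An entire function is continuous, and a nonempty open set is not a null set; on the
  Bergman space the seminorm is a norm without passing to classes.\<close>

lemma weighted_norm_sq_eq_0:
  assumes f: "f \<in> bergman_space \<phi>" and 0: "weighted_norm_sq \<phi> f = 0"
  shows "f z = 0"
proof -
  have "AE z in lborel. f z = 0"
    using f 0 unfolding weighted_norm_sq_def by (subst (asm) integral_nonneg_eq_0_iff_AE) (auto simp: bergman_space_def)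
  hence "AE z in lborel. z \<notin> {z. f z \<noteq> 0}" by simp
  moreover have "open {z. f z \<noteq> 0}"
    using C_k_continuous[OF C_1_entire, of f] f
    by (intro open_Collect_neq) (auto simp: bergman_space_def)
  ultimately show ?thesis using AE_lborel_notin_open by blast
qed

text \<open>Gram-Schmidt by dependent choice: finitely many chosen vectors never span the space, so
  there is always a further g outside their span.\<close>

lemma orthonormal_sequence:
  assumes inf: "infinite_dimensional (bergman_space \<phi>)"
  obtains e where "\<And>n::nat. e n \<in> bergman_space \<phi>" "\<And>n. weighted_inner \<phi> (e n) (e n) = 1"
    "\<And>m n. m < n \<Longrightarrow> weighted_inner \<phi> (e n) (e m) = 0"
proof -
  let ?P = "\<lambda>e (n::nat) f. f \<in> bergman_space \<phi> \<and> weighted_inner \<phi> f f = 1 \<and> (\<forall>m<n. weighted_inner \<phi> f (e m) = 0)"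
  have "\<exists>e. \<forall>n. ?P e n (e n)"
  proof (rule dependent_wellorder_choice)
    fix n :: nat and e assume e: "\<And>m. m < n \<Longrightarrow> ?P e m (e m)"
    have eB: "e m \<in> bergman_space \<phi>" if "m < n" for m using e that by auto
    hence es: "sq_int \<phi> (e m)" if "m < n" for m using that by (simp add: bergman_space_iff)
    have "\<not> bergman_space \<phi> \<subseteq> cfun.span (e ` {..<n})"
      using inf eB unfolding infinite_dimensional_def by (metis finite_imageI finite_lessThan image_subset_iff lessThan_iff)
    then obtain g where g: "g \<in> bergman_space \<phi>" "g \<notin> cfun.span (e ` {..<n})" by blast
    have gs: "sq_int \<phi> g" using g by (simp add: bergman_space_iff)
    \<comment> \<open>The orthogonal projection of g to the span of the earlier vectors; g lies
      outside the span, so the difference \<open>h\<close> is not zero.\<close>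
    define s where "s z = (\<Sum>m<n. weighted_inner \<phi> g (e m) * e m z)" for z
    have ss: "sq_int \<phi> s" unfolding s_def
      by (intro sq_int_sum[OF weight_measurable] sq_int_cmult[OF weight_measurable] es) auto
    \<comment> \<open>For n = 0 the projection is an empty sum, and \<open>bergman_space_sum\<close>
      covers nonempty ones.\<close>
    have "entire (\<lambda>z. 0)" unfolding entire_def by (intro allI exI[of _ "\<lambda>_. 0"]) auto
    hence sB: "s \<in> bergman_space \<phi>"
      using bergman_space_sum[of "{..<n}" "\<lambda>m z. weighted_inner \<phi> g (e m) * e m z"] eB bergman_space_cmult sq_int_zero[OF weight_measurable]
      unfolding s_def by (cases n) (auto simp: bergman_space_iff)
    have span: "s \<in> cfun.span (e ` {..<n})"
    proof -
      have "s = (\<Sum>m<n. (\<lambda>z. weighted_inner \<phi> g (e m) * e m z))"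
        by (auto simp: s_def fun_eq_iff sum_apply_fun)
      thus ?thesis by (simp only:) (intro cfun.span_sum cfun.span_scale cfun.span_base; auto)
    qed
    define h where "h z = g z - s z" for z
    have hB: "h \<in> bergman_space \<phi>" unfolding h_def by (intro bergman_space_diff g sB)
    have orth: "weighted_inner \<phi> (e m) (e l) = (if m = l then 1 else 0)" if "m < n" "l < n" for m l
    proof (cases m l rule: linorder_cases)
      case less
      hence "weighted_inner \<phi> (e l) (e m) = 0" using e[OF that(2)] by auto
      thus ?thesis using weighted_inner_commute[of \<phi> "e m" "e l"] less by simp
    qed (use e[OF that(1)] in auto)
    have h_orth: "weighted_inner \<phi> h (e l) = 0" if l: "l < n" for l
    proof -
      have "weighted_inner \<phi> s (e l) = (\<Sum>m<n. weighted_inner \<phi> g (e m) * weighted_inner \<phi> (e m) (e l))"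
        unfolding s_def by (subst weighted_inner_sum) (auto simp: weighted_inner_cmult intro!: sq_int_cmult[OF weight_measurable] es l)
      also have "\<dots> = (\<Sum>m<n. if m = l then weighted_inner \<phi> g (e l) else 0)"
        using l by (intro sum.cong) (auto simp: orth)
      also have "\<dots> = weighted_inner \<phi> g (e l)" using l by simp
      finally show ?thesis unfolding h_def by (simp add: weighted_inner_diff[OF gs ss es[OF l]])
    qed
    have "weighted_norm_sq \<phi> h \<noteq> 0"
    proof
      assume "weighted_norm_sq \<phi> h = 0"
      hence "g = s" using weighted_norm_sq_eq_0[OF hB] by (auto simp: h_def fun_eq_iff)
      thus False using g(2) span by simp
    qed
    moreover have "weighted_norm_sq \<phi> h \<ge> 0" unfolding weighted_norm_sq_def by (intro integral_nonneg_AE) auto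
    ultimately have pos: "weighted_norm_sq \<phi> h > 0" by simp
    define r where "r = complex_of_real (1 / sqrt (weighted_norm_sq \<phi> h))"
    have "weighted_inner \<phi> (\<lambda>z. r * h z) (\<lambda>z. r * h z) = r * cnj r * weighted_inner \<phi> h h"
      using weighted_inner_commute[of \<phi> h "\<lambda>z. r * h z"] weighted_inner_commute[of \<phi> h h] by (simp add: weighted_inner_cmult)
    also have "\<dots> = complex_of_real ((1 / sqrt (weighted_norm_sq \<phi> h)) * (1 / sqrt (weighted_norm_sq \<phi> h)) * weighted_norm_sq \<phi> h)"
      by (simp only: r_def weighted_inner_self complex_cnj_complex_of_real of_real_mult)
    also have "\<dots> = 1" using pos by simp
    finally show "\<exists>f. ?P e n f"
      using bergman_space_cmult[OF hB, of r] h_orth by (intro exI[of _ "\<lambda>z. r * h z"]) (simp add: weighted_inner_cmult)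
  qed auto
  thus ?thesis using that by blast
qed

lemma weighted_norm_sq_orthonormal_diff:
  assumes "sq_int \<phi> f" "sq_int \<phi> g" "weighted_inner \<phi> f f = 1" "weighted_inner \<phi> g g = 1" "weighted_inner \<phi> f g = 0"
  shows "weighted_norm_sq \<phi> (\<lambda>z. f z - g z) = 2"
proof -
  have s: "sq_int \<phi> (\<lambda>z. f z - g z)" by (rule sq_int_diff[OF weight_measurable assms(1,2)])
  have "complex_of_real (weighted_norm_sq \<phi> (\<lambda>z. f z - g z)) = weighted_inner \<phi> f (\<lambda>z. f z - g z) - weighted_inner \<phi> g (\<lambda>z. f z - g z)"
    unfolding weighted_inner_self[symmetric] by (rule weighted_inner_diff[OF assms(1,2) s])
  also have "\<dots> = cnj (weighted_inner \<phi> (\<lambda>z. f z - g z) f) - cnj (weighted_inner \<phi> (\<lambda>z. f z - g z) g)"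
    using weighted_inner_commute[of \<phi> f] weighted_inner_commute[of \<phi> g] by simp
  also have "\<dots> = 2"
    using assms weighted_inner_commute[of \<phi> g f] by (simp add: weighted_inner_diff)
  finally show ?thesis by (metis of_real_eq_iff of_real_numeral)
qed

end

section \<open>The contradiction between compactness and an orthonormal sequence\<close>

theorem theorem3p1:
  fixes \<phi> :: "complex^'n::{finite,linorder} \<Rightarrow> real"
  assumes "C_k 2 \<phi>"
    and "plurisubharmonic \<phi>"
    and "infinite_dimensional (bergman_space \<phi>)"
    and "\<exists>q. 1 \<le> q \<and> q \<le> CARD('n) \<and> neumann_compact \<phi> q"
  shows "Limsup at_infinity (\<lambda>z. ereal (Re (trace (complex_hessian \<phi> z)))) = \<infinity>"
proof (rule ccontr)
  assume ls: "\<not> ?thesis"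
  have \<phi>: "C_k (Suc (Suc 0)) \<phi>" using assms(1) by (simp add: numeral_2_eq_2)
  note c\<phi> = continuous_weight[OF \<phi>]
  note m\<phi> = measurable_weight[OF \<phi>]
  obtain C where "C > 0" and C: "\<And>j k z. cmod (hess \<phi> j k z) \<le> C"
    by (rule hessian_bounded[OF \<phi> assms(2) ls]) (rule that)
  obtain p where p: "Suc p \<le> CARD('n)" "neumann_compact \<phi> (Suc p)"
    using assms(4) by (auto simp: Suc_le_eq gr0_conv_Suc)
  \<comment> \<open>The lower bound on the degree has made it a successor, so that there is an
    adjoint to degree p; the upper bound provides J.\<close>
  obtain J :: "'n set" where J: "card J = Suc p" using obtain_subset_with_card_n[OF p(1)] by blast
  obtain T where ext: "neumann_extension \<phi> (Suc p) T" and Tcomp: "compact_operator \<phi> (Suc p) T"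
    using p(2) unfolding neumann_compact_def by blast
  have T: "form_eq (T f) u" if "(f, u) \<in> neumann_operator \<phi> (Suc p)" for f u
    using ext that by (auto simp: neumann_extension_def)
  have TL: "T u \<in> L2 \<phi> (Suc p)" if "u \<in> L2 \<phi> (Suc p)" for u
    using Tcomp that by (simp add: compact_operator_def bounded_operator_def)
  have Tc: "\<exists>r w. strict_mono r \<and> w \<in> L2 \<phi> (Suc p) \<and> (\<lambda>k. form_norm \<phi> (Suc p) (T (u (r k)) - w)) \<longlonglongrightarrow> 0"
    if "\<And>k. u k \<in> L2 \<phi> (Suc p) \<and> form_norm \<phi> (Suc p) (u k) \<le> 1" for u :: "nat \<Rightarrow> 'n form"
    using Tcomp[unfolded compact_operator_def, THEN conjunct2, THEN spec[of _ u]] that by blast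
  obtain e where e: "\<And>n::nat. e n \<in> bergman_space \<phi>" "\<And>n. weighted_inner \<phi> (e n) (e n) = 1"
    "\<And>m n. m < n \<Longrightarrow> weighted_inner \<phi> (e n) (e m) = 0"
    by (rule orthonormal_sequence[OF c\<phi> assms(3)]) (rule that)
  \<comment> \<open>The pointwise factor of \<open>laplacian_form_bound\<close>: C times the number
    of triples (J', k, j).\<close>
  define A where "A = (\<Sum>J' :: 'n set | card J' = p. \<Sum>k::'n\<in>UNIV. \<Sum>j::'n\<in>UNIV. C)"
  \<comment> \<open>Bounds the norm of the Laplacian of \<open>single J (e n)\<close>, summed over
    all coefficients K; the added 1 makes it positive for the division.\<close>
  define B where "B = sqrt (\<Sum>K :: 'n set | card K = Suc p. A\<^sup>2) + 1"
  have B: "B > 0" "(\<Sum>K :: 'n set | card K = Suc p. A\<^sup>2) \<le> B\<^sup>2"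
  proof -
    have s: "(\<Sum>K :: 'n set | card K = Suc p. A\<^sup>2) \<ge> 0" by (intro sum_nonneg) simp
    thus "B > 0" unfolding B_def using real_sqrt_ge_zero[OF s] by linarith
    have "(sqrt (\<Sum>K :: 'n set | card K = Suc p. A\<^sup>2))\<^sup>2 \<le> B\<^sup>2"
      unfolding B_def using s by (intro power_mono) auto
    thus "(\<Sum>K :: 'n set | card K = Suc p. A\<^sup>2) \<le> B\<^sup>2" using s by simp
  qed
  \<comment> \<open>The scaling puts the Laplacians \<open>?b n\<close> into the unit ball, where
    compactness is formulated.\<close>
  define f where "f n = (\<lambda>z. complex_of_real (1 / B) * e n z)" for n
  have fB: "f n \<in> bergman_space \<phi>" for n unfolding f_def by (rule bergman_space_cmult[OF c\<phi> e(1)])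
  have f: "entire (f n)" "sq_int \<phi> (f n)" for n using fB[of n] by (simp_all add: bergman_space_iff)
  have es: "sq_int \<phi> (e n)" for n using e(1)[of n] by (simp add: bergman_space_iff)
  have we: "weighted_norm_sq \<phi> (e n) = 1" for n using e(2)[of n] unfolding weighted_inner_self by (metis of_real_eq_1_iff)
  have wf: "weighted_norm_sq \<phi> (f n) = (1 / B)\<^sup>2" for n
    using we[of n] by (simp add: weighted_norm_sq_def f_def norm_mult norm_divide power_mult_distrib power_divide)
  let ?b = "\<lambda>n. laplacian_form \<phi> J p (f n)"
  have bL: "?b n \<in> L2 \<phi> (Suc p)" for n by (rule laplacian_form_L2[OF \<phi> J f C])
  have bN: "form_norm \<phi> (Suc p) (?b n) \<le> 1" for n
  proof -
    have "(\<Sum>K :: 'n set | card K = Suc p. LINT z|lborel. (cmod (?b n K z))\<^sup>2 * exp (- \<phi> z)) \<le> (\<Sum>K :: 'n set | card K = Suc p. A\<^sup>2 * weighted_norm_sq \<phi> (f n))"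
    proof (intro sum_mono)
      fix K assume "K \<in> {K :: 'n set. card K = Suc p}"
      hence "?b n K \<in> borel_measurable borel" using bL[of n] by (simp add: L2_def)
      thus "(LINT z|lborel. (cmod (?b n K z))\<^sup>2 * exp (- \<phi> z)) \<le> A\<^sup>2 * weighted_norm_sq \<phi> (f n)"
        unfolding weighted_norm_sq_def A_def by (rule sq_int_bound(2)[OF m\<phi> _ f(2) laplacian_form_bound[OF \<phi> J f C]])
    qed
    also have "\<dots> = (\<Sum>K :: 'n set | card K = Suc p. A\<^sup>2) * (1 / B)\<^sup>2" by (simp add: wf sum_distrib_right)
    also have "\<dots> \<le> B\<^sup>2 * (1 / B)\<^sup>2" by (intro mult_right_mono B(2)) simp
    also have "\<dots> = 1" using B(1) by (simp add: power_divide)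
    finally show ?thesis by (simp add: form_norm_eq)
  qed
  \<comment> \<open>The pair of \<open>?b n\<close> and \<open>single J (f n)\<close> lies in the
    Neumann graph, so coefficient J of the compact image is \<open>f n\<close> up to a null
    set.\<close>
  have Tb: "AE z in lborel. T (?b n) J z = f n z" for n
  proof -
    have "(?b n, single J (f n)) \<in> neumann_operator \<phi> (Suc p)"
      unfolding neumann_operator_def
      using single_laplacian[OF \<phi> J f C] single_orthogonal_kernel[OF \<phi> J f] by auto
    from T[OF this, unfolded form_eq_def, THEN spec[of _ J]] show ?thesis by (simp add: single_def)
  qed
  obtain r w where r: "strict_mono r" and w: "w \<in> L2 \<phi> (Suc p)"
    and lim: "(\<lambda>k. form_norm \<phi> (Suc p) (T (?b (r k)) - w)) \<longlonglongrightarrow> 0"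
    using Tc[of ?b] bL bN by blast
  have wJ: "sq_int \<phi> (w J)" using w J by (simp add: L2_iff)
  have bound: "weighted_norm_sq \<phi> (\<lambda>z. f n z - w J z) \<le> (form_norm \<phi> (Suc p) (T (?b n) - w))\<^sup>2" for n
  proof -
    have tJ: "sq_int \<phi> (T (?b n) J)" using TL[OF bL[of n]] J by (simp add: L2_iff)
    note [measurable] = m\<phi> sq_int_measurable[OF wJ] sq_int_measurable[OF tJ] sq_int_measurable[OF f(2)]
    have "weighted_norm_sq \<phi> (\<lambda>z. f n z - w J z) = (LINT z|lborel. (cmod ((T (?b n) - w) J z))\<^sup>2 * exp (- \<phi> z))"
      unfolding weighted_norm_sq_def by (rule integral_cong_AE) (use Tb[of n] in \<open>auto elim!: eventually_mono\<close>)
    also have "\<dots> \<le> (\<Sum>K | card K = Suc p. LINT z|lborel. (cmod ((T (?b n) - w) K z))\<^sup>2 * exp (- \<phi> z))"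
      using J by (intro member_le_sum[where f="\<lambda>K. LINT z|lborel. (cmod ((T (?b n) - w) K z))\<^sup>2 * exp (- \<phi> z)"]) (auto intro!: integral_nonneg_AE)
    also have "\<dots> = (form_norm \<phi> (Suc p) (T (?b n) - w))\<^sup>2"
      unfolding form_norm_eq by (subst real_sqrt_pow2) (auto intro!: sum_nonneg integral_nonneg_AE)
    finally show ?thesis .
  qed
  \<comment> \<open>With the threshold 1 / (2 B) the inequality |a + b|^2 \<le> 2 |a|^2 + 2 |b|^2
    gives less than 1 / B^2, whereas distinct members of the scaled orthonormal sequence have
    squared distance 2 / B^2.\<close>
  have "eventually (\<lambda>k. form_norm \<phi> (Suc p) (T (?b (r k)) - w) < 1 / (2 * B)) sequentially"
    using order_tendstoD(2)[OF lim, of "1 / (2 * B)"] B(1) by simp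
  then obtain N where N: "\<And>k. k \<ge> N \<Longrightarrow> form_norm \<phi> (Suc p) (T (?b (r k)) - w) < 1 / (2 * B)"
    by (auto simp: eventually_sequentially)
  have small: "weighted_norm_sq \<phi> (\<lambda>z. f (r k) z - w J z) < (1 / (2 * B))\<^sup>2" if "k \<ge> N" for k
  proof -
    have "(form_norm \<phi> (Suc p) (T (?b (r k)) - w))\<^sup>2 < (1 / (2 * B))\<^sup>2"
      using N[OF that] by (intro power_strict_mono) (auto simp: form_norm_eq intro!: sum_nonneg integral_nonneg_AE)
    thus ?thesis using bound[of "r k"] by linarith
  qed
  define m where "m = r N"
  define n where "n = r (Suc N)"
  have mn: "m < n" using r by (simp add: m_def n_def strict_mono_less)
  have sm: "sq_int \<phi> (\<lambda>z. w J z - f m z)" and sn: "sq_int \<phi> (\<lambda>z. f n z - w J z)"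
    by (intro sq_int_diff[OF m\<phi>] f wJ)+
  have "weighted_norm_sq \<phi> (\<lambda>z. e n z - e m z) = 2"
    using weighted_norm_sq_orthonormal_diff[OF c\<phi> es es e(2) e(2) e(3)[OF mn]] .
  hence "(1 / B)\<^sup>2 * 2 = weighted_norm_sq \<phi> (\<lambda>z. f n z - f m z)"
    by (simp add: weighted_norm_sq_def f_def norm_mult norm_divide power_mult_distrib power_divide flip: right_diff_distrib diff_divide_distrib)
  also have "\<dots> = weighted_norm_sq \<phi> (\<lambda>z. (f n z - w J z) + (w J z - f m z))" by simp
  also have "\<dots> \<le> 2 * weighted_norm_sq \<phi> (\<lambda>z. f n z - w J z) + 2 * weighted_norm_sq \<phi> (\<lambda>z. w J z - f m z)"
    unfolding weighted_norm_sq_def by (rule sq_int_add(2)[OF m\<phi> sn sm])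
  also have "weighted_norm_sq \<phi> (\<lambda>z. w J z - f m z) = weighted_norm_sq \<phi> (\<lambda>z. f m z - w J z)"
    by (simp add: weighted_norm_sq_def norm_minus_commute)
  also have "2 * weighted_norm_sq \<phi> (\<lambda>z. f n z - w J z) + 2 * weighted_norm_sq \<phi> (\<lambda>z. f m z - w J z) < 4 * (1 / (2 * B))\<^sup>2"
    using small[of N] small[of "Suc N"] by (simp add: m_def n_def)
  also have "\<dots> = (1 / B)\<^sup>2" by (simp add: power_divide power_mult_distrib)
  finally show False using B(1) by simp
qed

end
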